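(* Let $f\in\mathbb C[u_1,u_1^{-1},\dots,u_n,u_n^{-1}]$ be a Laurent polynomial which is convenient and nondegenerate with respect to its Newton polyhedron. Then the Newton filtration $\mathcal N_\bullet G_0$ on the Brieskorn lattice of $f$ coincides with the filtration $G_0\cap V_\bullet G$ induced on $G_0$ by the Malgrange-Kashiwara filtration $V_\bullet G$, i.e. $\mathcal N_\alpha G_0=G_0\cap V_\alpha G$ for every $\alpha\in\mathbb Q$.
   Context: Let $U=(\mathbb C^* )^n$, $\frac{du}{u}=\frac{du_1}{u_1}\wedge\cdots\wedge\frac{du_n}{u_n}$, and $\Omega^k(U)$ the algebraic $k$-forms on $U$. For $f=\sum_ka_ku^k$, $\Gamma(f)\subset\mathbb R^n$ is the convex hull of $\{k\neq0:a_k\ne0\}$. $f$ is convenient if $0$ is in the interior of $\Gamma(f)$; nondegenerate if for every proper face $\Delta$ of $\Gamma(f)$, with $f_\Delta=\sum_{k\in\Delta}a_ku^k$, the functions $u_i\partial f_\Delta/\partial u_i$ ($1\le i\le n$) have no common zero in $(\mathbb C^* )^n$. Gauss-Manin system and Brieskorn lattice: $\theta=\tau^{-1}$, $G=\Omega^n(U)[\tau,\tau^{-1}]/(d-\tau df\wedge)\Omega^{n-1}(U)[\tau,\tau^{-1}]$, with $\partial_\tau$ acting by $\partial_\tau[\omega\tau^k]=[k\omega\tau^{k-1}-f\omega\tau^k]$ for $\omega\in\Omega^n(U)$; $G_0$ is the image of $\Omega^n(U)[\theta]$ in $G$. Newton filtration: for each $(n-1)$-dimensional face $\sigma$ of $\partial\Gamma(f)$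 let $L_\sigma$ be the linear form with $L_\sigma\equiv1$ on $\sigma$; for $g\in\mathbb C[u,u^{-1}]$ put $\phi_\sigma(g)=\max L_\sigma(a)$ over exponents $a$ of monomials appearing in $g$, and $\phi(g)=\max_\sigma\phi_\sigma(g)$ ($\phi(0)=-\infty$). $\mathcal N_\alpha\Omega^n(U)=\{g\,du/u:\phi(g)\le\alpha\}$ for $\alpha\in\mathbb Q$, $\mathcal N_\alpha\Omega^n(U)[\theta]=\sum_{k\ge0}\theta^k\mathcal N_{\alpha-k}\Omega^n(U)$, and $\mathcal N_\alpha G_0$ is the image of $\mathcal N_\alpha\Omega^n(U)[\theta]$ in $G_0$. Malgrange-Kashiwara filtration: let $V_{-k}\mathbb C[\tau]\langle\partial_\tau\rangle=\tau^k\mathbb C[\tau]\langle\tau\partial_\tau\rangle$ ($k\ge0$), $V_k=V_{k-1}+\partial_\tau V_{k-1}$ ($k\ge1$). $V_\bullet G$ is the unique increasing exhaustive filtration of $G$, indexed by a union of finitely many sets $\alpha+\mathbb Z\subset\mathbb Q$, such that each $V_{\alpha+\mathbb Z}G$ is good with respect to $V_\bullet\mathbb C[\tau]\langle\partial_\tau\rangle$ and $\tau\partial_\tau+\beta$ is nilpotent on $\mathrm{gr}^V_\beta G=V_\beta G/V_{<\beta}G$ for every $\beta\in\mathbb Q$. *)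

theory Defs
  imports "HOL-Analysis.Analysis" "HOL-Library.Poly_Mapping"
begin

text \<open>
  \<^bold>\<open>Laurent polynomials.\<close>  The coordinates \<open>u\<^sub>i\<close> are indexed by a finite type \<open>'n\<close>, so
  \<open>n = CARD('n)\<close>.  The ring of Laurent polynomials is the group ring of \<open>\<int>\<^sup>n\<close> over the complex
  numbers; its product is the convolution product of \<^typ>\<open>'a \<Rightarrow>\<^sub>0 'b\<close>.
\<close>

type_synonym 'n laurent = "(int, 'n) vec \<Rightarrow>\<^sub>0 complex"

definition eval_laurent :: "'n::finite laurent \<Rightarrow> complex ^ 'n \<Rightarrow> complex" where
  "eval_laurent g u =
     (\<Sum>k\<in>Poly_Mapping.keys g. Poly_Mapping.lookup g k * (\<Prod>i\<in>UNIV. (u $ i) powi (k $ i)))"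

text \<open>The derivation \<open>u\<^sub>i \<partial>/\<partial>u\<^sub>i\<close>, which sends \<open>u\<^sup>k\<close> to \<open>k\<^sub>i u\<^sup>k\<close>.\<close>

definition log_deriv :: "'n::finite \<Rightarrow> 'n laurent \<Rightarrow> 'n laurent" where
  "log_deriv i g = Poly_Mapping.mapp (\<lambda>k c. of_int (k $ i) * c) g"

definition real_exponent :: "(int, 'n::finite) vec \<Rightarrow> real ^ 'n" where
  "real_exponent k = (\<chi> i. real_of_int (k $ i))"

definition newton_polytope :: "'n::finite laurent \<Rightarrow> (real ^ 'n) set" where
  "newton_polytope f = convex hull (real_exponent ` (Poly_Mapping.keys f - {0}))"

definition convenient :: "'n::finite laurent \<Rightarrow> bool" where
  "convenient f \<longleftrightarrow> 0 \<in> interior (newton_polytope f)"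

definition face_part :: "'n::finite laurent \<Rightarrow> (real ^ 'n) set \<Rightarrow> 'n laurent" where
  "face_part f D =
     (\<Sum>k\<in>{k \<in> Poly_Mapping.keys f. real_exponent k \<in> D}.
        Poly_Mapping.single k (Poly_Mapping.lookup f k))"

text \<open>In the library the empty set is a face of every convex set; it is not meant here.\<close>

definition nondegenerate :: "'n::finite laurent \<Rightarrow> bool" where
  "nondegenerate f \<longleftrightarrow>
     (\<forall>D. D face_of newton_polytope f \<and> D \<noteq> newton_polytope f \<and> D \<noteq> {} \<longrightarrow>
        \<not> (\<exists>u. (\<forall>i. u $ i \<noteq> 0) \<and> (\<forall>i. eval_laurent (log_deriv i (face_part f D)) u = 0)))"

text \<open>
  \<^bold>\<open>Algebraic differential forms on the torus.\<close>  The module of all forms is free over the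
  Laurent polynomials on the elements \<open>du\<^sub>I/u\<^sub>I\<close>, where for \<open>I = {i\<^sub>1 < \<dots> < i\<^sub>k}\<close> this denotes
  \<open>du\<^bsub>i\<^sub>1\<^esub>/u\<^bsub>i\<^sub>1\<^esub> \<and> \<dots> \<and> du\<^bsub>i\<^sub>k\<^esub>/u\<^bsub>i\<^sub>k\<^esub>\<close>.  A form is the family of its coordinates, indexed by the subsets
  \<open>I\<close> of the index type.  The linear order on \<open>'n\<close> is used only to fix the signs.
\<close>

type_synonym 'n form = "('n laurent, 'n set) vec"

definition k_forms :: "nat \<Rightarrow> 'n::finite form set" where
  "k_forms k = {\<omega>. \<forall>I. card I \<noteq> k \<longrightarrow> \<omega> $ I = 0}"

definition fun_form :: "'n::finite laurent \<Rightarrow> 'n form" where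
  "fun_form g = axis {} g"

definition vol_form :: "'n::finite form" where
  "vol_form = axis UNIV 1"

definition wedge :: "'n::{finite,linorder} form \<Rightarrow> 'n form \<Rightarrow> 'n form" where
  "wedge \<omega> \<eta> = (\<chi> J. \<Sum>I\<in>Pow J.
      (-1) ^ card {(i, j). i \<in> I \<and> j \<in> J - I \<and> j < i} * (\<omega> $ I) * (\<eta> $ (J - I)))"

text \<open>Since \<open>du\<^sub>I/u\<^sub>I\<close> is closed,
  \<open>d(g du\<^sub>I/u\<^sub>I)\<close> is the sum over \<open>i\<close> of \<open>(u\<^sub>i \<partial>g/\<partial>u\<^sub>i) du\<^sub>i/u\<^sub>i \<and> du\<^sub>I/u\<^sub>I\<close>.\<close>

definition ext_deriv :: "'n::{finite,linorder} form \<Rightarrow> 'n form" where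
  "ext_deriv \<omega> =
     (\<chi> J. \<Sum>i\<in>J. (-1) ^ card {j \<in> J. j < i} * log_deriv i (\<omega> $ (J - {i})))"

text \<open>
  \<^bold>\<open>The Gauss-Manin system.\<close>  An element of \<open>\<Omega>\<^sup>k(U)[\<tau>,\<tau>\<^sup>-\<^sup>1]\<close> is a finitely supported family of
  \<open>k\<close>-forms indexed by the exponent of \<open>\<tau>\<close>; thus \<open>\<omega> \<tau>\<^sup>m\<close> is \<open>Poly_Mapping.single m \<omega>\<close>.
\<close>

type_synonym 'n tau_form = "int \<Rightarrow>\<^sub>0 'n form"

definition tau_forms :: "nat \<Rightarrow> 'n::finite tau_form set" where
  "tau_forms k = {p. \<forall>m. Poly_Mapping.lookup p m \<in> k_forms k}"

definition twisted_d :: "'n::{finite,linorder} laurent \<Rightarrow> 'n tau_form \<Rightarrow> 'n tau_form" where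
  "twisted_d f p =
     (\<Sum>m\<in>Poly_Mapping.keys p.
        Poly_Mapping.single m (ext_deriv (Poly_Mapping.lookup p m))
      - Poly_Mapping.single (m + 1)
          (wedge (ext_deriv (fun_form f)) (Poly_Mapping.lookup p m)))"

definition gm_relations :: "'n::{finite,linorder} laurent \<Rightarrow> 'n tau_form set" where
  "gm_relations f = twisted_d f ` tau_forms (CARD('n) - 1)"

definition gm_class :: "'n::{finite,linorder} laurent \<Rightarrow> 'n tau_form \<Rightarrow> 'n tau_form set" where
  "gm_class f p = {p + w | w. w \<in> gm_relations f}"

definition gauss_manin :: "'n::{finite,linorder} laurent \<Rightarrow> 'n tau_form set set" where
  "gauss_manin f = gm_class f ` tau_forms CARD('n)"

definition theta_forms :: "'n::finite tau_form set" where
  "theta_forms = {p \<in> tau_forms CARD('n). \<forall>m>0. Poly_Mapping.lookup p m = 0}"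

definition brieskorn :: "'n::{finite,linorder} laurent \<Rightarrow> 'n tau_form set set" where
  "brieskorn f = gm_class f ` theta_forms"

text \<open>
  \<^bold>\<open>Action of the Weyl algebra.\<close>  The operators below make \<open>\<Omega>\<^sup>n(U)[\<tau>,\<tau>\<^sup>-\<^sup>1]\<close> a left module over
  \<open>\<complex>[\<tau>]\<langle>\<partial>\<^sub>\<tau>\<rangle>\<close> (they satisfy \<open>[\<partial>\<^sub>\<tau>, \<tau>] = 1\<close>), the subspace \<open>gm_relations\<close> is a submodule, and the
  action on the Gauss-Manin system is the induced one: \<open>P [p] = [P p]\<close>.  The Weyl algebra
  being simple, it is isomorphic to the algebra generated by these operators; its elements
  and the pieces \<open>V\<^sub>k\<close> of its filtration are represented by operators.
\<close>

definition gm_scale :: "complex \<Rightarrow> 'n::finite tau_form \<Rightarrow> 'n tau_form" where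
  "gm_scale c p = Poly_Mapping.map (\<lambda>\<omega>. Poly_Mapping.single 0 c *s \<omega>) p"

definition gm_tau :: "'n::finite tau_form \<Rightarrow> 'n tau_form" where
  "gm_tau p =
     (\<Sum>m\<in>Poly_Mapping.keys p. Poly_Mapping.single (m + 1) (Poly_Mapping.lookup p m))"

definition gm_dtau :: "'n::finite laurent \<Rightarrow> 'n tau_form \<Rightarrow> 'n tau_form" where
  "gm_dtau f p =
     (\<Sum>m\<in>Poly_Mapping.keys p.
        Poly_Mapping.single (m - 1) (of_int m *s Poly_Mapping.lookup p m)
      - Poly_Mapping.single m (f *s Poly_Mapping.lookup p m))"

text \<open>The algebra \<open>\<complex>[\<tau>]\<langle>\<tau>\<partial>\<^sub>\<tau>\<rangle>\<close> generated by \<open>\<tau>\<close> and \<open>\<tau>\<partial>\<^sub>\<tau>\<close>.\<close>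

inductive_set weyl_V0 :: "'n::finite laurent \<Rightarrow> ('n tau_form \<Rightarrow> 'n tau_form) set"
  for f :: "'n::finite laurent" where
  const: "gm_scale c \<in> weyl_V0 f"
| tau: "gm_tau \<in> weyl_V0 f"
| euler: "gm_tau \<circ> gm_dtau f \<in> weyl_V0 f"
| add: "P \<in> weyl_V0 f \<Longrightarrow> Q \<in> weyl_V0 f \<Longrightarrow> (\<lambda>p. P p + Q p) \<in> weyl_V0 f"
| mult: "P \<in> weyl_V0 f \<Longrightarrow> Q \<in> weyl_V0 f \<Longrightarrow> P \<circ> Q \<in> weyl_V0 f"

primrec weyl_V_pos ::
  "'n::finite laurent \<Rightarrow> nat \<Rightarrow> ('n tau_form \<Rightarrow> 'n tau_form) set" where
  "weyl_V_pos f 0 = weyl_V0 f"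
| "weyl_V_pos f (Suc k) =
     {\<lambda>p. P p + gm_dtau f (Q p) | P Q. P \<in> weyl_V_pos f k \<and> Q \<in> weyl_V_pos f k}"

definition weyl_V :: "'n::finite laurent \<Rightarrow> int \<Rightarrow> ('n tau_form \<Rightarrow> 'n tau_form) set" where
  "weyl_V f k =
     (if k \<le> 0 then {(gm_tau ^^ nat (- k)) \<circ> P | P. P \<in> weyl_V0 f}
      else weyl_V_pos f (nat k))"

text \<open>
  \<^bold>\<open>The Malgrange-Kashiwara filtration.\<close>  An increasing filtration \<open>U\<close> indexed by the integers
  is good with respect to \<open>V\<close> if it is generated by finitely many elements \<open>x\<^sub>j = [m\<^sub>j]\<close> placed in
  degrees \<open>l\<^sub>j\<close>: \<open>U\<^sub>k\<close> is the sum over \<open>j\<close> of \<open>V\<^bsub>k - l\<^sub>j\<^esub> x\<^sub>j\<close>, for all \<open>k\<close>.  In particular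
  \<open>V\<^sub>k U\<^sub>l \<subseteq> U\<^bsub>k + l\<^esub>\<close>.
\<close>

definition good_filtration ::
  "'n::{finite,linorder} laurent \<Rightarrow> (int \<Rightarrow> 'n tau_form set set) \<Rightarrow> bool" where
  "good_filtration f U \<longleftrightarrow>
     (\<exists>(r::nat) m (l :: nat \<Rightarrow> int).
        (\<forall>j<r. m j \<in> tau_forms CARD('n)) \<and>
        (\<forall>k. U k = {gm_class f (\<Sum>j<r. P j (m j)) | P. \<forall>j<r. P j \<in> weyl_V f (k - l j)}))"

text \<open>
  A filtration indexed by the union of the sets \<open>\<alpha> + \<int>\<close>, for \<open>\<alpha>\<close> in a finite set \<open>A\<close>, is
  extended to all rational indices by \<open>V\<^sub>\<beta> = \<Union>{V\<^sub>\<gamma> | \<gamma> \<le> \<beta>}\<close>, \<open>\<gamma>\<close> running through the index set.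
\<close>

definition is_MK_filtration ::
  "'n::{finite,linorder} laurent \<Rightarrow> (rat \<Rightarrow> 'n tau_form set set) \<Rightarrow> bool" where
  "is_MK_filtration f V \<longleftrightarrow>
     mono V \<and>
     (\<Union>\<beta>. V \<beta>) = gauss_manin f \<and>
     (\<exists>A. finite A \<and>
        (\<forall>\<beta>. V \<beta> = \<Union>{V (\<alpha> + of_int k) | \<alpha> k. \<alpha> \<in> A \<and> \<alpha> + of_int k \<le> \<beta>}) \<and>
        (\<forall>\<alpha>\<in>A. good_filtration f (\<lambda>k. V (\<alpha> + of_int k)))) \<and>
     (\<forall>\<beta>. \<exists>N::nat. \<forall>p\<in>tau_forms CARD('n). gm_class f p \<in> V \<beta> \<longrightarrow>
        gm_class f (((\<lambda>q. gm_tau (gm_dtau f q) + gm_scale (of_rat \<beta>) q) ^^ N) p)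
          \<in> (\<Union>\<gamma>\<in>{..<\<beta>}. V \<gamma>))"

definition MK_filtration ::
  "'n::{finite,linorder} laurent \<Rightarrow> rat \<Rightarrow> 'n tau_form set set" where
  "MK_filtration f = (THE V. is_MK_filtration f V)"

text \<open>
  \<^bold>\<open>The Newton filtration.\<close>  The suprema below are taken in the extended reals over finite sets,
  hence are maxima, except that the supremum of the empty set is \<open>-\<infinity>\<close>, so that \<open>\<phi>(0) = -\<infinity>\<close>.
\<close>

definition newton_facets :: "'n::finite laurent \<Rightarrow> (real ^ 'n) set set" where
  "newton_facets f =
     {\<sigma>. \<sigma> face_of newton_polytope f \<and> aff_dim \<sigma> = int CARD('n) - 1}"

definition facet_form :: "(real ^ 'n::finite) set \<Rightarrow> real ^ 'n \<Rightarrow> real" where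
  "facet_form \<sigma> = (THE L. linear L \<and> (\<forall>x\<in>\<sigma>. L x = 1))"

definition newton_order_facet ::
  "(real ^ 'n::finite) set \<Rightarrow> 'n laurent \<Rightarrow> ereal" where
  "newton_order_facet \<sigma> g =
     (SUP a\<in>Poly_Mapping.keys g. ereal (facet_form \<sigma> (real_exponent a)))"

definition newton_order :: "'n::finite laurent \<Rightarrow> 'n laurent \<Rightarrow> ereal" where
  "newton_order f g = (SUP \<sigma>\<in>newton_facets f. newton_order_facet \<sigma> g)"

definition newton_forms :: "'n::finite laurent \<Rightarrow> rat \<Rightarrow> 'n form set" where
  "newton_forms f \<alpha> = {g *s vol_form | g. newton_order f g \<le> ereal (real_of_rat \<alpha>)}"

definition newton_theta_forms :: "'n::finite laurent \<Rightarrow> rat \<Rightarrow> 'n tau_form set" where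
  "newton_theta_forms f \<alpha> =
     {(\<Sum>k\<le>K. Poly_Mapping.single (- int k) (\<omega> k)) | (K::nat) \<omega>.
        \<forall>k\<le>K. \<omega> k \<in> newton_forms f (\<alpha> - of_nat k)}"

definition newton_brieskorn ::
  "'n::{finite,linorder} laurent \<Rightarrow> rat \<Rightarrow> 'n tau_form set set" where
  "newton_brieskorn f \<alpha> = gm_class f ` newton_theta_forms f \<alpha>"

end

theory Submission
  imports Defs "HOL-Computational_Algebra.Fundamental_Theorem_Algebra"
begin

text \<open>
  Homogenise \<open>f\<close> by a variable \<open>t\<close>: the Laurent polynomials of Newton order at most \<open>T\<close> become the degree
  \<open>T\<close> part of the semigroup ring of the cone \<open>C\<close> over \<open>\<Gamma>(f)\<close>.  The Koszul complex of the functions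
  \<open>t u\<^sub>i \<partial>f/\<partial>u\<^sub>i\<close> on \<open>\<complex>[C] / t \<complex>[C]\<close> is exact below degree \<open>n\<close> and has finite cokernel.  To see this
  without Cohen-Macaulay theory, filter the monomials of \<open>C - (t + C)\<close>, sliced by a generic vector, into
  half-open translates of faces of \<open>C\<close>.  On each face nondegeneracy and the Nullstellensatz express a power
  of an interior monomial through the \<open>t u\<^sub>i \<partial>f/\<partial>u\<^sub>i\<close>, so that multiplication by this monomial is
  homotopic to zero, and one can induct on the dimension of the face.

  Consequently \<open>df \<and>\<close> is strict for the Newton filtration, and the filtration that the Newton order
  induces on all of \<open>G\<close> is good.  If \<open>u\<^sup>a\<close> has order \<open>\<alpha>\<close>, then \<open>\<tau>\<partial>\<^sub>\<tau> + \<alpha>\<close> maps it to monomials lying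
  in the cones over fewer facets, hence is nilpotent on the graded pieces.  By the uniqueness of the
  Malgrange-Kashiwara filtration the two filtrations of \<open>G\<close> agree.  Strictness of \<open>df \<and>\<close> finally allows one to
  choose representatives without positive powers of \<open>\<tau>\<close> for elements of \<open>G\<^sub>0\<close>.
\<close>

section \<open>Finitely supported functions\<close>

text \<open>\<open>MK_filtration\<close> is given only by a characterization, so it is identified by
  exhibiting the Newton filtration as a candidate that satisfies it; this also supplies existence.
  Orders lie in (1/M)\<int> for a common denominator M of the facet forms, and an integer T stands
  for the order T/M. The algebra over the cone serves two purposes: exactness gives strictness of df
  and exactness in form degree n - 1, the finite cokernel gives finitely many generators over \<tau>
  and \<open>\<tau>\<partial>\<^sub>\<tau>\<close>. Generation by
  \<open>\<partial>\<^sub>\<tau>\<close> in high steps has another source, the identity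
  \<open>\<tau>\<partial>\<^sub>\<tau> + \<beta> = \<partial>\<^sub>\<tau>\<tau> + (\<beta> -
  1)\<close>, whose scalar is invertible for \<beta> \<noteq> 1. In the induction over faces, sets
  of lattice points S' \<subseteq> S replace modules, and a face of dimension d yields exactness
  below degree d: dividing by an interior monomial loses one dimension, and the homotopy regains it
  as a degree. Without the generic shift a slice could be a union of several faces. For the whole
  cone, of dimension n + 1, t replaces the interior monomial and no homotopy follows, so exactness
  is obtained below degree n.\<close>

abbreviation (input) "pkeys \<equiv> Poly_Mapping.keys"
abbreviation (input) "plookup \<equiv> Poly_Mapping.lookup"
abbreviation (input) "psingle \<equiv> Poly_Mapping.single"

definition pm_restrict :: "'e set \<Rightarrow> ('e \<Rightarrow>\<^sub>0 'c) \<Rightarrow> ('e \<Rightarrow>\<^sub>0 'c::zero)" where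
  "pm_restrict X g = Poly_Mapping.mapp (\<lambda>k c. if k \<in> X then c else 0) g"

lemma lookup_pm_restrict: "plookup (pm_restrict X g) k = (if k \<in> X then plookup g k else 0)"
  by (auto simp: pm_restrict_def lookup_mapp when_def in_keys_iff)

lemma keys_pm_restrict: "pkeys (pm_restrict X g) = pkeys g \<inter> X"
  by (auto simp: in_keys_iff lookup_pm_restrict split: if_splits)

lemma keys_uminus_pm [simp]: "pkeys (- g) = pkeys (g :: 'e \<Rightarrow>\<^sub>0 'c::ab_group_add)"
  by (auto simp: in_keys_iff)

lemma keys_subset_add: "pkeys g \<subseteq> S \<Longrightarrow> pkeys h \<subseteq> S \<Longrightarrow> pkeys (g + h) \<subseteq> S"
  using keys_add[of g h] by blast

lemma keys_subset_diff:
  "pkeys g \<subseteq> S \<Longrightarrow> pkeys h \<subseteq> S \<Longrightarrow> pkeys (g - (h :: 'e \<Rightarrow>\<^sub>0 'c::ab_group_add)) \<subseteq> S"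
  using keys_subset_add[of g S "-h"] by simp

lemma keys_subset_sum: "(\<And>i. i \<in> I \<Longrightarrow> pkeys (g i) \<subseteq> S) \<Longrightarrow> pkeys (sum g I) \<subseteq> S"
  by (induction I rule: infinite_finite_induct) (simp_all add: keys_subset_add)

lemma keys_subset_mult:
  "pkeys g \<subseteq> S \<Longrightarrow> pkeys h \<subseteq> T \<Longrightarrow> (\<And>a b. a \<in> S \<Longrightarrow> b \<in> T \<Longrightarrow> a + b \<in> U) \<Longrightarrow> pkeys (g * h) \<subseteq> U"
  using keys_mult[of g h] by fastforce

lemma poly_mapping_sum_single: "g = (\<Sum>k\<in>pkeys g. psingle k (plookup g k))"
proof (rule poly_mapping_eqI)
  fix k
  show "plookup g k = plookup (\<Sum>k\<in>pkeys g. psingle k (plookup g k)) k"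
    by (simp add: lookup_sum lookup_single when_def in_keys_iff cong: if_cong)
qed

lemma lookup_single_mult:
  fixes g :: "'e::ab_group_add \<Rightarrow>\<^sub>0 'c::semiring_0"
  shows "plookup (psingle w c * g) k = c * plookup g (k - w)"
proof -
  have "psingle w c * g = (\<Sum>l\<in>pkeys g. psingle (w + l) (c * plookup g l))"
    by (subst poly_mapping_sum_single[of g]) (simp add: sum_distrib_left mult_single)
  then have "plookup (psingle w c * g) k = (\<Sum>l\<in>pkeys g. c * plookup g l when w + l = k)"
    by (simp add: lookup_sum lookup_single)
  also have "\<dots> = (\<Sum>l\<in>pkeys g. if l = k - w then c * plookup g l else 0)"
    by (intro sum.cong) (auto simp: when_def algebra_simps)
  also have "\<dots> = c * plookup g (k - w)" by (simp add: in_keys_iff)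
  finally show ?thesis .
qed

lemma keys_single_mult:
  fixes g :: "'e::ab_group_add \<Rightarrow>\<^sub>0 'c::semiring_1_no_zero_divisors"
  shows "pkeys (psingle w 1 * g) = (+) w ` pkeys g"
proof -
  have "k \<in> (+) w ` pkeys g \<longleftrightarrow> k - w \<in> pkeys g" for k
    by (metis (no_types, lifting) add_diff_cancel_left' diff_add_cancel add.commute image_iff)
  then show ?thesis by (auto simp: in_keys_iff lookup_single_mult)
qed

lemma pm_restrict_sum: "pm_restrict X (sum g I) = (\<Sum>i\<in>I. pm_restrict X (g i :: 'e \<Rightarrow>\<^sub>0 'c::comm_monoid_add))"
  by (rule poly_mapping_eqI) (simp add: lookup_pm_restrict lookup_sum)

lemma poly_mapping_split_single:
  fixes g :: "'e \<Rightarrow>\<^sub>0 'c::ab_group_add"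
  shows "g = pm_restrict X g + pm_restrict (-X) g"
  by (rule poly_mapping_eqI) (simp add: lookup_pm_restrict lookup_add)

lemma le_div_iff_int: "0 < b \<Longrightarrow> k \<le> a div b \<longleftrightarrow> k * b \<le> a" for a b k :: int
proof
  assume b: "0 < b" and "k \<le> a div b"
  then have "k * b \<le> a div b * b" by (intro mult_right_mono) auto
  also have "\<dots> \<le> a" using pos_mod_sign[OF b, of a] div_mult_mod_eq[of a b] by linarith
  finally show "k * b \<le> a" .
next
  assume b: "0 < b" and "k * b \<le> a"
  then show "k \<le> a div b" using zdiv_mono1[of "k * b" a b] by simp
qed

section \<open>Koszul complexes\<close>

text \<open>For i in J this is the sign in e_i \<and> e_(J - {i}) = \<plusminus> e_J, counting the
  elements of J that i has to pass.\<close>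

definition koszul_sign :: "'i::linorder \<Rightarrow> 'i set \<Rightarrow> 'a::comm_ring_1" where
  "koszul_sign i J = (-1) ^ card {j \<in> J. j < i}"

text \<open>The operators \<open>T i\<close> are arbitrary because one formula has to serve twice:
  with \<open>log_deriv\<close> it is the exterior derivative, with multiplication by
  \<open>log_deriv i f\<close> it is the wedge product with df.\<close>

definition koszul ::
  "('i::{finite,linorder} \<Rightarrow> 'a \<Rightarrow> 'a) \<Rightarrow> ('a::comm_ring_1, 'i set) vec \<Rightarrow> ('a, 'i set) vec" where
  "koszul T \<omega> = (\<chi> J. \<Sum>i\<in>J. koszul_sign i J * T i (\<omega> $ (J - {i})))"

text \<open>Interior product with the vector whose i-th component is \<open>h i\<close>.\<close>

definition contraction ::
  "('i::{finite,linorder} \<Rightarrow> 'a) \<Rightarrow> ('a::comm_ring_1, 'i set) vec \<Rightarrow> ('a, 'i set) vec" where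
  "contraction h \<omega> = (\<chi> I. \<Sum>i\<in>-I. koszul_sign i (insert i I) * h i * \<omega> $ (insert i I))"

lemma koszul_sign_square [simp]: "koszul_sign i J * koszul_sign i J = 1"
  by (simp add: koszul_sign_def flip: power_add)

lemma koszul_sign_square_left [simp]: "koszul_sign i J * (koszul_sign i J * x) = x"
  by (simp add: mult.assoc[symmetric])

lemma koszul_sign_remove_greater:
  assumes "i \<le> j" shows "koszul_sign i (J - {j}) = koszul_sign i J"
proof -
  have "{k \<in> J - {j}. k < i} = {k \<in> J. k < i}" using assms by auto
  then show ?thesis by (simp add: koszul_sign_def)
qed

lemma koszul_sign_remove_less:
  fixes i j :: "'i::{finite,linorder}"
  assumes "i < j" "i \<in> J"
  shows "koszul_sign j (J - {i}) = - koszul_sign j J"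
proof -
  have "{k \<in> J. k < j} = insert i {k \<in> J - {i}. k < j}" using assms by auto
  then have "card {k \<in> J. k < j} = Suc (card {k \<in> J - {i}. k < j})" by simp
  then show ?thesis by (simp add: koszul_sign_def)
qed

lemma koszul_sign_swap:
  fixes i j :: "'i::{finite,linorder}"
  assumes "i \<in> J" "j \<in> J" "i \<noteq> j"
  shows "koszul_sign i J * koszul_sign j (J - {i}) = - (koszul_sign j J * koszul_sign i (J - {j}))"
proof (cases "i < j")
  case True
  then show ?thesis using assms by (simp add: koszul_sign_remove_less koszul_sign_remove_greater)
next
  case False
  then have "j < i" using assms by auto
  then show ?thesis using assms by (simp add: koszul_sign_remove_less koszul_sign_remove_greater)
qed

text \<open>The pairs (i, j) and (j, i) carry opposite signs and cancel. Both the vanishing of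
  squares and the anticommutation of two differentials reduce to this.\<close>

lemma sum_koszul_sign_symmetric:
  fixes S :: "'i::{finite,linorder} \<Rightarrow> 'i \<Rightarrow> 'a::comm_ring_1"
  assumes sym: "\<And>i j. S i j = S j i"
  shows "(\<Sum>i\<in>J. \<Sum>j\<in>J - {i}. koszul_sign i J * koszul_sign j (J - {i}) * S i j) = 0"
proof -
  define g where "g = (\<lambda>(i, j). koszul_sign i J * koszul_sign j (J - {i}) * S i j)"
  define A where "A = {(i, j). i \<in> J \<and> j \<in> J \<and> i < j}"
  define B where "B = {(i, j). i \<in> J \<and> j \<in> J \<and> j < i}"
  have "(\<Sum>i\<in>J. \<Sum>j\<in>J - {i}. koszul_sign i J * koszul_sign j (J - {i}) * S i j) = sum g (SIGMA i:J. J - {i})"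
    by (simp add: g_def sum.Sigma)
  also have "(SIGMA i:J. J - {i}) = A \<union> B" by (auto simp: A_def B_def)
  also have "sum g (A \<union> B) = sum g A + sum g B"
    by (rule sum.union_disjoint) (auto simp: A_def B_def)
  also have "sum g B = sum (g \<circ> prod.swap) A"
    by (rule sum.reindex_bij_witness[of _ prod.swap prod.swap]) (auto simp: A_def B_def)
  also have "\<dots> = sum (\<lambda>p. - g p) A"
  proof (rule sum.cong)
    fix p assume "p \<in> A"
    then obtain i j where p: "p = (i, j)" "i \<in> J" "j \<in> J" "i < j" by (auto simp: A_def)
    then have "koszul_sign j J * koszul_sign i (J - {j}) = - (koszul_sign i J * koszul_sign j (J - {i}) :: 'a)"
      by (intro koszul_sign_swap) auto
    then show "(g \<circ> prod.swap) p = - g p" using sym[of i j] by (simp add: g_def p)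
  qed simp
  finally show ?thesis by (simp add: sum_negf)
qed

lemma koszul_sign_cases: "koszul_sign i J = 1 \<or> koszul_sign i J = -1"
  unfolding koszul_sign_def by (metis minus_one_power_iff)

lemma additive_koszul_sign:
  fixes T :: "'a::comm_ring_1 \<Rightarrow> 'a"
  assumes "Modules.additive T" shows "T (koszul_sign i J * x) = koszul_sign i J * T x"
  using koszul_sign_cases[of i J, where 'a='a]
proof
  assume "koszul_sign i J = (-1 :: 'a)"
  then show ?thesis by (simp only: mult_minus_left mult_1 Modules.additive.minus[OF assms])
qed simp

lemma koszul_koszul_nth:
  assumes "\<And>i. Modules.additive (T i)"
  shows "koszul T (koszul T' \<omega>) $ J =
    (\<Sum>i\<in>J. \<Sum>j\<in>J - {i}. koszul_sign i J * koszul_sign j (J - {i}) * T i (T' j (\<omega> $ (J - {i} - {j}))))"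
  by (simp add: koszul_def Modules.additive.sum[OF assms] additive_koszul_sign[OF assms] sum_distrib_left mult.assoc)

text \<open>The last hypothesis says that the commutator of \<open>T i\<close> and
  \<open>T' j\<close> is symmetric in i and j. Commuting operators would be too special: the
  commutator of \<open>log_deriv i\<close> with multiplication by \<open>log_deriv j f\<close> is
  multiplication by a second logarithmic derivative of f, which is symmetric but not zero.\<close>

lemma koszul_anticommute:
  fixes T T' :: "'i::{finite,linorder} \<Rightarrow> 'a::comm_ring_1 \<Rightarrow> 'a" and \<omega> :: "('a, 'i set) vec"
  assumes add: "\<And>i. Modules.additive (T i)" "\<And>i. Modules.additive (T' i)"
    and sym: "\<And>i j x. T i (T' j x) - T' j (T i x) = T j (T' i x) - T' i (T j x)"
  shows "koszul T (koszul T' \<omega>) = - koszul T' (koszul T \<omega>)"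
proof (rule vec_eq_iff[THEN iffD2], rule allI)
  fix J :: "'i set"
  let ?s = "\<lambda>i j. koszul_sign i J * koszul_sign j (J - {i}) :: 'a"
  let ?w = "\<lambda>i j. \<omega> $ (J - {i} - {j})"
  have w: "?w i j = ?w j i" for i j
    by (simp add: Diff_insert2[symmetric] insert_commute)
  have "koszul T' (koszul T \<omega>) $ J = (\<Sum>i\<in>J. \<Sum>j\<in>J - {i}. ?s i j * T' i (T j (?w i j)))"
    by (rule koszul_koszul_nth[OF add(2)])
  also have "\<dots> = (\<Sum>i\<in>J. \<Sum>j\<in>J. if i \<noteq> j then ?s i j * T' i (T j (?w i j)) else 0)"
    by (intro sum.cong refl sum.mono_neutral_cong_left) auto
  also have "\<dots> = (\<Sum>i\<in>J. \<Sum>j\<in>J. if j \<noteq> i then ?s j i * T' j (T i (?w j i)) else 0)"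
    by (rule sum.swap)
  also have "\<dots> = (\<Sum>i\<in>J. \<Sum>j\<in>J. if i \<noteq> j then - (?s i j * T' j (T i (?w i j))) else 0)"
    proof (intro sum.cong refl)
    fix i j assume "i \<in> J" "j \<in> J"
    then show "(if j \<noteq> i then ?s j i * T' j (T i (?w j i)) else 0) =
        (if i \<noteq> j then - (?s i j * T' j (T i (?w i j))) else 0)"
      unfolding w[of j i] using koszul_sign_swap[of j J i, where 'a='a] by simp
  qed
  also have "\<dots> = - (\<Sum>i\<in>J. \<Sum>j\<in>J - {i}. ?s i j * T' j (T i (?w i j)))"
    unfolding sum_negf[symmetric] by (intro sum.cong refl sum.mono_neutral_cong_right) auto
  finally have 1: "koszul T' (koszul T \<omega>) $ J = - (\<Sum>i\<in>J. \<Sum>j\<in>J - {i}. ?s i j * T' j (T i (?w i j)))" .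
  have "koszul T (koszul T' \<omega>) $ J + koszul T' (koszul T \<omega>) $ J
    = (\<Sum>i\<in>J. \<Sum>j\<in>J - {i}. ?s i j * (T i (T' j (?w i j)) - T' j (T i (?w i j))))"
    unfolding 1 koszul_koszul_nth[OF add(1)] by (simp add: sum_subtractf[symmetric] right_diff_distrib)
  also have "\<dots> = 0"
  proof (rule sum_koszul_sign_symmetric)
    fix i j
    show "T i (T' j (?w i j)) - T' j (T i (?w i j)) = T j (T' i (?w j i)) - T' i (T j (?w j i))"
      unfolding w[of j i] by (rule sym)
  qed
  finally show "koszul T (koszul T' \<omega>) $ J = (- koszul T' (koszul T \<omega>)) $ J"
    by (simp add: eq_neg_iff_add_eq_0)
qed

lemma koszul_square:
  fixes T :: "'i::{finite,linorder} \<Rightarrow> 'a::comm_ring_1 \<Rightarrow> 'a" and \<omega> :: "('a, 'i set) vec"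
  assumes add: "\<And>i. Modules.additive (T i)"
    and comm: "\<And>i j x. T i (T j x) = T j (T i x)"
  shows "koszul T (koszul T \<omega>) = 0"
proof (rule vec_eq_iff[THEN iffD2], rule allI)
  fix J :: "'i set"
  have w: "\<omega> $ (J - {i} - {j}) = \<omega> $ (J - {j} - {i})" for i j
    by (simp add: Diff_insert2[symmetric] insert_commute)
  show "koszul T (koszul T \<omega>) $ J = 0 $ J"
    unfolding koszul_koszul_nth[OF add] zero_index
  proof (rule sum_koszul_sign_symmetric)
    fix i j
    show "T i (T j (\<omega> $ (J - {i} - {j}))) = T j (T i (\<omega> $ (J - {j} - {i})))"
      unfolding w[of j i] by (rule comm)
  qed
qed

lemma koszul_add:
  assumes "\<And>i. Modules.additive (T i)"
  shows "koszul T (\<omega> + \<eta>) = koszul T \<omega> + koszul T \<eta>"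
  by (simp add: vec_eq_iff koszul_def Modules.additive.add[OF assms] distrib_left sum.distrib)

lemma koszul_diff:
  assumes "\<And>i. Modules.additive (T i)"
  shows "koszul T (\<omega> - \<eta>) = koszul T \<omega> - koszul T \<eta>"
  by (simp add: vec_eq_iff koszul_def Modules.additive.diff[OF assms] right_diff_distrib sum_subtractf)

lemma koszul_zero:
  assumes "\<And>i. Modules.additive (T i)"
  shows "koszul T 0 = 0"
  by (simp add: vec_eq_iff koszul_def Modules.additive.zero[OF assms])

lemma additive_mult: "Modules.additive ((*) (c::'a::ring))"
  by unfold_locales (simp add: distrib_left)

lemma koszul_scale:
  "koszul (\<lambda>i. (*) (F i)) (c *s \<omega>) = c *s koszul (\<lambda>i. (*) (F i)) \<omega>"
  by (simp add: vec_eq_iff koszul_def sum_distrib_left mult_ac)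

text \<open>Cartan's formula. The diagonal terms give \<open>F i * h i\<close> once for each i, from
  the first summand for i in J and from the second for i outside J; the mixed terms have opposite
  signs.\<close>

lemma koszul_contraction_homotopy:
  fixes F h :: "'i::{finite,linorder} \<Rightarrow> 'a::comm_ring_1"
  shows "koszul (\<lambda>i. (*) (F i)) (contraction h \<omega>) + contraction h (koszul (\<lambda>i. (*) (F i)) \<omega>)
    = (\<Sum>i\<in>UNIV. F i * h i) *s \<omega>"
proof (rule vec_eq_iff[THEN iffD2], rule allI)
  fix J :: "'i set"
  let ?X = "\<lambda>i j. koszul_sign i J * koszul_sign j (insert j (J - {i})) * F i * h j * \<omega> $ (insert j (J - {i}))"
  let ?Y = "\<lambda>j i. koszul_sign j (insert j J) * koszul_sign i (insert j J) * F i * h j * \<omega> $ (insert j J - {i})"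
  have "koszul (\<lambda>i. (*) (F i)) (contraction h \<omega>) $ J = (\<Sum>i\<in>J. \<Sum>j\<in>-(J-{i}). ?X i j)"
    by (simp add: koszul_def contraction_def sum_distrib_left mult_ac del: Compl_Diff_eq)
  also have "\<dots> = (\<Sum>i\<in>J. F i * h i * \<omega> $ J + (\<Sum>j\<in>-J. ?X i j))"
  proof (intro sum.cong refl)
    fix i assume i: "i \<in> J"
    have e: "- (J - {i}) = insert i (- J)" using i by auto
    have "insert i (J - {i}) = J" using i by auto
    then have "?X i i = F i * h i * \<omega> $ J" by (simp add: mult.assoc)
    then show "(\<Sum>j\<in>-(J-{i}). ?X i j) = F i * h i * \<omega> $ J + (\<Sum>j\<in>-J. ?X i j)"
      unfolding e using i by simp
  qed
  finally have 1: "koszul (\<lambda>i. (*) (F i)) (contraction h \<omega>) $ J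
      = (\<Sum>i\<in>J. F i * h i * \<omega> $ J) + (\<Sum>i\<in>J. \<Sum>j\<in>-J. ?X i j)" by (simp add: sum.distrib)
  have "contraction h (koszul (\<lambda>i. (*) (F i)) \<omega>) $ J = (\<Sum>j\<in>-J. \<Sum>i\<in>insert j J. ?Y j i)"
    by (simp add: koszul_def contraction_def sum_distrib_left mult_ac del: sum.insert)
  also have "\<dots> = (\<Sum>j\<in>-J. F j * h j * \<omega> $ J + (\<Sum>i\<in>J. ?Y j i))"
  proof (intro sum.cong refl)
    fix j assume j: "j \<in> -J"
    have "insert j J - {j} = J" using j by auto
    then show "(\<Sum>i\<in>insert j J. ?Y j i) = F j * h j * \<omega> $ J + (\<Sum>i\<in>J. ?Y j i)"
      using j by (simp add: mult.assoc)
  qed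
  also have "\<dots> = (\<Sum>j\<in>-J. F j * h j * \<omega> $ J) + (\<Sum>j\<in>-J. \<Sum>i\<in>J. ?Y j i)"
    by (simp add: sum.distrib)
  also have "(\<Sum>j\<in>-J. \<Sum>i\<in>J. ?Y j i) = (\<Sum>i\<in>J. \<Sum>j\<in>-J. ?Y j i)" by (rule sum.swap)
  also have "\<dots> = (\<Sum>i\<in>J. \<Sum>j\<in>-J. - ?X i j)"
  proof (intro sum.cong refl)
    fix i j assume i: "i \<in> J" and j: "j \<in> - J"
    then have ne: "i \<noteq> j" by auto
    have K: "insert j J - {i} = insert j (J - {i})" "insert j J - {j} = J" using i j by auto
    have "koszul_sign i (insert j J) * koszul_sign j (insert j (J - {i}))
       = - (koszul_sign j (insert j J) * koszul_sign i J :: 'a)"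
      using koszul_sign_swap[of i "insert j J" j, where 'a='a] i j ne K by simp
    then have "koszul_sign i (insert j J) * koszul_sign i J * (koszul_sign i (insert j J) * koszul_sign j (insert j (J - {i})))
       = - (koszul_sign i (insert j J) * koszul_sign i J * (koszul_sign j (insert j J) * koszul_sign i J) :: 'a)"
      by simp
    then have "koszul_sign i J * koszul_sign j (insert j (J - {i}))
       = - (koszul_sign j (insert j J) * koszul_sign i (insert j J) :: 'a)"
      by (simp add: mult_ac)
    then show "?Y j i = - ?X i j" using K by simp
  qed
  finally have 2: "contraction h (koszul (\<lambda>i. (*) (F i)) \<omega>) $ J
      = (\<Sum>j\<in>-J. F j * h j * \<omega> $ J) - (\<Sum>i\<in>J. \<Sum>j\<in>-J. ?X i j)" by (simp add: sum_negf)
  have "(\<Sum>i\<in>J. F i * h i * \<omega> $ J) + (\<Sum>i\<in>-J. F i * h i * \<omega> $ J) = (\<Sum>i\<in>J \<union> -J. F i * h i * \<omega> $ J)"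
    by (rule sum.union_disjoint[symmetric]) auto
  then show "(koszul (\<lambda>i. (*) (F i)) (contraction h \<omega>) + contraction h (koszul (\<lambda>i. (*) (F i)) \<omega>)) $ J
     = ((\<Sum>i\<in>UNIV. F i * h i) *s \<omega>) $ J"
    by (simp add: 1 2 sum_distrib_right)
qed

section \<open>Exactness and finiteness of Koszul complexes on quotients spanned by lattice
  points\<close>

definition absorbing :: "'e::plus set \<Rightarrow> 'e set \<Rightarrow> bool" where
  "absorbing C S \<longleftrightarrow> (\<forall>a\<in>S. \<forall>b\<in>C. a + b \<in> S)"

lemma keys_mult_absorbing:
  fixes g h :: "'e::ab_group_add \<Rightarrow>\<^sub>0 complex"
  assumes "absorbing C S" "pkeys h \<subseteq> C" "pkeys g \<subseteq> S"
  shows "pkeys (h * g) \<subseteq> S"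
  by (rule keys_subset_mult[OF assms(2,3)]) (use assms(1) in \<open>metis absorbing_def add.commute\<close>)

text \<open>The Koszul complex of \<open>F\<close> on \<open>\<complex>[S] / \<complex>[S']\<close> is exact in degrees below \<open>d\<close>.\<close>

definition koszul_exact ::
  "('i::{finite,linorder} \<Rightarrow> ('e::ab_group_add \<Rightarrow>\<^sub>0 complex)) \<Rightarrow> nat \<Rightarrow> 'e set \<Rightarrow> 'e set \<Rightarrow> bool" where
  "koszul_exact F d S S' \<longleftrightarrow>
    (\<forall>\<omega>. (\<forall>I. pkeys (\<omega> $ I) \<subseteq> S) \<longrightarrow> (\<forall>I. d \<le> card I \<longrightarrow> \<omega> $ I = 0) \<longrightarrow>
         (\<forall>I. pkeys (koszul (\<lambda>i. (*) (F i)) \<omega> $ I) \<subseteq> S') \<longrightarrow>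
      (\<exists>\<eta>. (\<forall>I. pkeys (\<eta> $ I) \<subseteq> S) \<and> (\<forall>I. d \<le> Suc (card I) \<longrightarrow> \<eta> $ I = 0) \<and>
         (\<forall>I. pkeys ((\<omega> - koszul (\<lambda>i. (*) (F i)) \<eta>) $ I) \<subseteq> S')))"

text \<open>Finite dimension of the top cohomology of the same quotient complex, phrased by a finite
  set of exponents so that it can be chained without quotient spaces.\<close>

definition koszul_cofinite ::
  "('i::finite \<Rightarrow> ('e::ab_group_add \<Rightarrow>\<^sub>0 complex)) \<Rightarrow> 'e set \<Rightarrow> 'e set \<Rightarrow> bool" where
  "koszul_cofinite F S S' \<longleftrightarrow>
    (\<exists>E. finite E \<and> (\<forall>g. pkeys g \<subseteq> S \<longrightarrow>
      (\<exists>h e s. g = (\<Sum>i\<in>UNIV. F i * h i) + e + s \<and>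
         (\<forall>i. pkeys (h i) \<subseteq> S) \<and> pkeys e \<subseteq> E \<and> pkeys s \<subseteq> S')))"

lemma koszul_exact_0: "koszul_exact F 0 S S'"
  unfolding koszul_exact_def
proof (intro allI impI)
  fix \<omega> :: "('b \<Rightarrow>\<^sub>0 complex, 'a set) vec" assume "\<forall>I. 0 \<le> card I \<longrightarrow> \<omega> $ I = 0"
  then show "\<exists>\<eta>. (\<forall>I. pkeys (\<eta> $ I) \<subseteq> S) \<and> (\<forall>I. 0 \<le> Suc (card I) \<longrightarrow> \<eta> $ I = 0) \<and>
      (\<forall>I. pkeys ((\<omega> - koszul (\<lambda>i. (*) (F i)) \<eta>) $ I) \<subseteq> S')"
    by (intro exI[of _ 0]) (simp add: koszul_zero additive_mult)
qed

lemma koszul_exact_refl: "koszul_exact F d S S"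
  unfolding koszul_exact_def
proof (intro allI impI)
  fix \<omega> :: "('b \<Rightarrow>\<^sub>0 complex, 'a set) vec" assume "\<forall>I. pkeys (\<omega> $ I) \<subseteq> S"
  then show "\<exists>\<eta>. (\<forall>I. pkeys (\<eta> $ I) \<subseteq> S) \<and> (\<forall>I. d \<le> Suc (card I) \<longrightarrow> \<eta> $ I = 0) \<and>
      (\<forall>I. pkeys ((\<omega> - koszul (\<lambda>i. (*) (F i)) \<eta>) $ I) \<subseteq> S)"
    by (intro exI[of _ 0]) (simp add: koszul_zero additive_mult)
qed

lemma koszul_cofinite_refl: "koszul_cofinite F S S"
  unfolding koszul_cofinite_def
  by (intro exI[of _ "{}"] conjI allI impI, simp) (rule exI[of _ "\<lambda>_. 0"], rule exI[of _ 0], auto)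

text \<open>The long exact sequence by hand: a primitive modulo S'' leaves a remainder supported in
  S'', which is still closed modulo S' because the differential squares to zero, and the second
  hypothesis removes it.\<close>

lemma koszul_exact_trans:
  assumes "koszul_exact F d S S''" "koszul_exact F d S'' S'" "S'' \<subseteq> S" "S' \<subseteq> S''"
  shows "koszul_exact F d S S'"
  unfolding koszul_exact_def
proof (intro allI impI)
  let ?d = "koszul (\<lambda>i. (*) (F i))"
  fix \<omega> :: "('b \<Rightarrow>\<^sub>0 complex, 'a set) vec"
  assume \<omega>: "\<forall>I. pkeys (\<omega> $ I) \<subseteq> S" "\<forall>I. d \<le> card I \<longrightarrow> \<omega> $ I = 0"
    and d\<omega>: "\<forall>I. pkeys (?d \<omega> $ I) \<subseteq> S'"
  then obtain \<eta> where \<eta>: "\<forall>I. pkeys (\<eta> $ I) \<subseteq> S" "\<forall>I. d \<le> Suc (card I) \<longrightarrow> \<eta> $ I = 0"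
      "\<forall>I. pkeys ((\<omega> - ?d \<eta>) $ I) \<subseteq> S''"
    using assms(1,4) unfolding koszul_exact_def by (meson subset_trans)
  have dd: "?d (?d \<eta>) = 0" by (rule koszul_square) (auto simp: additive_mult mult_ac)
  have "?d (\<omega> - ?d \<eta>) = ?d \<omega>"
    by (simp add: koszul_diff[OF additive_mult] dd)
  then have "\<forall>I. pkeys (?d (\<omega> - ?d \<eta>) $ I) \<subseteq> S'" using d\<omega> by simp
  moreover have "\<forall>I. d \<le> card I \<longrightarrow> (\<omega> - ?d \<eta>) $ I = 0"
  proof (intro allI impI)
    fix I :: "'a set" assume "d \<le> card I"
    then have "\<eta> $ (I - {i}) = 0" if "i \<in> I" for i using \<eta>(2) that by (simp add: card_Suc_Diff1)
    then show "(\<omega> - ?d \<eta>) $ I = 0" using \<omega>(2) \<open>d \<le> card I\<close> by (simp add: koszul_def)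
  qed
  ultimately obtain \<zeta> where \<zeta>: "\<forall>I. pkeys (\<zeta> $ I) \<subseteq> S''" "\<forall>I. d \<le> Suc (card I) \<longrightarrow> \<zeta> $ I = 0"
      "\<forall>I. pkeys ((\<omega> - ?d \<eta> - ?d \<zeta>) $ I) \<subseteq> S'"
    using assms(2) \<eta>(3) unfolding koszul_exact_def by blast
  show "\<exists>\<eta>. (\<forall>I. pkeys (\<eta> $ I) \<subseteq> S) \<and> (\<forall>I. d \<le> Suc (card I) \<longrightarrow> \<eta> $ I = 0) \<and>
      (\<forall>I. pkeys ((\<omega> - ?d \<eta>) $ I) \<subseteq> S')"
  proof (intro exI[of _ "\<eta> + \<zeta>"] conjI)
    show "\<forall>I. pkeys ((\<eta> + \<zeta>) $ I) \<subseteq> S"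
    proof
      fix I show "pkeys ((\<eta> + \<zeta>) $ I) \<subseteq> S"
        unfolding vector_add_component
        using \<eta>(1) \<zeta>(1) assms(3) by (intro keys_subset_add) (blast intro: subset_trans)+
    qed
    show "\<forall>I. d \<le> Suc (card I) \<longrightarrow> (\<eta> + \<zeta>) $ I = 0" using \<eta>(2) \<zeta>(2) by simp
    show "\<forall>I. pkeys ((\<omega> - ?d (\<eta> + \<zeta>)) $ I) \<subseteq> S'"
      using \<zeta>(3) by (simp add: koszul_add[OF additive_mult] diff_diff_add)
  qed
qed

lemma koszul_cofinite_trans:
  assumes "koszul_cofinite F S S''" "koszul_cofinite F S'' S'" "S'' \<subseteq> S"
  shows "koszul_cofinite F S S'"
proof -
  obtain E1 where E1: "finite E1" "\<And>g. pkeys g \<subseteq> S \<Longrightarrow> \<exists>h e s. g = (\<Sum>i\<in>UNIV. F i * h i) + e + s \<and>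
         (\<forall>i. pkeys (h i) \<subseteq> S) \<and> pkeys e \<subseteq> E1 \<and> pkeys s \<subseteq> S''"
    using assms(1) unfolding koszul_cofinite_def by blast
  obtain E2 where E2: "finite E2" "\<And>g. pkeys g \<subseteq> S'' \<Longrightarrow> \<exists>h e s. g = (\<Sum>i\<in>UNIV. F i * h i) + e + s \<and>
         (\<forall>i. pkeys (h i) \<subseteq> S'') \<and> pkeys e \<subseteq> E2 \<and> pkeys s \<subseteq> S'"
    using assms(2) unfolding koszul_cofinite_def by blast
  show ?thesis unfolding koszul_cofinite_def
  proof (intro exI[of _ "E1 \<union> E2"] conjI allI impI)
    fix g :: "'b \<Rightarrow>\<^sub>0 complex" assume "pkeys g \<subseteq> S"
    then obtain h e s where 1: "g = (\<Sum>i\<in>UNIV. F i * h i) + e + s" "\<forall>i. pkeys (h i) \<subseteq> S" "pkeys e \<subseteq> E1" "pkeys s \<subseteq> S''"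
      using E1(2) by blast
    obtain h' e' s' where 2: "s = (\<Sum>i\<in>UNIV. F i * h' i) + e' + s'" "\<forall>i. pkeys (h' i) \<subseteq> S''" "pkeys e' \<subseteq> E2" "pkeys s' \<subseteq> S'"
      using E2(2)[OF 1(4)] by blast
    show "\<exists>h e s. g = (\<Sum>i\<in>UNIV. F i * h i) + e + s \<and>
         (\<forall>i. pkeys (h i) \<subseteq> S) \<and> pkeys e \<subseteq> E1 \<union> E2 \<and> pkeys s \<subseteq> S'"
    proof (intro exI conjI allI)
      show "g = (\<Sum>i\<in>UNIV. F i * (h i + h' i)) + (e + e') + s'"
        unfolding 1(1) 2(1) by (simp add: algebra_simps sum.distrib)
      show "pkeys (h i + h' i) \<subseteq> S" for i using 1(2) 2(2) assms(3) by (intro keys_subset_add) (blast intro: subset_trans)+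
      show "pkeys (e + e') \<subseteq> E1 \<union> E2" using 1(3) 2(3) by (intro keys_subset_add) auto
      show "pkeys s' \<subseteq> S'" by (fact 2(4))
    qed
  qed (use E1(1) E2(1) in simp)
qed

lemma keys_koszul_sign_mult [simp]:
  "pkeys (koszul_sign i J * (g :: 'e::ab_group_add \<Rightarrow>\<^sub>0 complex)) = pkeys g"
  using koszul_sign_cases[of i J, where 'a="'e \<Rightarrow>\<^sub>0 complex"]
proof
  assume "koszul_sign i J = (- 1 :: 'e \<Rightarrow>\<^sub>0 complex)"
  then show ?thesis by (simp only: mult_minus_left mult_1 keys_uminus_pm)
qed simp

lemma keys_koszul:
  fixes F :: "'i::{finite,linorder} \<Rightarrow> ('e::ab_group_add \<Rightarrow>\<^sub>0 complex)"
  assumes "\<And>i. pkeys (F i) \<subseteq> C" "absorbing C S" "\<And>I. pkeys (\<omega> $ I) \<subseteq> S"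
  shows "pkeys (koszul (\<lambda>i. (*) (F i)) \<omega> $ I) \<subseteq> S"
  unfolding koszul_def vec_lambda_beta
  by (intro keys_subset_sum, unfold keys_koszul_sign_mult, rule keys_mult_absorbing[OF assms(2,1,3)])

lemma keys_contraction:
  fixes h :: "'i::{finite,linorder} \<Rightarrow> ('e::ab_group_add \<Rightarrow>\<^sub>0 complex)"
  assumes "\<And>i. pkeys (h i) \<subseteq> C" "absorbing C S" "\<And>I. pkeys (\<omega> $ I) \<subseteq> S"
  shows "pkeys (contraction h \<omega> $ I) \<subseteq> S"
  unfolding contraction_def vec_lambda_beta mult.assoc
  by (intro keys_subset_sum, unfold keys_koszul_sign_mult, rule keys_mult_absorbing[OF assms(2,1,3)])

lemma split_shift:
  fixes g :: "'e::ab_group_add \<Rightarrow>\<^sub>0 complex"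
  assumes "pkeys g \<subseteq> S' \<union> (+) w ` S"
  obtains p q where "g = psingle w 1 * p + q" "pkeys p \<subseteq> S" "pkeys q \<subseteq> S'"
proof
  let ?r = "pm_restrict ((+) w ` S) g"
  show "g = psingle w 1 * (psingle (-w) 1 * ?r) + pm_restrict (- (+) w ` S) g"
    using poly_mapping_split_single[of g "(+) w ` S"] by (simp add: mult.assoc[symmetric] mult_single)
  show "pkeys (psingle (-w) 1 * ?r) \<subseteq> S"
    by (auto simp: keys_single_mult keys_pm_restrict)
  show "pkeys (pm_restrict (- (+) w ` S) g) \<subseteq> S'"
    using assms by (auto simp: keys_pm_restrict)
qed

text \<open>If \<open>u\<^sup>w\<close> is a combination of the \<open>F i\<close> modulo elements killing \<open>\<complex>[S] / \<complex>[S']\<close>, then contraction makes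
  multiplication by \<open>u\<^sup>w\<close> homotopic to zero, and one gains a degree of exactness over the quotient by \<open>u\<^sup>w\<close>.\<close>

locale koszul_step =
  fixes F h :: "'i::{finite,linorder} \<Rightarrow> ('e::ab_group_add \<Rightarrow>\<^sub>0 complex)"
    and C S S' :: "'e set" and w :: 'e and r :: "'e \<Rightarrow>\<^sub>0 complex"
  assumes F: "\<And>i. pkeys (F i) \<subseteq> C" and h: "\<And>i. pkeys (h i) \<subseteq> C"
    and S: "absorbing C S"
    and S': "absorbing C S'"
    and sub: "S' \<subseteq> S"
    and w: "psingle w 1 = (\<Sum>i\<in>UNIV. F i * h i) + r"
    and kill: "\<And>a b. a \<in> S \<Longrightarrow> b \<in> pkeys r \<Longrightarrow> a + b \<in> S'"
    and inj: "\<And>a. a \<in> S \<Longrightarrow> a + w \<in> S' \<Longrightarrow> a \<in> S'"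
begin

lemma keys_kill: assumes "pkeys g \<subseteq> S" shows "pkeys (r * g) \<subseteq> S'"
  by (rule keys_subset_mult[OF order_refl assms]) (metis add.commute kill)

text \<open>For a form \<omega> closed modulo S' the homotopy gives u^w \<omega> = d\<eta> modulo
  S', where \<eta> is the contraction of \<omega>. So \<eta> is closed modulo S' and u^w and has
  degree one lower; the hypothesis yields \<eta> = d\<zeta> + u^w p modulo S'. Then u^w (\<omega> -
  dp) is zero modulo S', and \<open>inj\<close> cancels u^w.\<close>

lemma exact:
  assumes ex: "koszul_exact F d S (S' \<union> (+) w ` S)"
  shows "koszul_exact F (Suc d) S S'"
  unfolding koszul_exact_def
proof (intro allI impI)
  let ?d = "koszul (\<lambda>i. (*) (F i))"
  fix \<omega> :: "('e \<Rightarrow>\<^sub>0 complex, 'i set) vec"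
  assume \<omega>: "\<forall>I. pkeys (\<omega> $ I) \<subseteq> S" "\<forall>I. Suc d \<le> card I \<longrightarrow> \<omega> $ I = 0"
    and d\<omega>: "\<forall>I. pkeys (?d \<omega> $ I) \<subseteq> S'"
  define \<eta> where "\<eta> = contraction h \<omega>"
  have h': "psingle w 1 *s \<omega> = ?d \<eta> + contraction h (?d \<omega>) + r *s \<omega>"
    unfolding \<eta>_def koszul_contraction_homotopy by (simp add: w vec_eq_iff distrib_right)
  have diff: "pkeys ((psingle w 1 *s \<omega> - ?d \<eta>) $ I) \<subseteq> S'" for I
  proof -
    have "pkeys (contraction h (?d \<omega>) $ I) \<subseteq> S'"
      by (rule keys_contraction[OF h S']) (use d\<omega> in blast)
    moreover have "pkeys ((r *s \<omega>) $ I) \<subseteq> S'" using \<omega>(1) keys_kill by simp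
    ultimately show ?thesis unfolding h' by (simp add: keys_subset_add)
  qed
  have \<eta>S: "\<forall>I. pkeys (\<eta> $ I) \<subseteq> S"
    unfolding \<eta>_def using \<omega>(1) by (intro allI keys_contraction[OF h S]) blast
  have \<eta>0: "\<eta> $ I = 0" if "d \<le> card I" for I
  proof -
    have "\<omega> $ insert i I = 0" if "i \<in> -I" for i using \<omega>(2) that \<open>d \<le> card I\<close> by (simp add: card_insert_if)
    then show ?thesis by (simp add: \<eta>_def contraction_def)
  qed
  have "pkeys (?d \<eta> $ I) \<subseteq> S' \<union> (+) w ` S" for I
  proof -
    have "pkeys ((psingle w 1 *s \<omega>) $ I) \<subseteq> S' \<union> (+) w ` S"
      using \<omega>(1) by (auto simp: keys_single_mult)
    from keys_subset_diff[OF this, of "(psingle w 1 *s \<omega> - ?d \<eta>) $ I"]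
    show ?thesis using diff[of I] by auto
  qed
  then obtain \<zeta> where \<zeta>: "\<forall>I. pkeys (\<zeta> $ I) \<subseteq> S" "\<forall>I. d \<le> Suc (card I) \<longrightarrow> \<zeta> $ I = 0"
      "\<forall>I. pkeys ((\<eta> - ?d \<zeta>) $ I) \<subseteq> S' \<union> (+) w ` S"
    using ex \<eta>S \<eta>0 unfolding koszul_exact_def by blast
  \<comment> \<open>In degrees from d on the left side vanishes, and \<open>p\<close> is chosen to
    vanish there as well, because \<open>p\<close> will be the primitive and must satisfy the degree
    condition.\<close>
  have ex2: "\<exists>p q. (\<eta> - ?d \<zeta>) $ I = psingle w 1 * p + q \<and> pkeys p \<subseteq> S \<and> pkeys q \<subseteq> S' \<and> (d \<le> card I \<longrightarrow> p = 0)" for I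
  proof (cases "d \<le> card I")
    case True
    have "\<zeta> $ (I - {i}) = 0" if "i \<in> I" for i
      using \<zeta>(2) that True by (simp add: card_Suc_Diff1)
    then have "(\<eta> - ?d \<zeta>) $ I = 0" using \<eta>0[OF True] by (simp add: koszul_def)
    then show ?thesis by (intro exI[of _ 0]) auto
  next
    case False
    then show ?thesis using \<zeta>(3) split_shift[of "(\<eta> - ?d \<zeta>) $ I" S' w S] by metis
  qed
  then obtain P where P: "\<forall>I. \<exists>q. (\<eta> - ?d \<zeta>) $ I = psingle w 1 * P I + q \<and> pkeys (P I) \<subseteq> S \<and> pkeys q \<subseteq> S' \<and> (d \<le> card I \<longrightarrow> P I = 0)"
    by metis
  then obtain Q where Q: "\<forall>I. (\<eta> - ?d \<zeta>) $ I = psingle w 1 * P I + Q I \<and> pkeys (P I) \<subseteq> S \<and> pkeys (Q I) \<subseteq> S' \<and> (d \<le> card I \<longrightarrow> P I = 0)"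
    by metis
  define p where "p = (\<chi> I. P I)"
  define q where "q = (\<chi> I. Q I)"
  have eq: "\<eta> = ?d \<zeta> + psingle w 1 *s p + q"
    using Q by (simp add: vec_eq_iff p_def q_def algebra_simps)
  have dd: "?d (?d \<zeta>) = 0" by (rule koszul_square) (auto simp: additive_mult mult_ac)
  have d\<eta>: "?d \<eta> = psingle w 1 *s ?d p + ?d q"
    unfolding eq by (simp add: koszul_add[OF additive_mult] dd koszul_scale)
  have qS: "pkeys (q $ I) \<subseteq> S'" for I using Q by (simp add: q_def)
  have fin: "pkeys ((\<omega> - ?d p) $ I) \<subseteq> S'" for I
  proof -
    have "psingle w 1 * (\<omega> - ?d p) $ I = (psingle w 1 *s \<omega> - ?d \<eta>) $ I + ?d q $ I"
      unfolding d\<eta> by (simp add: algebra_simps)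
    then have "pkeys (psingle w 1 * (\<omega> - ?d p) $ I) \<subseteq> S'"
      using diff[of I] keys_koszul[OF F S' qS] by (simp add: keys_subset_add)
    then have "\<And>a. a \<in> pkeys ((\<omega> - ?d p) $ I) \<Longrightarrow> a + w \<in> S'"
      by (auto simp: keys_single_mult add.commute)
    moreover have "pkeys ((\<omega> - ?d p) $ I) \<subseteq> S"
      unfolding vector_minus_component
    proof (rule keys_subset_diff)
      have "pkeys (p $ I) \<subseteq> S" for I using Q by (simp add: p_def)
      then show "pkeys (?d p $ I) \<subseteq> S" by (rule keys_koszul[OF F S])
    qed (use \<omega>(1) in blast)
    ultimately show ?thesis using inj by blast
  qed
  show "\<exists>\<eta>. (\<forall>I. pkeys (\<eta> $ I) \<subseteq> S) \<and> (\<forall>I. Suc d \<le> Suc (card I) \<longrightarrow> \<eta> $ I = 0) \<and>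
      (\<forall>I. pkeys ((\<omega> - ?d \<eta>) $ I) \<subseteq> S')"
    using Q fin by (intro exI[of _ p]) (auto simp: p_def)
qed

text \<open>Modulo S' every multiple of u^w is a combination of the \<open>F i\<close>, since
  \<open>r\<close> maps S into S'. Dividing out u^w therefore leaves the cokernel unchanged.\<close>

lemma cofinite:
  assumes fin: "koszul_cofinite F S (S' \<union> (+) w ` S)"
  shows "koszul_cofinite F S S'"
proof -
  obtain E where E: "finite E" "\<And>g. pkeys g \<subseteq> S \<Longrightarrow> \<exists>h e s. g = (\<Sum>i\<in>UNIV. F i * h i) + e + s \<and>
         (\<forall>i. pkeys (h i) \<subseteq> S) \<and> pkeys e \<subseteq> E \<and> pkeys s \<subseteq> S' \<union> (+) w ` S"
    using fin unfolding koszul_cofinite_def by blast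
  show ?thesis unfolding koszul_cofinite_def
  proof (intro exI[of _ E] conjI allI impI)
    fix g :: "'e \<Rightarrow>\<^sub>0 complex" assume "pkeys g \<subseteq> S"
    then obtain k e s where 1: "g = (\<Sum>i\<in>UNIV. F i * k i) + e + s" "\<forall>i. pkeys (k i) \<subseteq> S" "pkeys e \<subseteq> E" "pkeys s \<subseteq> S' \<union> (+) w ` S"
      using E(2) by blast
    obtain p q where pq: "s = psingle w 1 * p + q" "pkeys p \<subseteq> S" "pkeys q \<subseteq> S'"
      using split_shift[OF 1(4)] by blast
    show "\<exists>h e s. g = (\<Sum>i\<in>UNIV. F i * h i) + e + s \<and>
         (\<forall>i. pkeys (h i) \<subseteq> S) \<and> pkeys e \<subseteq> E \<and> pkeys s \<subseteq> S'"
    proof (intro exI conjI allI)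
      show "g = (\<Sum>i\<in>UNIV. F i * (k i + h i * p)) + e + (r * p + q)"
        unfolding 1(1) pq(1) w by (simp add: algebra_simps sum.distrib sum_distrib_left)
      show "pkeys (k i + h i * p) \<subseteq> S" for i
        using 1(2) keys_mult_absorbing[OF S h pq(2)] by (intro keys_subset_add) auto
      show "pkeys e \<subseteq> E" by (fact 1(3))
      show "pkeys (r * p + q) \<subseteq> S'" using keys_kill[OF pq(2)] pq(3) by (intro keys_subset_add) auto
    qed
  qed (use E(1) in simp)
qed

end

section \<open>Filtering a cone by pieces of faces\<close>

text \<open>Finitely many kernels that do not contain \<open>H\<close> cannot cover it. When a new
  form vanishes at the old vector but not at y, a large multiple of the old vector plus y serves all
  forms.\<close>

lemma generic_vector:
  fixes P :: "('e::ab_group_add \<Rightarrow> int) set" and smul :: "int \<Rightarrow> 'e \<Rightarrow> 'e"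
  assumes "finite P"
    and add: "\<And>g a b. g \<in> P \<Longrightarrow> g (a + b) = g a + g b"
    and sm: "\<And>g c a. g \<in> P \<Longrightarrow> g (smul c a) = c * g a"
    and H: "z \<in> H" "\<And>a b. a \<in> H \<Longrightarrow> b \<in> H \<Longrightarrow> a + b \<in> H" "\<And>c a. a \<in> H \<Longrightarrow> smul c a \<in> H"
  shows "\<exists>v\<in>H. \<forall>g\<in>P. g v = 0 \<longrightarrow> (\<forall>y\<in>H. g y = 0)"
  using assms(1-3)
proof (induction P rule: finite_induct)
  case empty
  then show ?case using H(1) by auto
next
  case (insert g P)
  then obtain v where v: "v \<in> H" "\<forall>g\<in>P. g v = 0 \<longrightarrow> (\<forall>y\<in>H. g y = 0)" by auto
  show ?case
  proof (cases "g v = 0 \<longrightarrow> (\<forall>y\<in>H. g y = 0)")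
    case True
    then show ?thesis using v by auto
  next
    case False
    then obtain y where y: "y \<in> H" "g y \<noteq> 0" "g v = 0" by auto
    \<comment> \<open>K exceeds every |g' y|, so K g'(v) + g'(y) = 0 forces the integer g'(v) to be
      zero.\<close>
    define K where "K = 1 + (\<Sum>g\<in>P. \<bar>g y\<bar>)"
    have K: "\<bar>g' y\<bar> < K" if "g' \<in> P" for g'
      using member_le_sum[of g' P "\<lambda>g. \<bar>g y\<bar>"] that insert.hyps(1) by (simp add: K_def)
    have "g' v = 0" if "g' \<in> P" "g' (smul K v + y) = 0" for g'
    proof (rule ccontr)
      assume "g' v \<noteq> 0"
      then have "1 \<le> \<bar>g' v\<bar>" by simp
      moreover have Kp: "0 \<le> K" using K[OF that(1)] by linarith
      ultimately have "K \<le> \<bar>K * g' v\<bar>" using mult_left_mono[of 1 "\<bar>g' v\<bar>" K] by (simp add: abs_mult)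
      moreover have "K * g' v = - g' y"
        using that insert.prems(1)[of g' "smul K v" y] insert.prems(2)[of g' K v] by simp
      ultimately show False using K[OF that(1)] by simp
    qed
    moreover have "g (smul K v + y) \<noteq> 0"
      using insert.prems(1)[of g "smul K v" y] insert.prems(2)[of g K v] y by simp
    moreover have "smul K v + y \<in> H" using v(1) y(1) H(2,3) by blast
    ultimately show ?thesis using v(2) by (intro bexI[of _ "smul K v + y"]) blast+
  qed
qed

text \<open>A face is encoded by the set \<open>J\<close> of forms vanishing on it, and a nonzero
  point \<open>y\<close> at which the other forms are positive certifies a point of its relative
  interior. The last assumption is the geometric input: some interior monomial of the face lies in
  the ideal of the \<open>F i\<close> up to terms off the face.\<close>

locale cone_koszul =
  fixes \<Lambda> :: "'l set" and ev :: "'l \<Rightarrow> 'e::ab_group_add \<Rightarrow> int" and smul :: "int \<Rightarrow> 'e \<Rightarrow> 'e"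
    and F :: "'i::{finite,linorder} \<Rightarrow> ('e \<Rightarrow>\<^sub>0 complex)" and cone :: "'e set"
  assumes finite_forms: "finite \<Lambda>"
    and form_add: "\<And>l a b. l \<in> \<Lambda> \<Longrightarrow> ev l (a + b) = ev l a + ev l b"
    and form_smul: "\<And>l c a. l \<in> \<Lambda> \<Longrightarrow> ev l (smul c a) = c * ev l a"
    and pointed: "\<And>y. (\<forall>l\<in>\<Lambda>. ev l y = 0) \<Longrightarrow> y = 0"
    and cone: "cone = {b. \<forall>l\<in>\<Lambda>. 0 \<le> ev l b}"
    and keys_F: "\<And>i. pkeys (F i) \<subseteq> cone"
    and face_nilpotent: "\<And>J y. J \<subseteq> \<Lambda> \<Longrightarrow> J \<noteq> {} \<Longrightarrow> y \<noteq> 0 \<Longrightarrow> (\<forall>l\<in>J. ev l y = 0) \<Longrightarrow> (\<forall>l\<in>\<Lambda> - J. 0 < ev l y) \<Longrightarrow>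
      \<exists>w h r. (\<forall>l\<in>J. ev l w = 0) \<and> (\<forall>l\<in>\<Lambda> - J. 0 < ev l w) \<and> psingle w 1 = (\<Sum>i\<in>UNIV. F i * h i) + r \<and>
        (\<forall>i. pkeys (h i) \<subseteq> cone) \<and> (\<forall>b\<in>pkeys r. \<exists>l\<in>J. 0 < ev l b) \<and> pkeys r \<subseteq> cone"
begin

text \<open>Lattice points of a face of the cone translated by \<open>x / m\<close>, with \<open>m\<close> clearing denominators.\<close>

definition piece :: "'l set \<Rightarrow> 'e \<Rightarrow> int \<Rightarrow> 'e set" where
  "piece J x m = {a. (\<forall>l\<in>J. m * ev l a = ev l x) \<and> (\<forall>l\<in>\<Lambda>. ev l x \<le> m * ev l a)}"

text \<open>The common kernel of \<open>J\<close> has rank at least \<open>d\<close>, stated without a rank function.\<close>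

definition corank_ge :: "'l set \<Rightarrow> nat \<Rightarrow> bool" where
  "corank_ge J d \<longleftrightarrow> (\<forall>G\<subseteq>\<Lambda>. card G < d \<longrightarrow> (\<exists>y. y \<noteq> 0 \<and> (\<forall>l\<in>J \<union> G. ev l y = 0)))"

lemma form_0: "l \<in> \<Lambda> \<Longrightarrow> ev l 0 = 0"
  using form_add[of l 0 0] by simp

lemma form_diff: "l \<in> \<Lambda> \<Longrightarrow> ev l (a - b) = ev l a - ev l b"
  using form_add[of l "a - b" b] by simp

text \<open>The cross forms l'(w) l - l(w) l' measure whether two forms are proportional on the
  kernel of \<open>J\<close>. A generic vector of this kernel detects all of them; adding a multiple
  of w makes it nonnegative and does not affect the cross forms, since they vanish at w.\<close>

lemma generic_direction:
  assumes J: "J \<subseteq> \<Lambda>" and wJ: "\<forall>l\<in>J. ev l w = 0" and w: "\<forall>l\<in>\<Lambda> - J. 0 < ev l w"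
  obtains v where "\<forall>l\<in>J. ev l v = 0" "\<forall>l\<in>\<Lambda>. 0 \<le> ev l v"
    "\<forall>l\<in>\<Lambda>. \<forall>l'\<in>\<Lambda>. ev l' w * ev l v = ev l w * ev l' v \<longrightarrow>
      (\<forall>y. (\<forall>l\<in>J. ev l y = 0) \<longrightarrow> ev l' w * ev l y = ev l w * ev l' y)"
proof -
  define P where "P = (\<lambda>(l, l') y. ev l' w * ev l y - ev l w * ev l' y) ` (\<Lambda> \<times> \<Lambda>)"
  define H where "H = {y. \<forall>l\<in>J. ev l y = 0}"
  have "\<exists>v\<in>H. \<forall>g\<in>P. g v = 0 \<longrightarrow> (\<forall>y\<in>H. g y = 0)"
    by (rule generic_vector[where smul = smul and z = 0])
      (use finite_forms J in \<open>auto simp: P_def H_def subset_iff form_add form_smul form_0 algebra_simps\<close>)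
  then obtain v where v: "v \<in> H" "\<forall>g\<in>P. g v = 0 \<longrightarrow> (\<forall>y\<in>H. g y = 0)" by blast
  define c where "c = (\<Sum>l\<in>\<Lambda>. \<bar>ev l v\<bar>)"
  define v' where "v' = v + smul c w"
  have v': "ev l v' = ev l v + c * ev l w" if "l \<in> \<Lambda>" for l using that by (simp add: v'_def form_add form_smul)
  have cv: "\<bar>ev l v\<bar> \<le> c" if "l \<in> \<Lambda>" for l
    unfolding c_def using that finite_forms by (intro member_le_sum) auto
  show thesis
  proof (rule that[of v'])
    show "\<forall>l\<in>J. ev l v' = 0" using v(1) J wJ v' by (auto simp: H_def)
    show "\<forall>l\<in>\<Lambda>. 0 \<le> ev l v'"
    proof
      fix l assume l: "l \<in> \<Lambda>"
      show "0 \<le> ev l v'"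
      proof (cases "l \<in> J")
        case False
        then have "1 \<le> ev l w" using w l by force
        moreover have "0 \<le> c" using cv[OF l] by linarith
        ultimately have "c \<le> c * ev l w" using mult_left_mono[of 1 "ev l w" c] by simp
        then show ?thesis using cv[OF l] v'[OF l] by linarith
      qed (use \<open>\<forall>l\<in>J. ev l v' = 0\<close> in simp)
    qed
    show "\<forall>l\<in>\<Lambda>. \<forall>l'\<in>\<Lambda>. ev l' w * ev l v' = ev l w * ev l' v' \<longrightarrow>
      (\<forall>y. (\<forall>l\<in>J. ev l y = 0) \<longrightarrow> ev l' w * ev l y = ev l w * ev l' y)"
    proof (intro ballI allI impI)
    fix l l' y assume a: "l \<in> \<Lambda>" "l' \<in> \<Lambda>" "ev l' w * ev l v' = ev l w * ev l' v'" "\<forall>l\<in>J. ev l y = 0"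
    define g where "g = (\<lambda>y. ev l' w * ev l y - ev l w * ev l' y)"
    have "g \<in> P" using a(1,2) by (auto simp: P_def g_def)
    moreover have "g v = 0" using a(3) v' a(1,2) by (simp add: g_def algebra_simps)
    ultimately have "g y = 0" using v(2) a(4) by (auto simp: H_def)
    then show "ev l' w * ev l y = ev l w * ev l' y" by (simp add: g_def)
    qed
  qed
qed

text \<open>Shift the piece by a small generic \<open>v\<close> and scale the forms to a common value at \<open>w\<close>.  Two of them can
  then agree at lattice points only if they are proportional on the kernel of \<open>J\<close>, so filtering by their
  minimum yields pieces of strictly smaller faces.\<close>

lemma quotient_step:
  assumes J: "J \<subseteq> \<Lambda>" and ne: "\<Lambda> - J \<noteq> {}" and wJ: "\<forall>l\<in>J. ev l w = 0" and w: "\<forall>l\<in>\<Lambda> - J. 0 < ev l w"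
    and m: "0 < m" and abs: "absorbing cone S" "absorbing cone S'" and sub: "S' \<subseteq> S"
    and SP: "S - S' = piece J x m"
    and IH: "\<And>J' x' m' T T' y. J \<subset> J' \<Longrightarrow> J' \<subseteq> \<Lambda> \<Longrightarrow> 0 < m' \<Longrightarrow> absorbing cone T \<Longrightarrow> absorbing cone T' \<Longrightarrow>
      T' \<subseteq> T \<Longrightarrow> T - T' = piece J' x' m' \<Longrightarrow> \<forall>l\<in>J'. ev l y = 0 \<Longrightarrow> \<forall>l\<in>\<Lambda> - J'. 0 < ev l y \<Longrightarrow>
      koszul_cofinite F T T' \<and> (\<forall>d. corank_ge J' d \<longrightarrow> koszul_exact F d T T')"
  shows "koszul_cofinite F S (S' \<union> (+) w ` S) \<and>
    (\<forall>d. corank_ge J (Suc d) \<longrightarrow> koszul_exact F d S (S' \<union> (+) w ` S))"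
proof -
  obtain v where vJ: "\<forall>l\<in>J. ev l v = 0" and v0: "\<forall>l\<in>\<Lambda>. 0 \<le> ev l v"
    and vgen0: "\<forall>l\<in>\<Lambda>. \<forall>l'\<in>\<Lambda>. ev l' w * ev l v = ev l w * ev l' v \<longrightarrow>
      (\<forall>y. (\<forall>l\<in>J. ev l y = 0) \<longrightarrow> ev l' w * ev l y = ev l w * ev l' y)"
    by (rule generic_direction[OF J wJ w])
  have vgen: "ev l' w * ev l y = ev l w * ev l' y"
    if "l \<in> \<Lambda>" "l' \<in> \<Lambda>" "ev l' w * ev l v = ev l w * ev l' v" "\<forall>l\<in>J. ev l y = 0" for l l' y
    using vgen0 that by blast
  have wcone: "w \<in> cone" unfolding cone
  proof (intro CollectI ballI)
    fix l assume "l \<in> \<Lambda>"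
    then show "0 \<le> ev l w" using wJ w by (cases "l \<in> J") (auto intro: less_imp_le)
  qed
  \<comment> \<open>\<open>K\<close> exceeds the values at v of all forms and of all cross forms. By
    the former, the shift by -v / (K m) keeps the lattice points of the piece; by the latter, it
    breaks every tie between forms that are not proportional on the kernel of
    \<open>J\<close>.\<close>
  define A where "A = (\<Sum>l\<in>\<Lambda>. \<bar>ev l v\<bar>)"
  define B where "B = (\<Sum>p\<in>\<Lambda> \<times> \<Lambda>. \<bar>ev (snd p) w * ev (fst p) v - ev (fst p) w * ev (snd p) v\<bar>)"
  define K where "K = 1 + A + B"
  have A0: "0 \<le> A" and B0: "0 \<le> B" unfolding A_def B_def by (simp_all add: sum_nonneg)
  have Kpos: "0 < K" using A0 B0 by (simp add: K_def)
  have Kv: "ev l v < K" if "l \<in> \<Lambda>" for l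
  proof -
    have "\<bar>ev l v\<bar> \<le> A" unfolding A_def by (rule member_le_sum) (use that finite_forms in auto)
    then show ?thesis using B0 by (simp add: K_def)
  qed
  have Kg: "\<bar>ev l' w * ev l v - ev l w * ev l' v\<bar> < K" if "l \<in> \<Lambda>" "l' \<in> \<Lambda>" for l l'
  proof -
    have "\<bar>ev (snd (l, l')) w * ev (fst (l, l')) v - ev (fst (l, l')) w * ev (snd (l, l')) v\<bar> \<le> B"
      unfolding B_def by (rule member_le_sum) (use that finite_forms in auto)
    then show ?thesis using A0 by (simp add: K_def)
  qed
  define X where "X = smul K x - v"
  have X: "ev l X = K * ev l x - ev l v" if "l \<in> \<Lambda>" for l using that by (simp add: X_def form_diff form_smul)
  define mm where "mm = K * m"
  have mmpos: "0 < mm" using Kpos m by (simp add: mm_def)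
  \<comment> \<open>A common multiple of the values l(w): after rescaling by \<open>c l\<close>,
    adding w raises every \<open>\<kappa> l\<close> by the same amount e * mm.\<close>
  define e where "e = (\<Prod>l\<in>\<Lambda> - J. ev l w)"
  have epos: "0 < e" unfolding e_def using w by (intro prod_pos) auto
  define c where "c = (\<lambda>l. e div ev l w)"
  have ce: "c l * ev l w = e" if "l \<in> \<Lambda> - J" for l
    unfolding c_def e_def using that finite_forms by (intro dvd_div_mult_self dvd_prodI) auto
  have cpos: "0 < c l" if "l \<in> \<Lambda> - J" for l
    using ce[OF that] epos w that by (metis zero_less_mult_pos2)
  define \<kappa> where "\<kappa> = (\<lambda>l a. c l * (mm * ev l a - ev l X))"
  define s where "s = (\<lambda>a. Min ((\<lambda>l. \<kappa> l a) ` (\<Lambda> - J)))"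
  have s_ge: "\<sigma> \<le> s a \<longleftrightarrow> (\<forall>l\<in>\<Lambda> - J. \<sigma> \<le> \<kappa> l a)" for \<sigma> a
    unfolding s_def using ne finite_forms by (subst Min_ge_iff) auto
  have s_ex: "\<exists>l\<in>\<Lambda> - J. s a = \<kappa> l a" for a
  proof -
    have "s a \<in> (\<lambda>l. \<kappa> l a) ` (\<Lambda> - J)" unfolding s_def using ne finite_forms by (intro Min_in) auto
    then show ?thesis by auto
  qed
  define Q where "Q = piece J x m"
  have \<kappa>e: "e * (mm * ev l a - ev l X) = ev l w * \<kappa> l a" if "l \<in> \<Lambda> - J" for l a
    using ce[OF that] by (simp add: \<kappa>_def) (metis mult.assoc mult.commute)
  have mmX: "mm * ev l a - ev l X = K * (m * ev l a - ev l x) + ev l v" if "l \<in> \<Lambda>" for l a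
    using that by (simp add: X mm_def algebra_simps)
  have ge_iff: "0 \<le> mm * ev l a - ev l X \<longleftrightarrow> ev l x \<le> m * ev l a" if "l \<in> \<Lambda>" for l a
  proof
    assume "0 \<le> mm * ev l a - ev l X"
    then have "- K < K * (m * ev l a - ev l x)" using mmX[OF that, of a] Kv[OF that] by linarith
    then have "K * (-1) < K * (m * ev l a - ev l x)" by simp
    then have "-1 < m * ev l a - ev l x" using Kpos by (simp only: mult_less_cancel_left_pos)
    then show "ev l x \<le> m * ev l a" by linarith
  next
    assume "ev l x \<le> m * ev l a"
    then have "0 \<le> K * (m * ev l a - ev l x)" using Kpos by simp
    then show "0 \<le> mm * ev l a - ev l X" using mmX[OF that, of a] v0 that by fastforce
  qed
  have Q_iff: "a \<in> Q \<longleftrightarrow> (\<forall>l\<in>J. m * ev l a = ev l x) \<and> (\<forall>l\<in>\<Lambda> - J. 0 \<le> \<kappa> l a)" for a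
  proof -
    have "(0 \<le> \<kappa> l a) = (ev l x \<le> m * ev l a)" if "l \<in> \<Lambda> - J" for l
      using cpos[OF that] ge_iff[of l a] that by (simp add: \<kappa>_def zero_le_mult_iff)
    then show ?thesis unfolding Q_def piece_def by auto
  qed
  \<comment> \<open>The cross form at v is K times an integer but smaller than K in absolute value,
    hence zero, and genericity applies. The points a and a' may differ, so that two points of one
    slice can be compared.\<close>
  have propor: "ev l' w * ev l y = ev l w * ev l' y"
    if l: "l \<in> \<Lambda> - J" "l' \<in> \<Lambda> - J" and eqk: "\<kappa> l a = \<kappa> l' a'" and y: "\<forall>l\<in>J. ev l y = 0" for l l' a a' y
  proof (rule vgen)
    have "e * (ev l' w * (mm * ev l a - ev l X)) = ev l' w * ev l w * \<kappa> l a"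
      using \<kappa>e[OF l(1), of a] by (simp add: mult_ac)
    also have "\<dots> = e * (ev l w * (mm * ev l' a' - ev l' X))"
      using \<kappa>e[OF l(2), of a'] eqk by (simp add: mult_ac)
    finally have "ev l' w * (mm * ev l a - ev l X) = ev l w * (mm * ev l' a' - ev l' X)" using epos by simp
    then have 1: "ev l w * ev l' v - ev l' w * ev l v = K * (ev l' w * (m * ev l a - ev l x) - ev l w * (m * ev l' a' - ev l' x))"
      using l by (simp add: mmX) (simp add: algebra_simps)
    define z where "z = ev l' w * (m * ev l a - ev l x) - ev l w * (m * ev l' a' - ev l' x)"
    have "\<bar>K * z\<bar> < K" using Kg[of l l'] l 1 by (simp add: z_def)
    then have "\<bar>z\<bar> < 1" using Kpos by (simp add: abs_mult)
    then have "z = 0" by simp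
    then show "ev l' w * ev l v = ev l w * ev l' v" using 1 by (simp add: z_def)
  qed (use l y in auto)
  \<comment> \<open>The filtration by the minimum \<open>s\<close> runs from \<open>S\<close> at
    index 0 to the union of S' and w + S at index e * mm; its consecutive differences are the level
    sets of \<open>s\<close> on the piece.\<close>
  define T where "T = (\<lambda>n::nat. S' \<union> {a \<in> Q. int n \<le> s a})"
  have SQ: "S = S' \<union> Q" "S' \<inter> Q = {}" using SP sub by (auto simp: Q_def)
  have T0: "T 0 = S" unfolding T_def using SQ by (auto simp: s_ge Q_iff)
  have Tabs: "absorbing cone (T n)" for n
    unfolding absorbing_def
  proof (intro ballI)
    fix a b assume a: "a \<in> T n" and b: "b \<in> cone"
    have aS: "a \<in> S" using a SQ by (auto simp: T_def)
    show "a + b \<in> T n"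
    proof (cases "a + b \<in> S'")
      case False
      have "a + b \<in> S" using abs(1) aS b by (simp add: absorbing_def)
      then have abQ: "a + b \<in> Q" using False SQ by auto
      have "a \<notin> S'" using False abs(2) b by (auto simp: absorbing_def)
      then have "int n \<le> s a" using a by (auto simp: T_def)
      moreover have "\<kappa> l a \<le> \<kappa> l (a + b)" if "l \<in> \<Lambda> - J" for l
        unfolding \<kappa>_def using that b cpos[OF that] mmpos by (intro mult_left_mono) (auto simp: form_add cone distrib_left)
      ultimately have "int n \<le> s (a + b)" unfolding s_ge by (meson order_trans)
      then show ?thesis using abQ by (simp add: T_def)
    qed (simp add: T_def)
  qed
  have TB: "T (nat (e * mm)) = S' \<union> (+) w ` S"
  proof -
    have "a \<in> (+) w ` S \<longleftrightarrow> e * mm \<le> s a" if a: "a \<in> Q" for a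
    proof -
      have aw: "a \<in> (+) w ` S \<longleftrightarrow> a - w \<in> S"
        by (metis (no_types, lifting) add_diff_cancel_left' diff_add_cancel add.commute image_iff)
      have "a - w \<notin> S'"
      proof
        assume "a - w \<in> S'"
        then have "a - w + w \<in> S'" using abs(2) wcone unfolding absorbing_def by blast
        then show False using a SQ by auto
      qed
      then have "a - w \<in> S \<longleftrightarrow> a - w \<in> Q" using SQ by auto
      also have "\<dots> \<longleftrightarrow> (\<forall>l\<in>\<Lambda> - J. 0 \<le> \<kappa> l (a - w))"
        unfolding Q_iff using a wJ J by (auto simp: Q_iff form_diff subset_iff)
      also have "\<dots> \<longleftrightarrow> (\<forall>l\<in>\<Lambda> - J. e * mm \<le> \<kappa> l a)"
      proof (intro ball_cong refl)
        fix l assume l: "l \<in> \<Lambda> - J"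
        have "\<kappa> l (a - w) = \<kappa> l a - (c l * ev l w) * mm"
          using l by (simp add: \<kappa>_def form_diff algebra_simps)
        then show "(0 \<le> \<kappa> l (a - w)) = (e * mm \<le> \<kappa> l a)" using ce[OF l] by simp
      qed
      finally show ?thesis unfolding aw s_ge .
    qed
    moreover have "(+) w ` S \<subseteq> S' \<union> Q"
      using abs(1) wcone SQ(1) unfolding absorbing_def by (metis add.commute image_subsetI)
    moreover have "int (nat (e * mm)) = e * mm" using epos mmpos by simp
    ultimately show ?thesis unfolding T_def by auto
  qed
  have step: "koszul_cofinite F (T n) (T (Suc n)) \<and> (\<forall>d. corank_ge J (Suc d) \<longrightarrow> koszul_exact F d (T n) (T (Suc n)))" for n
  proof (cases "T n = T (Suc n)")
    case True
    then show ?thesis by (simp add: koszul_exact_refl koszul_cofinite_refl)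
  next
    case False
    define \<sigma> where "\<sigma> = int n"
    have Tsub: "T (Suc n) \<subseteq> T n" by (auto simp: T_def)
    have Tdiff: "T n - T (Suc n) = {a \<in> Q. s a = \<sigma>}" using SQ(2) by (auto simp: T_def \<sigma>_def)
    then obtain a0 where a0: "a0 \<in> Q" "s a0 = \<sigma>" using False Tsub by blast
    obtain l0 where l0: "l0 \<in> \<Lambda> - J" "\<kappa> l0 a0 = \<sigma>" using s_ex[of a0] a0 by auto
    \<comment> \<open>By \<open>propor\<close> the forms that attain the minimum at one point
      \<open>a0\<close> of the level set attain it at all of its points, and with \<open>J\<close>
      they cut out the smaller face. Its translation vector X' / m' is X / mm moved along w by
      \<sigma> / (e * mm).\<close>
    define J' where "J' = J \<union> {l \<in> \<Lambda> - J. \<kappa> l a0 = \<sigma>}"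
    define m' where "m' = e * mm"
    define X' where "X' = smul e X + smul \<sigma> w"
    have X': "m' * ev l a - ev l X' = e * (mm * ev l a - ev l X) - \<sigma> * ev l w" if "l \<in> \<Lambda>" for l a
      using that by (simp add: X'_def m'_def form_add form_smul algebra_simps)
    have X'J: "m' * ev l a - ev l X' = e * K * (m * ev l a - ev l x)" if "l \<in> J" for l a
      using X'[of l a] that J wJ vJ mmX[of l a] by (auto simp: subset_iff)
    have X'2: "m' * ev l a - ev l X' = ev l w * (\<kappa> l a - \<sigma>)" if "l \<in> \<Lambda> - J" for l a
      using X'[of l a] \<kappa>e[OF that, of a] that by (simp add: algebra_simps)
    have pc: "a \<in> piece J' X' m' \<longleftrightarrow> (\<forall>l\<in>J. m * ev l a = ev l x) \<and> (\<forall>l\<in>J' - J. \<kappa> l a = \<sigma>) \<and> (\<forall>l\<in>\<Lambda> - J. \<sigma> \<le> \<kappa> l a)" for a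
    proof -
      have p1: "m' * ev l a = ev l X' \<longleftrightarrow> m * ev l a = ev l x" if "l \<in> J" for l
        using X'J[OF that, of a] epos Kpos by (metis diff_0 eq_iff_diff_eq_0 less_irrefl mult_eq_0_iff)
      have p2: "m' * ev l a = ev l X' \<longleftrightarrow> \<kappa> l a = \<sigma>" if "l \<in> \<Lambda> - J" for l
        using X'2[OF that, of a] w that by (metis eq_iff_diff_eq_0 less_irrefl mult_eq_0_iff)
      have p3: "ev l X' \<le> m' * ev l a \<longleftrightarrow> \<sigma> \<le> \<kappa> l a" if "l \<in> \<Lambda> - J" for l
      proof -
        have "ev l X' \<le> m' * ev l a \<longleftrightarrow> 0 \<le> ev l w * (\<kappa> l a - \<sigma>)" using X'2[OF that, of a] by linarith
        also have "\<dots> \<longleftrightarrow> \<sigma> \<le> \<kappa> l a"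
        proof -
          have "0 < ev l w" using w that by blast
          then show ?thesis by (simp add: zero_le_mult_iff)
        qed
        finally show ?thesis .
      qed
      show ?thesis unfolding piece_def
      proof (intro iffI CollectI; (elim CollectE)?)
        assume a: "(\<forall>l\<in>J'. m' * ev l a = ev l X') \<and> (\<forall>l\<in>\<Lambda>. ev l X' \<le> m' * ev l a)"
        then show "(\<forall>l\<in>J. m * ev l a = ev l x) \<and> (\<forall>l\<in>J' - J. \<kappa> l a = \<sigma>) \<and> (\<forall>l\<in>\<Lambda> - J. \<sigma> \<le> \<kappa> l a)"
          using p1 p2 p3 by (auto simp: J'_def)
      next
        assume a: "(\<forall>l\<in>J. m * ev l a = ev l x) \<and> (\<forall>l\<in>J' - J. \<kappa> l a = \<sigma>) \<and> (\<forall>l\<in>\<Lambda> - J. \<sigma> \<le> \<kappa> l a)"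
        have "m' * ev l a = ev l X'" if "l \<in> J'" for l
          using a p1[of l] p2[of l] that by (cases "l \<in> J") (auto simp: J'_def)
        moreover have "ev l X' \<le> m' * ev l a" if "l \<in> \<Lambda>" for l
          using a p1[of l] p3[of l] that by (cases "l \<in> J") auto
        ultimately show "(\<forall>l\<in>J'. m' * ev l a = ev l X') \<and> (\<forall>l\<in>\<Lambda>. ev l X' \<le> m' * ev l a)" by blast
      qed
    qed
    have "T n - T (Suc n) = piece J' X' m'"
    proof (rule set_eqI)
      fix a
      show "a \<in> T n - T (Suc n) \<longleftrightarrow> a \<in> piece J' X' m'"
        unfolding Tdiff pc
      proof (intro iffI CollectI conjI; (elim CollectE conjE)?)
        assume aQ: "a \<in> Q" and sa: "s a = \<sigma>"
        show J1: "\<forall>l\<in>J. m * ev l a = ev l x" using aQ Q_iff by blast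
        show "\<forall>l\<in>\<Lambda> - J. \<sigma> \<le> \<kappa> l a" using s_ge[of \<sigma> a] sa by simp
        obtain l1 where l1: "l1 \<in> \<Lambda> - J" "\<kappa> l1 a = \<sigma>" using s_ex[of a] sa by auto
        show "\<forall>l\<in>J' - J. \<kappa> l a = \<sigma>"
        proof
          fix l assume "l \<in> J' - J"
          then have l: "l \<in> \<Lambda> - J" "\<kappa> l a0 = \<kappa> l1 a" using l1 by (auto simp: J'_def)
          let ?y = "smul mm a - X"
          have y: "ev l ?y = mm * ev l a - ev l X" if "l \<in> \<Lambda>" for l using that by (simp add: form_diff form_smul)
          have "\<forall>l\<in>J. ev l ?y = 0" using J1 J vJ y mmX by (auto simp: subset_iff)
          from propor[OF l(1) l1(1) l(2) this]
          have "ev l1 w * (mm * ev l a - ev l X) = ev l w * (mm * ev l1 a - ev l1 X)" using y l l1 by auto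
          then have "ev l1 w * (e * (mm * ev l a - ev l X)) = ev l w * (e * (mm * ev l1 a - ev l1 X))"
            by (simp add: mult.left_commute)
          then have "ev l1 w * (ev l w * \<kappa> l a) = ev l w * (ev l1 w * \<kappa> l1 a)"
            unfolding \<kappa>e[OF l(1)] \<kappa>e[OF l1(1)] .
          moreover have "0 < ev l1 w" "0 < ev l w" using w l(1) l1(1) by auto
          ultimately show "\<kappa> l a = \<sigma>" using l1(2) by simp
        qed
      next
        assume a: "\<forall>l\<in>J. m * ev l a = ev l x" "\<forall>l\<in>J' - J. \<kappa> l a = \<sigma>" "\<forall>l\<in>\<Lambda> - J. \<sigma> \<le> \<kappa> l a"
        have "0 \<le> \<sigma>" by (simp add: \<sigma>_def)
        then show "a \<in> Q" unfolding Q_iff using a order_trans by blast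
        have "l0 \<in> J' - J" using l0 by (auto simp: J'_def)
        then have "\<kappa> l0 a = \<sigma>" using a by blast
        moreover have "s a \<le> \<kappa> l0 a" using s_ge[of "s a" a] l0 by auto
        ultimately show "s a = \<sigma>" using s_ge[of \<sigma> a] a(3) by auto
      qed
    qed
    moreover have "J \<subset> J'" "J' \<subseteq> \<Lambda>" using l0 J by (auto simp: J'_def)
    moreover have "0 < m'" using epos mmpos by (simp add: m'_def)
    moreover have "\<forall>l\<in>J'. ev l (smul m' a0 - X') = 0 " "\<forall>l\<in>\<Lambda> - J'. 0 < ev l (smul m' a0 - X')"
    proof -
      have y: "ev l (smul m' a0 - X') = m' * ev l a0 - ev l X'" if "l \<in> \<Lambda>" for l
        using that by (simp add: form_diff form_smul)
      show "\<forall>l\<in>J'. ev l (smul m' a0 - X') = 0"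
      proof
        fix l assume l: "l \<in> J'"
        show "ev l (smul m' a0 - X') = 0"
        proof (cases "l \<in> J")
          case True
          then show ?thesis using y[of l] X'J[OF True, of a0] J a0(1) by (auto simp: Q_iff)
        next
          case False
          then show ?thesis using y[of l] X'2[of l a0] l by (auto simp: J'_def)
        qed
      qed
      show "\<forall>l\<in>\<Lambda> - J'. 0 < ev l (smul m' a0 - X')"
      proof
        fix l assume "l \<in> \<Lambda> - J'"
        then have l: "l \<in> \<Lambda> - J" "\<kappa> l a0 \<noteq> \<sigma>" by (auto simp: J'_def)
        moreover have "\<sigma> \<le> \<kappa> l a0" using s_ge[of \<sigma> a0] a0(2) l(1) by simp
        ultimately have "\<sigma> < \<kappa> l a0" by simp
        then show "0 < ev l (smul m' a0 - X')" using y[of l] X'2[OF l(1), of a0] l w by auto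
      qed
    qed
    ultimately have "koszul_cofinite F (T n) (T (Suc n)) \<and> (\<forall>d. corank_ge J' d \<longrightarrow> koszul_exact F d (T n) (T (Suc n)))"
      using IH[of J' m' "T n" "T (Suc n)" X' "smul m' a0 - X'"] Tabs Tsub by blast
    \<comment> \<open>On the kernel of \<open>J\<close> all new forms are proportional to the single
      form \<open>l0\<close>, so the rank of the kernel drops by at most one.\<close>
    moreover have "corank_ge J' d" if rk: "corank_ge J (Suc d)" for d
      unfolding corank_ge_def
    proof (intro allI impI)
      fix G assume G: "G \<subseteq> \<Lambda>" "card G < d"
      have "finite G" using G finite_forms finite_subset by blast
      then have "card (insert l0 G) < Suc d" using G by (simp add: card_insert_if)
      moreover have "insert l0 G \<subseteq> \<Lambda>" using G l0 by auto
      ultimately obtain y where y: "y \<noteq> 0" "\<forall>l\<in>J \<union> insert l0 G. ev l y = 0"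
        using rk unfolding corank_ge_def by blast
      have "ev l y = 0" if "l \<in> J'" "l \<notin> J" for l
      proof -
        have l: "l \<in> \<Lambda> - J" "\<kappa> l a0 = \<kappa> l0 a0" using that l0 by (auto simp: J'_def)
        have "ev l0 w * ev l y = ev l w * ev l0 y" by (rule propor[OF l(1) l0(1) l(2)]) (use y in auto)
        moreover have "0 < ev l0 w" "ev l0 y = 0" using y(2) w l0(1) by blast+
        ultimately show ?thesis by simp
      qed
      then show "\<exists>y. y \<noteq> 0 \<and> (\<forall>l\<in>J' \<union> G. ev l y = 0)" using y by (intro exI[of _ y]) auto
    qed
    ultimately show ?thesis by blast
  qed
  have Tmono: "T (n + k) \<subseteq> T n" for n k by (auto simp: T_def)
  have "koszul_cofinite F (T 0) (T n) \<and> (\<forall>d. corank_ge J (Suc d) \<longrightarrow> koszul_exact F d (T 0) (T n))" for n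
  proof (induction n)
    case 0
    then show ?case by (simp add: koszul_exact_refl koszul_cofinite_refl)
  next
    case (Suc n)
    have "T n \<subseteq> T 0" "T (Suc n) \<subseteq> T n" using Tmono[of 0 n] Tmono[of n 1] by simp_all
    then show ?case using Suc step[of n] koszul_cofinite_trans[of F "T 0" "T n" "T (Suc n)"]
        koszul_exact_trans[of F _ "T 0" "T n" "T (Suc n)"] by blast
  qed
  from this[of "nat (e * mm)"] show ?thesis unfolding T0 TB .
qed

text \<open>Induction on the number of forms outside \<open>J\<close>. If there are none, the piece
  has at most one point, since the forms separate points. Otherwise an interior monomial w of the
  face makes \<open>koszul_step\<close> applicable, and \<open>quotient_step\<close> treats the
  quotient by u^w through smaller faces; the rank lost there comes back as a degree.\<close>

theorem face_piece:
  assumes "J \<subseteq> \<Lambda>" "J \<noteq> {}" "0 < m" "absorbing cone S" "absorbing cone S'" "S' \<subseteq> S"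
    "S - S' = piece J x m" "\<forall>l\<in>J. ev l y = 0" "\<forall>l\<in>\<Lambda> - J. 0 < ev l y"
  shows "koszul_cofinite F S S' \<and> (\<forall>d. corank_ge J d \<longrightarrow> koszul_exact F d S S')"
  using assms
proof (induction "card (\<Lambda> - J)" arbitrary: J S S' m x y rule: less_induct)
  case less
  show ?case
  proof (cases "\<Lambda> - J = {}")
    case True
    then have JL: "J = \<Lambda>" using less.prems by auto
    have one: "a = b" if "a \<in> S - S'" "b \<in> S - S'" for a b
    proof -
      have "ev l (a - b) = 0" if "l \<in> \<Lambda>" for l
      proof -
        have "m * ev l a = m * ev l b"
          using \<open>a \<in> S - S'\<close> \<open>b \<in> S - S'\<close> that unfolding less.prems(7) JL piece_def by simp
        then show ?thesis using less.prems(3) that by (simp add: form_diff)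
      qed
      then show ?thesis using pointed[of "a - b"] by simp
    qed
    have "finite (S - S')"
    proof (cases "S - S' = {}")
      case False
      then obtain a where "a \<in> S - S'" by blast
      then have "S - S' \<subseteq> {a}" using one by blast
      then show ?thesis by (rule finite_subset) simp
    qed (simp only: finite.emptyI)
    then have "koszul_cofinite F S S'"
      unfolding koszul_cofinite_def
    proof (intro exI[of _ "S - S'"] conjI allI impI)
      fix g :: "'e \<Rightarrow>\<^sub>0 complex" assume g: "pkeys g \<subseteq> S"
      show "\<exists>h e s. g = (\<Sum>i\<in>UNIV. F i * h i) + e + s \<and> (\<forall>i. pkeys (h i) \<subseteq> S) \<and> pkeys e \<subseteq> S - S' \<and> pkeys s \<subseteq> S'"
      proof (intro exI conjI allI)
        show "g = (\<Sum>i\<in>UNIV. F i * 0) + pm_restrict (- S') g + pm_restrict S' g"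
          using poly_mapping_split_single[of g S'] by (simp add: add.commute)
      qed (use g in \<open>auto simp: keys_pm_restrict\<close>)
    qed
    \<comment> \<open>All forms together have trivial kernel, so for a point only exactness below
      degree 0 is claimed.\<close>
    moreover have "d = 0" if rk: "corank_ge J d" for d
    proof (rule ccontr)
      assume "d \<noteq> 0"
      then have "card ({} :: 'l set) < d" by simp
      then obtain y where "y \<noteq> 0" "\<forall>l\<in>J \<union> {}. ev l y = 0"
        using rk unfolding corank_ge_def by (metis empty_subsetI)
      then show False using pointed JL by blast
    qed
    ultimately show ?thesis using koszul_exact_0 by blast
  next
    case False
    obtain l1 where "l1 \<in> \<Lambda> - J" using False by blast
    then have y0: "y \<noteq> 0" using less.prems(9) form_0[of l1] by force
    obtain w h r where wJ: "\<forall>l\<in>J. ev l w = 0" and w: "\<forall>l\<in>\<Lambda> - J. 0 < ev l w"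
      and eq: "psingle w 1 = (\<Sum>i\<in>UNIV. F i * h i) + r" and h: "\<forall>i. pkeys (h i) \<subseteq> cone"
      and r: "\<forall>b\<in>pkeys r. \<exists>l\<in>J. 0 < ev l b" "pkeys r \<subseteq> cone"
      using face_nilpotent[OF less.prems(1,2) y0 less.prems(8,9)] by (elim exE conjE) (rule that)
    have pieceD: "m * ev l a = ev l x" if "a \<in> piece J x m" "l \<in> J" for a l using that by (auto simp: piece_def)
    interpret st: koszul_step F h cone S S' w r
    proof
      \<comment> \<open>The forms of \<open>J\<close> are constant on the piece, so a term of
        \<open>r\<close> on which one of them is positive moves every point out of the piece, that
        is into S'.\<close>
      show "a + b \<in> S'" if a: "a \<in> S" and b: "b \<in> pkeys r" for a b
      proof (rule ccontr)
        assume n: "a + b \<notin> S'"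
        have bc: "b \<in> cone" using b r by auto
        have "a \<in> piece J x m" "a + b \<in> piece J x m"
          using n a bc less.prems(4,5) unfolding less.prems(7)[symmetric] absorbing_def by auto
        moreover obtain l where "l \<in> J" "0 < ev l b" using r b by blast
        ultimately show False
          using less.prems(1,3) pieceD[of a l] pieceD[of "a + b" l] form_add[of l a b] by (auto simp: distrib_left)
      qed
      show "a \<in> S'" if a: "a \<in> S" "a + w \<in> S'" for a
      proof (rule ccontr)
        assume "a \<notin> S'"
        then have "a \<in> piece J x m" using a less.prems(7) by auto
        then have "a + w \<in> piece J x m"
          unfolding piece_def
        proof (intro CollectI conjI ballI; elim CollectE conjE)
          fix l assume "\<forall>l\<in>J. m * ev l a = ev l x" "l \<in> J"
          then show "m * ev l (a + w) = ev l x" using wJ less.prems(1) by (simp add: form_add subset_iff)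
        next
          fix l assume l: "\<forall>l\<in>\<Lambda>. ev l x \<le> m * ev l a" "l \<in> \<Lambda>"
          have "0 \<le> ev l w" using wJ w l(2) by (cases "l \<in> J") (auto intro: less_imp_le)
          then have "0 \<le> m * ev l w" using less.prems(3) by simp
          then show "ev l x \<le> m * ev l (a + w)" using l by (simp add: form_add distrib_left) (use l in fastforce)
        qed
        then show False using a less.prems(7) by auto
      qed
    qed (use keys_F h eq less.prems in \<open>simp_all\<close>)
    have "koszul_cofinite F S (S' \<union> (+) w ` S) \<and>
        (\<forall>d. corank_ge J (Suc d) \<longrightarrow> koszul_exact F d S (S' \<union> (+) w ` S))"
    proof (rule quotient_step[OF less.prems(1) False wJ w less.prems(3-7)])
      fix J' x' m' T T' y'
      assume J': "J \<subset> J'" "J' \<subseteq> \<Lambda>" "0 < m'" "absorbing cone T" "absorbing cone T'" "T' \<subseteq> T"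
        "T - T' = piece J' x' m'" "\<forall>l\<in>J'. ev l y' = 0" "\<forall>l\<in>\<Lambda> - J'. 0 < ev l y'"
      have "card (\<Lambda> - J') < card (\<Lambda> - J)" using J' finite_forms by (intro psubset_card_mono) auto
      then show "koszul_cofinite F T T' \<and> (\<forall>d. corank_ge J' d \<longrightarrow> koszul_exact F d T T')"
        by (rule less.hyps) (use J' less.prems(2) in auto)
    qed
    then have "koszul_cofinite F S S'" and ex: "\<And>d. corank_ge J (Suc d) \<Longrightarrow> koszul_exact F (Suc d) S S'"
      using st.cofinite st.exact by blast+
    moreover have "koszul_exact F d S S'" if "corank_ge J d" for d
      using that ex by (cases d) (auto simp: koszul_exact_0)
    ultimately show ?thesis by blast
  qed
qed

text \<open>The cone is the piece for J = {}, and t, being positive on all forms, takes the role of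
  w. Only the passage to the boundary is used and no homotopy, whence the drop from Suc d to
  d.\<close>

theorem cone_quotient:
  assumes ne: "\<Lambda> \<noteq> {}" and t: "\<And>l. l \<in> \<Lambda> \<Longrightarrow> 0 < ev l t"
  shows "koszul_cofinite F cone ((+) t ` cone)"
    and "corank_ge {} (Suc d) \<Longrightarrow> koszul_exact F d cone ((+) t ` cone)"
proof -
  have "koszul_cofinite F cone ({} \<union> (+) t ` cone) \<and>
      (\<forall>d. corank_ge {} (Suc d) \<longrightarrow> koszul_exact F d cone ({} \<union> (+) t ` cone))"
  proof (rule quotient_step)
    show "absorbing cone cone" by (auto simp: absorbing_def cone form_add)
    show "cone - {} = piece {} 0 1" by (auto simp: piece_def cone form_0)
    show "koszul_cofinite F T T' \<and> (\<forall>d. corank_ge J' d \<longrightarrow> koszul_exact F d T T')"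
      if "{} \<subset> J'" "J' \<subseteq> \<Lambda>" "0 < m'" "absorbing cone T" "absorbing cone T'" "T' \<subseteq> T"
        "T - T' = piece J' x' m'" "\<forall>l\<in>J'. ev l y = 0" "\<forall>l\<in>\<Lambda> - J'. 0 < ev l y" for J' x' m' T T' y
      using that by (intro face_piece[of J' m' T T' x' y]) auto
  qed (use ne t in \<open>simp_all add: absorbing_def\<close>)
  then show "koszul_cofinite F cone ((+) t ` cone)"
    and "corank_ge {} (Suc d) \<Longrightarrow> koszul_exact F d cone ((+) t ` cone)" by auto
qed

end

section \<open>Nullstellensatz for Laurent polynomials\<close>

text \<open>Gaussian elimination: the equation of \<open>b0\<close> is solved for an unknown
  \<open>t0\<close> with nonzero coefficient and substituted into the others. It serves over
  \<complex> in the Nullstellensatz and over \<rat> for finding lattice vectors.\<close>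

lemma homogeneous_system:
  fixes a :: "'b \<Rightarrow> 't \<Rightarrow> 'k::field"
  assumes "finite B" "finite T" "card B < card T"
  shows "\<exists>x. (\<exists>t\<in>T. x t \<noteq> 0) \<and> (\<forall>b\<in>B. (\<Sum>t\<in>T. x t * a b t) = 0)"
  using assms
proof (induction B arbitrary: T a rule: finite_induct)
  case empty
  then have "T \<noteq> {}" by auto
  then show ?case by (intro exI[of _ "\<lambda>_. 1"]) auto
next
  case (insert b0 B)
  show ?case
  proof (cases "\<forall>t\<in>T. a b0 t = 0")
    case True
    have "card B < card T" using insert.hyps insert.prems by simp
    then obtain x where "\<exists>t\<in>T. x t \<noteq> 0" "\<forall>b\<in>B. (\<Sum>t\<in>T. x t * a b t) = 0"
      using insert.IH[OF insert.prems(1)] by blast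
    then show ?thesis using True by (intro exI[of _ x]) auto
  next
    case False
    then obtain t0 where t0: "t0 \<in> T" "a b0 t0 \<noteq> 0" by blast
    define T' where "T' = T - {t0}"
    have T: "T = insert t0 T'" "t0 \<notin> T'" "finite T'" using t0 insert.prems(1) by (auto simp: T'_def)
    then have "card B < card T'" using insert.hyps insert.prems by simp
    then obtain x where x: "\<exists>t\<in>T'. x t \<noteq> 0"
        "\<forall>b\<in>B. (\<Sum>t\<in>T'. x t * (a b t - a b t0 * a b0 t / a b0 t0)) = 0"
      using insert.IH[OF T(3), of "\<lambda>b t. a b t - a b t0 * a b0 t / a b0 t0"] by blast
    define z where "z = - (\<Sum>t\<in>T'. x t * a b0 t) / a b0 t0"
    define x' where "x' = x(t0 := z)"
    have sum': "(\<Sum>t\<in>T. x' t * a b t) = z * a b t0 + (\<Sum>t\<in>T'. x t * a b t)" for b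
    proof -
      have "(\<Sum>t\<in>T'. x' t * a b t) = (\<Sum>t\<in>T'. x t * a b t)"
        using T(2) by (intro sum.cong) (auto simp: x'_def)
      then show ?thesis unfolding T(1) using T(2,3) by (simp add: x'_def)
    qed
    have "(\<Sum>t\<in>T. x' t * a b0 t) = 0" unfolding sum' using t0(2) by (simp add: z_def)
    moreover have "(\<Sum>t\<in>T. x' t * a b t) = 0" if "b \<in> B" for b
    proof -
      have "(\<Sum>t\<in>T'. x t * (a b t - a b t0 * a b0 t / a b0 t0))
          = (\<Sum>t\<in>T'. x t * a b t) - (\<Sum>t\<in>T'. x t * a b0 t * (a b t0 / a b0 t0))"
        by (simp add: sum_subtractf[symmetric] algebra_simps)
      also have "\<dots> = (\<Sum>t\<in>T'. x t * a b t) - (\<Sum>t\<in>T'. x t * a b0 t) * (a b t0 / a b0 t0)"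
        by (simp add: sum_distrib_right sum_divide_distrib)
      also have "\<dots> = (\<Sum>t\<in>T. x' t * a b t)" unfolding sum' by (simp add: z_def)
      finally show ?thesis using x(2) that by simp
    qed
    moreover have "\<exists>t\<in>T. x' t \<noteq> 0" using x(1) T by (auto simp: x'_def)
    ultimately show ?thesis by (intro exI[of _ x']) auto
  qed
qed

section \<open>Maximal ideals of Laurent rings and their residues\<close>

definition ring_ideal :: "'a::comm_ring_1 set \<Rightarrow> bool" where
  "ring_ideal I \<longleftrightarrow> 0 \<in> I \<and> (\<forall>a\<in>I. \<forall>b\<in>I. a + b \<in> I) \<and> (\<forall>r. \<forall>a\<in>I. r * a \<in> I)"

lemma ring_ideal_diff: "ring_ideal I \<Longrightarrow> a \<in> I \<Longrightarrow> b \<in> I \<Longrightarrow> a - b \<in> I"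
  unfolding ring_ideal_def by (metis add_uminus_conv_diff mult_minus1)

lemma ring_ideal_sum: "ring_ideal I \<Longrightarrow> (\<And>x. x \<in> A \<Longrightarrow> g x \<in> I) \<Longrightarrow> sum g A \<in> I"
  by (induction A rule: infinite_finite_induct) (auto simp: ring_ideal_def)

text \<open>Maximality is delivered as invertibility modulo \<open>M\<close>, the form in which
  primality and residues are derived from it.\<close>

lemma maximal_ideal_exists:
  fixes I :: "'a::comm_ring_1 set"
  assumes "ring_ideal I" "1 \<notin> I"
  obtains M where "I \<subseteq> M" "ring_ideal M" "1 \<notin> M" "\<forall>x. x \<notin> M \<longrightarrow> (\<exists>y. 1 - x * y \<in> M)"
proof -
  define A where "A = {M. I \<subseteq> M \<and> ring_ideal M \<and> 1 \<notin> M}"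
  have "\<exists>M\<in>A. \<forall>X\<in>A. M \<subseteq> X \<longrightarrow> X = M"
  proof (rule subset_Zorn_nonempty)
    show "A \<noteq> {}" using assms by (auto simp: A_def)
    fix C assume C: "C \<noteq> {}" "subset.chain A C"
    have CA: "\<And>M. M \<in> C \<Longrightarrow> I \<subseteq> M \<and> ring_ideal M \<and> 1 \<notin> M" using C(2) by (auto simp: subset.chain_def A_def)
    have "ring_ideal (\<Union>C)"
      unfolding ring_ideal_def
    proof (intro conjI allI ballI)
      show "0 \<in> \<Union>C" using C(1) CA by (auto simp: ring_ideal_def)
      fix a b assume "a \<in> \<Union>C" "b \<in> \<Union>C"
      then obtain X Y where XY: "X \<in> C" "Y \<in> C" "a \<in> X" "b \<in> Y" by blast
      then have "X \<subseteq> Y \<or> Y \<subseteq> X" using C(2) by (auto simp: subset.chain_def)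
      then obtain Z where "Z \<in> C" "a \<in> Z" "b \<in> Z" using XY by blast
      then show "a + b \<in> \<Union>C" using CA[of Z] by (auto simp: ring_ideal_def)
    next
      fix r a assume "a \<in> \<Union>C"
      then show "r * a \<in> \<Union>C" using CA by (auto simp: ring_ideal_def)
    qed
    then show "\<Union>C \<in> A" using C(1) CA by (auto simp: A_def)
  qed
  then obtain M where M: "M \<in> A" "\<And>X. X \<in> A \<Longrightarrow> M \<subseteq> X \<Longrightarrow> X = M" by blast
  have id: "ring_ideal M" "1 \<notin> M" "I \<subseteq> M" using M(1) by (auto simp: A_def)
  show thesis
  proof (rule that[OF id(3,1,2)], intro allI impI)
    fix x assume x: "x \<notin> M"
    define X where "X = {a + r * x | a r. a \<in> M}"
    have MX: "M \<subseteq> X"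
    proof
      fix a assume "a \<in> M"
      then show "a \<in> X" unfolding X_def by (intro CollectI exI[of _ a] exI[of _ 0]) simp
    qed
    have "0 + 1 * x \<in> X" unfolding X_def using id(1) by (blast intro: ring_ideal_def[THEN iffD1, THEN conjunct1])
    then have "X \<noteq> M" using x by auto
    moreover have "ring_ideal X"
      unfolding ring_ideal_def
    proof (intro conjI allI ballI)
      show "0 \<in> X" using MX id(1) by (auto simp: ring_ideal_def)
      fix a b assume "a \<in> X" "b \<in> X"
      then obtain a' r b' s where "a = a' + r * x" "b = b' + s * x" "a' \<in> M" "b' \<in> M" by (auto simp: X_def)
      then show "a + b \<in> X" unfolding X_def using id(1)
        by (intro CollectI exI[of _ "a' + b'"] exI[of _ "r + s"]) (auto simp: ring_ideal_def algebra_simps)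
    next
      fix s a assume "a \<in> X"
      then obtain a' r where "a = a' + r * x" "a' \<in> M" by (auto simp: X_def)
      then have "s * a = s * a' + (s * r) * x" "s * a' \<in> M"
        using id(1) by (simp add: algebra_simps) (use id(1) \<open>a' \<in> M\<close> in \<open>simp add: ring_ideal_def\<close>)
      then show "s * a \<in> X" unfolding X_def by blast
    qed
    ultimately have "1 \<in> X" using M(2)[OF _ MX] MX id(3) by (auto simp: A_def)
    then obtain a r where "1 = a + r * x" "a \<in> M" by (auto simp: X_def)
    then have "1 - x * r \<in> M" by (metis add_diff_cancel_right' mult.commute)
    then show "\<exists>y. 1 - x * y \<in> M" by blast
  qed
qed

abbreviation scal :: "complex \<Rightarrow> ('e::comm_monoid_add \<Rightarrow>\<^sub>0 complex)" where
  "scal \<equiv> Poly_Mapping.single 0"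

lemma scal_mult_scal: "scal a * scal b = scal (a * b)"
  by (simp add: mult_single)

definition poly_scal :: "('e::comm_monoid_add \<Rightarrow>\<^sub>0 complex) \<Rightarrow> complex poly \<Rightarrow> ('e \<Rightarrow>\<^sub>0 complex)" where
  "poly_scal x p = poly (map_poly scal p) x"

lemma poly_scal_0 [simp]: "poly_scal x 0 = 0" by (simp add: poly_scal_def)

lemma poly_scal_pCons: "poly_scal x (pCons a p) = scal a + x * poly_scal x p"
  by (simp add: poly_scal_def map_poly_pCons)

lemma poly_scal_add: "poly_scal x (p + q) = poly_scal x p + poly_scal x q"
  by (induction p q rule: poly_induct2) (simp_all add: poly_scal_pCons single_add algebra_simps)

lemma poly_scal_sum: "poly_scal x (sum p A) = (\<Sum>i\<in>A. poly_scal x (p i))"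
  by (induction A rule: infinite_finite_induct) (simp_all add: poly_scal_add)

lemma poly_scal_smult: "poly_scal x (smult c p) = scal c * poly_scal x p"
  by (induction p) (simp_all add: poly_scal_pCons scal_mult_scal[symmetric] algebra_simps)

lemma poly_scal_mult: "poly_scal x (p * q) = poly_scal x p * poly_scal x q"
  by (induction p) (simp_all add: poly_scal_pCons poly_scal_add poly_scal_smult algebra_simps)

lemma poly_scal_prod: "poly_scal x (prod p A) = (\<Prod>i\<in>A. poly_scal x (p i))"
  by (induction A rule: infinite_finite_induct) (simp_all add: poly_scal_mult, simp_all add: poly_scal_def)

locale laurent_maximal_ideal =
  fixes M :: "('e::{countable,ab_group_add} \<Rightarrow>\<^sub>0 complex) set"
  assumes ideal: "ring_ideal M" and proper: "1 \<notin> M"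
    and maximal: "\<And>x. x \<notin> M \<Longrightarrow> \<exists>y. 1 - x * y \<in> M"
begin

lemma add_mem: "a \<in> M \<Longrightarrow> b \<in> M \<Longrightarrow> a + b \<in> M"
  and mult_mem: "a \<in> M \<Longrightarrow> r * a \<in> M"
  and zero_mem: "0 \<in> M"
  using ideal by (auto simp: ring_ideal_def)

lemma diff_mem: "a \<in> M \<Longrightarrow> b \<in> M \<Longrightarrow> a - b \<in> M"
  using ring_ideal_diff[OF ideal] .

lemma prime: assumes "x * y \<in> M" "x \<notin> M" shows "y \<in> M"
proof -
  obtain z where "1 - x * z \<in> M" using maximal[OF assms(2)] by blast
  then have "y * (1 - x * z) \<in> M" "z * (x * y) \<in> M" using assms(1) mult_mem by blast+
  then have "y * (1 - x * z) + z * (x * y) \<in> M" by (rule add_mem)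
  then show ?thesis by (simp add: algebra_simps)
qed

lemma scal_mem: assumes "scal c \<in> M" shows "c = 0"
proof (rule ccontr)
  assume "c \<noteq> 0"
  then have "scal (inverse c) * scal c = (1 :: 'e \<Rightarrow>\<^sub>0 complex)" by (simp add: scal_mult_scal)
  then show False using mult_mem[OF assms, of "scal (inverse c)"] proper by simp
qed

text \<open>Over \<complex> the polynomial splits into linear factors, and as \<open>M\<close> is
  prime one of them, evaluated at x, lies in \<open>M\<close>.\<close>

lemma poly_root:
  assumes "poly_scal x p \<in> M" "p \<noteq> 0"
  shows "\<exists>c. x - scal c \<in> M"
  using assms
proof (induction "degree p" arbitrary: p rule: less_induct)
  case less
  show ?case
  proof (cases "degree p = 0")
    case True
    then obtain c where "p = [:c:]" using degree_eq_zeroE by blast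
    then show ?thesis using less.prems scal_mem[of c] by (simp add: poly_scal_pCons)
  next
    case False
    then obtain z where "poly p z = 0"
      using fundamental_theorem_of_algebra[of p] by (auto simp: constant_degree)
    then obtain q where q: "p = [:-z, 1:] * q" by (auto simp: poly_eq_0_iff_dvd)
    then have q0: "q \<noteq> 0" using less.prems by auto
    have dq: "degree q < degree p" unfolding q using q0 by (subst degree_mult_eq) auto
    have "poly_scal x [:-z, 1:] = x - scal z" by (simp add: poly_scal_pCons single_uminus)
    then have "(x - scal z) * poly_scal x q \<in> M" using less.prems(1) unfolding q poly_scal_mult by simp
    then show ?thesis using prime[of "x - scal z"] less.hyps[OF dq _ q0] by blast
  qed
qed

text \<open>Otherwise the uncountably many inverses of \<open>x - c\<close> modulo \<open>M\<close> would be linearly independent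
  in a space of countable dimension.\<close>

lemma residue_exists: "\<exists>c. x - scal c \<in> M"
proof (rule ccontr)
  assume no: "\<nexists>c. x - scal c \<in> M"
  then have "\<forall>c. \<exists>y. 1 - (x - scal c) * y \<in> M" using maximal by blast
  then obtain g where g: "\<And>c. 1 - (x - scal c) * g c \<in> M" by metis
  \<comment> \<open>The exponents are countable and are exhausted by the finite sets
    \<open>B N\<close>. There are uncountably many inverses \<open>g c\<close>, so infinitely many
    of them have their supports in one \<open>B N\<close>.\<close>
  define B :: "nat \<Rightarrow> 'e set" where "B = (\<lambda>N. {k. to_nat k < N})"
  have finB: "finite (B N)" for N
    unfolding B_def by (rule finite_imageD[of to_nat]) (auto intro: finite_subset[of _ "{..<N}"] inj_on_subset[OF inj_to_nat])
  define S where "S = (\<lambda>N. {c. pkeys (g c) \<subseteq> B N})"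
  have "(\<Union>N. S N) = UNIV"
  proof (intro set_eqI iffI UNIV_I)
    fix c
    have "k \<in> B (Suc (Max (to_nat ` pkeys (g c))))" if "k \<in> pkeys (g c)" for k
      using that by (auto simp: B_def less_Suc_eq_le intro!: Max_ge)
    then show "c \<in> (\<Union>N. S N)" by (auto simp: S_def)
  qed
  moreover have "uncountable (UNIV :: complex set)" by (rule uncountable_UNIV_complex)
  ultimately obtain N where "infinite (S N)"
    by (metis countable_UN[of UNIV S] countable_finite uncountable_infinite countableI_type)
  then obtain T where T: "T \<subseteq> S N" "finite T" "card T = Suc (card (B N))"
    using infinite_arbitrarily_large by metis
  \<comment> \<open>More inverses than available exponents satisfy a nontrivial linear relation.
    Multiplying it by the product of all x - d produces a polynomial p with value in
    \<open>M\<close> at x.\<close>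
  obtain l where l: "\<exists>c\<in>T. l c \<noteq> 0" "\<forall>b\<in>B N. (\<Sum>c\<in>T. l c * plookup (g c) b) = 0"
    using homogeneous_system[OF finB T(2), of N "\<lambda>b c. plookup (g c) b"] T(3) by auto
  have lg: "(\<Sum>c\<in>T. scal (l c) * g c) = 0"
  proof (rule poly_mapping_eqI)
    fix b
    have "plookup (\<Sum>c\<in>T. scal (l c) * g c) b = (\<Sum>c\<in>T. l c * plookup (g c) b)"
      by (simp add: lookup_sum lookup_single_mult)
    also have "\<dots> = 0"
    proof (cases "b \<in> B N")
      case False
      then have "plookup (g c) b = 0" if "c \<in> T" for c
        using T(1) that by (auto simp: S_def in_keys_iff subset_iff)
      then show ?thesis by simp
    qed (use l in auto)
    finally show "plookup (\<Sum>c\<in>T. scal (l c) * g c) b = plookup 0 b" by simp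
  qed
  define q where "q = (\<lambda>c. \<Prod>d\<in>T - {c}. [:-d, 1:] :: complex poly)"
  define p where "p = (\<Sum>c\<in>T. smult (l c) (q c))"
  have lin: "poly_scal x [:-d, 1:] = x - scal d" for d by (simp add: poly_scal_pCons single_uminus)
  have "poly_scal x p = (\<Sum>c\<in>T. scal (l c) * (\<Prod>d\<in>T - {c}. x - scal d))"
    unfolding p_def q_def poly_scal_sum poly_scal_smult poly_scal_prod lin ..
  also have "\<dots> = (\<Sum>c\<in>T. scal (l c) * (\<Prod>d\<in>T - {c}. x - scal d) * (1 - (x - scal c) * g c))
      + (\<Sum>c\<in>T. scal (l c) * ((x - scal c) * (\<Prod>d\<in>T - {c}. x - scal d)) * g c)"
    by (simp add: sum.distrib[symmetric] algebra_simps)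
  also have "(\<Sum>c\<in>T. scal (l c) * ((x - scal c) * (\<Prod>d\<in>T - {c}. x - scal d)) * g c)
      = (\<Sum>c\<in>T. (\<Prod>d\<in>T. x - scal d) * (scal (l c) * g c))"
  proof (intro sum.cong refl)
    fix c assume "c \<in> T"
    then have "(\<Prod>d\<in>T. x - scal d) = (x - scal c) * (\<Prod>d\<in>T - {c}. x - scal d)"
      by (rule prod.remove[OF T(2)])
    then show "scal (l c) * ((x - scal c) * (\<Prod>d\<in>T - {c}. x - scal d)) * g c
        = (\<Prod>d\<in>T. x - scal d) * (scal (l c) * g c)" by (simp only: mult_ac)
  qed
  also have "\<dots> = 0" by (simp only: sum_distrib_left[symmetric] lg mult_zero_right)
  finally have "poly_scal x p \<in> M"
    using g mult_mem by (auto intro!: ring_ideal_sum[OF ideal])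
  \<comment> \<open>At a node c with nonzero \<open>l c\<close> only the summand of c
    survives.\<close>
  moreover have "p \<noteq> 0"
  proof -
    obtain c where c: "c \<in> T" "l c \<noteq> 0" using l(1) by blast
    have "poly (q d) c = 0" if "d \<in> T" "d \<noteq> c" for d
      unfolding q_def poly_prod using that c(1) T(2) by (intro prod_zero) auto
    then have "poly p c = l c * poly (q c) c"
      unfolding p_def poly_sum using c(1) T(2) by (subst sum.remove[OF T(2) c(1)]) (auto intro!: sum.neutral)
    also have "poly (q c) c \<noteq> 0" unfolding q_def poly_prod using T(2) by auto
    ultimately show ?thesis using c(2) by auto
  qed
  ultimately show False using poly_root no by blast
qed

end

definition torus_char :: "complex ^ 'n::finite \<Rightarrow> (int, 'n) vec \<Rightarrow> complex" where
  "torus_char u k = (\<Prod>i\<in>UNIV. (u $ i) powi (k $ i))"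

lemma torus_char_add: "(\<forall>i. u $ i \<noteq> 0) \<Longrightarrow> torus_char u (k + l) = torus_char u k * torus_char u l"
  by (simp add: torus_char_def power_int_add prod.distrib)

lemma torus_char_0: "torus_char u 0 = 1"
  by (simp add: torus_char_def)

lemma torus_char_axis: "torus_char u (axis i 1) = u $ i"
proof -
  have "torus_char u (axis i 1) = (\<Prod>j\<in>UNIV. if j = i then u $ j else 1)"
    unfolding torus_char_def by (intro prod.cong) (auto simp: axis_def)
  then show ?thesis by simp
qed

text \<open>Otherwise the ideal of the \<open>F i\<close> lies in a maximal ideal, and the residues
  of the coordinates form a common zero. Monomials are units of the Laurent ring, hence these
  residues are nonzero and the zero lies on the torus.\<close>

theorem laurent_nullstellensatz:
  fixes F :: "'i::finite \<Rightarrow> 'n::finite laurent"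
  assumes nz: "\<And>u. (\<forall>j. u $ j \<noteq> 0) \<Longrightarrow> \<exists>i. eval_laurent (F i) u \<noteq> 0"
  shows "\<exists>g. (\<Sum>i\<in>UNIV. F i * g i) = 1"
proof (rule ccontr)
  assume no: "\<nexists>g. (\<Sum>i\<in>UNIV. F i * g i) = 1"
  define I where "I = range (\<lambda>g. \<Sum>i\<in>UNIV. F i * g i)"
  have "ring_ideal I"
    unfolding ring_ideal_def
  proof (intro conjI allI ballI)
    show "0 \<in> I" unfolding I_def by (intro image_eqI[of _ _ "\<lambda>_. 0"]) auto
    fix a b assume "a \<in> I" "b \<in> I"
    then obtain g h where "a = (\<Sum>i\<in>UNIV. F i * g i)" "b = (\<Sum>i\<in>UNIV. F i * h i)" by (auto simp: I_def)
    then show "a + b \<in> I" unfolding I_def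
      by (intro image_eqI[of _ _ "\<lambda>i. g i + h i"]) (auto simp: algebra_simps sum.distrib)
  next
    fix r a assume "a \<in> I"
    then obtain g where "a = (\<Sum>i\<in>UNIV. F i * g i)" by (auto simp: I_def)
    then show "r * a \<in> I" unfolding I_def
      by (intro image_eqI[of _ _ "\<lambda>i. r * g i"]) (auto simp: sum_distrib_left mult_ac)
  qed
  moreover have "1 \<notin> I" using no unfolding I_def by (metis (mono_tags, lifting) imageE)
  ultimately obtain M where M: "I \<subseteq> M" "ring_ideal M" "1 \<notin> M" "\<forall>x. x \<notin> M \<longrightarrow> (\<exists>y. 1 - x * y \<in> M)"
    by (rule maximal_ideal_exists)
  interpret laurent_maximal_ideal M by unfold_locales (use M in blast)+
  have "\<forall>i. \<exists>c. psingle (axis i 1) 1 - scal c \<in> M" using residue_exists by blast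
  then obtain c where c: "\<And>i. psingle (axis i 1) 1 - scal (c i) \<in> M" by metis
  define u where "u = (\<chi> i. c i)"
  have unit: "psingle k 1 \<notin> M" for k
  proof
    assume "psingle k 1 \<in> M"
    from mult_mem[OF this, of "psingle (-k) 1"] show False using proper by (simp add: mult_single)
  qed
  have u0: "\<forall>i. u $ i \<noteq> 0"
  proof
    fix i show "u $ i \<noteq> 0"
      using c[of i] unit[of "axis i 1"] by (auto simp: u_def)
  qed
  define A where "A = {k. psingle k 1 - scal (torus_char u k) \<in> M}"
  have A_add: "k + l \<in> A" if "k \<in> A" "l \<in> A" for k l
  proof -
    have "psingle k 1 * (psingle l 1 - scal (torus_char u l)) + scal (torus_char u l) * (psingle k 1 - scal (torus_char u k)) \<in> M"
      using that by (intro add_mem mult_mem) (auto simp: A_def)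
    then show ?thesis
      by (simp add: A_def torus_char_add[OF u0] algebra_simps mult_single)
  qed
  have A_uminus: "- k \<in> A" if "k \<in> A" for k
  proof -
    have 1: "torus_char u (-k) * torus_char u k = 1"
      using torus_char_add[OF u0, of "-k" k] by (simp add: torus_char_0)
    have "(- psingle (-k) (torus_char u (-k))) * (psingle k 1 - scal (torus_char u k)) \<in> M"
      using that by (intro mult_mem) (auto simp: A_def)
    then show ?thesis using 1 by (simp add: A_def algebra_simps mult_single)
  qed
  have A_0: "0 \<in> A" by (simp add: A_def torus_char_0 zero_mem)
  have A_axis: "axis i 1 \<in> A" for i using c[of i] by (simp add: A_def torus_char_axis u_def)
  have A_axis_int: "axis i z \<in> A" for i z
  proof (induction z rule: int_induct[of _ 0])
    case base
    then show ?case using A_0 by (simp add: axis_eq_0_iff[THEN iffD2])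
  next
    case (step1 z)
    have "axis i (z + 1) = axis i z + axis i 1" by (simp add: vec_eq_iff axis_def)
    then show ?case using A_add[OF step1(2) A_axis] by simp
  next
    case (step2 z)
    have "axis i (z - 1) = axis i z + - axis i 1" by (simp add: vec_eq_iff axis_def)
    then show ?case using A_add[OF step2(2) A_uminus[OF A_axis]] by simp
  qed
  have "k \<in> A" for k
  proof -
    have "(\<Sum>i\<in>J. axis i (k $ i)) \<in> A" for J
      by (induction J rule: infinite_finite_induct) (simp_all add: A_0 A_add A_axis_int)
    moreover have "(\<Sum>i\<in>UNIV. axis i (k $ i)) = k"
      by (simp add: vec_eq_iff axis_def)
    ultimately show ?thesis by metis
  qed
  then have kM: "psingle k 1 - scal (torus_char u k) \<in> M" for k by (simp add: A_def)
  have ev: "g - scal (eval_laurent g u) \<in> M" for g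
  proof -
    have E: "scal (eval_laurent g u) = (\<Sum>k\<in>pkeys g. scal (plookup g k * torus_char u k))"
      unfolding eval_laurent_def torus_char_def
      by (rule poly_mapping_eqI) (simp add: lookup_sum lookup_single when_def)
    have "g - scal (eval_laurent g u) =
       (\<Sum>k\<in>pkeys g. psingle k (plookup g k)) - (\<Sum>k\<in>pkeys g. scal (plookup g k * torus_char u k))"
      unfolding E using poly_mapping_sum_single[of g] by simp
    also have "\<dots>
       = (\<Sum>k\<in>pkeys g. scal (plookup g k) * (psingle k 1 - scal (torus_char u k)))"
      by (simp add: sum_subtractf[symmetric] right_diff_distrib mult_single)
    also have "\<dots> \<in> M" by (intro ring_ideal_sum[OF ideal] mult_mem kM)
    finally show ?thesis .
  qed
  have "eval_laurent (F i) u = 0" for i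
  proof (rule scal_mem)
    have "F i \<in> I" unfolding I_def
      by (intro image_eqI[of _ _ "\<lambda>j. if j = i then 1 else 0"]) (simp_all add: if_distrib cong: if_cong)
    then have "F i \<in> M" using M(1) by blast
    from diff_mem[OF this ev[of "F i" ]] show "scal (eval_laurent (F i) u) \<in> M" by (simp only: diff_diff_eq2 add_diff_cancel_left')
  qed
  then show False using nz[OF u0] by blast
qed

section \<open>The Newton polytope and its facets\<close>

lemma real_exponent_add: "real_exponent (a + b) = real_exponent a + real_exponent b"
  by (simp add: real_exponent_def vec_eq_iff)

lemma real_exponent_0 [simp]: "real_exponent 0 = 0"
  by (simp add: real_exponent_def vec_eq_iff)

lemma real_exponent_eq_0_iff [simp]: "real_exponent a = 0 \<longleftrightarrow> a = 0"
  by (simp add: real_exponent_def vec_eq_iff)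

lemma det_Ints:
  fixes A :: "real ^ 'n::finite ^ 'n"
  assumes "\<And>i j. A $ i $ j \<in> \<int>" shows "det A \<in> \<int>"
  unfolding det_def by (intro Ints_sum Ints_mult Ints_prod) (auto simp: assms)

text \<open>By Cramer's rule a linear form taking integral values on a lattice basis of \<open>\<rat>\<^sup>n\<close> is rational.\<close>

lemma linear_form_denominator:
  fixes L :: "real ^ 'n::finite \<Rightarrow> real" and S :: "(int, 'n) vec set"
  assumes L: "linear L" and S: "span (real_exponent ` S) = UNIV" and int: "\<And>k. k \<in> S \<Longrightarrow> L (real_exponent k) \<in> \<int>"
  shows "\<exists>D::nat. 0 < D \<and> (\<forall>k. real D * L (real_exponent k) \<in> \<int>)"
proof -
  obtain B where B: "B \<subseteq> real_exponent ` S" "independent B" "real_exponent ` S \<subseteq> span B" "card B = dim (real_exponent ` S)"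
    by (rule basis_exists)
  have "span B = UNIV" using S B(3) by (metis span_mono span_span top.extremum_uniqueI)
  have "card B = CARD('n)" using B(4) S dim_span[of "real_exponent ` S"] by simp
  moreover have "finite B" using B(2) independent_imp_finite by blast
  ultimately obtain g where g: "bij_betw g (UNIV :: 'n set) B"
    by (metis bij_betw_iff_card finite)
  define A :: "real ^ 'n ^ 'n" where "A = (\<chi> i. g i)"
  define c where "c = (\<chi> j. L (axis j 1))"
  have Lc: "L x = c \<bullet> x" for x
  proof -
    have "L x = L (\<Sum>j\<in>UNIV. (x $ j) *\<^sub>R axis j 1)" by (simp add: basis_expansion flip: scalar_mult_eq_scaleR)
    also have "\<dots> = (\<Sum>j\<in>UNIV. x $ j * L (axis j 1))" by (simp add: linear_sum[OF L] linear_scale[OF L])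
    finally show ?thesis by (simp add: c_def inner_vec_def mult.commute)
  qed
  have "x = 0" if "A *v x = 0" for x
  proof -
    have "g i \<bullet> x = 0" for i
      using that by (simp add: A_def matrix_vector_mult_def inner_vec_def vec_eq_iff)
    then have "x \<bullet> b = 0" if "b \<in> B" for b
      using g that by (auto simp: bij_betw_def inner_commute)
    then have "span B \<subseteq> {b. x \<bullet> b = 0}" by (intro span_minimal subspace_hyperplane) auto
    then have "x \<bullet> x = 0" using \<open>span B = UNIV\<close> by blast
    then show ?thesis by simp
  qed
  then have "\<exists>A'. A' ** A = mat 1" using matrix_left_invertible_ker by blast
  then have d0: "det A \<noteq> 0" using invertible_det_nz invertible_left_inverse by blast
  define b where "b = (\<chi> i. L (g i))"
  have "A *v c = b" by (simp add: A_def b_def vec_eq_iff matrix_vector_mult_def Lc inner_vec_def mult.commute)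
  then have c: "c = (\<chi> k. det(\<chi> i j. if j=k then b$i else A$i$j) / det A)" using cramer[OF d0] by blast
  have gS: "\<exists>k\<in>S. g i = real_exponent k" for i using g B(1) by (auto simp: bij_betw_def)
  have Aint: "A $ i $ j \<in> \<int>" for i j using gS[of i] by (auto simp: A_def real_exponent_def)
  have bint: "b $ i \<in> \<int>" for i using gS[of i] int by (auto simp: b_def)
  have dc: "det A * c $ k \<in> \<int>" for k
  proof -
    have "det A * c $ k = det(\<chi> i j. if j=k then b$i else A$i$j)" using d0 by (subst c) simp
    also have "\<dots> \<in> \<int>" by (rule det_Ints) (simp add: Aint bint)
    finally show ?thesis .
  qed
  obtain z where z: "det A = of_int z" using det_Ints[OF Aint] by (auto elim: Ints_cases)
  show ?thesis
  proof (intro exI[of _ "nat \<bar>z\<bar>"] conjI allI)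
    show "0 < nat \<bar>z\<bar>" using d0 z by auto
    fix k
    have "det A * L (real_exponent k) = (\<Sum>j\<in>UNIV. (det A * c $ j) * of_int (k $ j))"
      by (simp add: Lc inner_vec_def real_exponent_def sum_distrib_left mult.assoc)
    also have "\<dots> \<in> \<int>" by (intro Ints_sum Ints_mult dc) auto
    finally have i: "det A * L (real_exponent k) \<in> \<int>" .
    have "real (nat \<bar>z\<bar>) = det A \<or> real (nat \<bar>z\<bar>) = - det A" using z by (auto simp: abs_if)
    then show "real (nat \<bar>z\<bar>) * L (real_exponent k) \<in> \<int>" using i by (auto simp: minus_in_Ints_iff)
  qed
qed

lemma face_part_eq_restrict: "face_part f D = pm_restrict {k. real_exponent k \<in> D} f"
proof (rule poly_mapping_eqI)
  fix k
  show "plookup (face_part f D) k = plookup (pm_restrict {k. real_exponent k \<in> D} f) k"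
    by (simp add: face_part_def lookup_sum lookup_single lookup_pm_restrict when_def in_keys_iff)
qed

lemma lookup_log_deriv: "plookup (log_deriv i g) k = of_int (k $ i) * plookup g k"
  by (auto simp: log_deriv_def lookup_mapp when_def in_keys_iff)

locale convenient_laurent =
  fixes f :: "'n::{finite,linorder} laurent"
  assumes convenient: "convenient f"
begin

abbreviation "\<Gamma> \<equiv> newton_polytope f"
abbreviation "\<Lambda> \<equiv> newton_facets f"
definition lform :: "(real, 'n) vec set \<Rightarrow> (int, 'n) vec \<Rightarrow> real" where
  "lform \<sigma> a = facet_form \<sigma> (real_exponent a)"

lemma polytope: "polytope \<Gamma>"
  unfolding newton_polytope_def by (intro polytope_convex_hull) simp

lemma zero_interior: "0 \<in> interior \<Gamma>"
  using convenient by (simp add: convenient_def)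

lemma aff_dim_polytope: "aff_dim \<Gamma> = CARD('n)"
  using zero_interior by (metis DIM_cart DIM_real aff_dim_nonempty_interior emptyE mult.right_neutral)

lemma newton_facets_eq: "\<Lambda> = {\<sigma>. \<sigma> facet_of \<Gamma>}"
proof -
  have "\<sigma> \<noteq> {}" if "aff_dim \<sigma> = int CARD('n) - 1" for \<sigma> :: "(real, 'n) vec set"
    using that by (metis aff_dim_empty_eq diff_eq_eq add.left_inverse card_0_eq finite of_nat_0 of_nat_eq_iff UNIV_not_empty add_diff_cancel)
  then show ?thesis by (auto simp: newton_facets_def facet_of_def aff_dim_polytope)
qed

lemma finite_facets: "finite \<Lambda>"
  unfolding newton_facets_eq by (rule finite_polytope_facets[OF polytope])

text \<open>The facet lies in the hyperplane L = 1, which misses the origin, so adding the origin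
  raises its dimension from n - 1 to n.\<close>

lemma facet_span:
  assumes "\<sigma> \<in> \<Lambda>" and L: "linear L" "\<forall>x\<in>\<sigma>. L x = (1::real)"
  shows "span \<sigma> = UNIV"
proof -
  have "L x = 1" if "x \<in> affine hull \<sigma>" for x
  proof -
    have "affine {x. L x = 1}"
      by (auto simp: affine_def linear_add[OF L(1)] linear_scale[OF L(1)])
    then have "affine hull \<sigma> \<subseteq> {x. L x = 1}" using L(2) by (intro hull_minimal) auto
    then show ?thesis using that by auto
  qed
  then have "0 \<notin> affine hull \<sigma>" using linear_0[OF L(1)] by fastforce
  then have "aff_dim (insert 0 \<sigma>) = CARD('n)"
    using assms(1) by (simp add: aff_dim_insert newton_facets_def)
  then have "dim (insert 0 \<sigma>) = CARD('n)"
    by (subst (asm) aff_dim_zero) (auto simp: hull_inc)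
  then have "span (insert 0 \<sigma>) = UNIV" using dim_eq_full[of "insert 0 \<sigma>"] by simp
  then show ?thesis by (simp add: span_insert_0)
qed

text \<open>A supporting inequality a \<bullet> x \<le> b of the facet has b > 0, because the
  polytope contains a ball around 0, and can be scaled to right-hand side 1. The form is unique
  since the facet spans the space.\<close>

lemma facet_form_exists:
  assumes "\<sigma> \<in> \<Lambda>"
  obtains c where "c \<noteq> 0" "facet_form \<sigma> = (\<lambda>x. c \<bullet> x)" "\<forall>x\<in>\<sigma>. c \<bullet> x = 1" "\<Gamma> \<subseteq> {x. c \<bullet> x \<le> 1}"
proof -
  have "\<sigma> facet_of \<Gamma>" using assms by (simp add: newton_facets_eq)
  then obtain a b where ab: "a \<noteq> 0" "\<Gamma> \<subseteq> {x. a \<bullet> x \<le> b}" "\<sigma> = \<Gamma> \<inter> {x. a \<bullet> x = b}"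
    using facet_of_polyhedron[OF polytope_imp_polyhedron[OF polytope]] by metis
  obtain e where e: "0 < e" "cball 0 e \<subseteq> \<Gamma>" using zero_interior mem_interior_cball by blast
  define y where "y = (e / norm a) *\<^sub>R a"
  have "y \<in> cball 0 e" using ab(1) e(1) by (simp add: y_def)
  then have "a \<bullet> y \<le> b" using e ab by blast
  moreover have "a \<bullet> y > 0" using ab(1) e(1) by (simp add: y_def)
  ultimately have b: "0 < b" by simp
  define c where "c = (1 / b) *\<^sub>R a"
  have c1: "\<forall>x\<in>\<sigma>. c \<bullet> x = 1" using b ab(3) by (simp add: c_def)
  have lin: "linear (\<lambda>x. c \<bullet> x)" by (intro bounded_linear.linear bounded_linear_inner_right)
  have sp: "span \<sigma> = UNIV" by (rule facet_span[OF assms lin c1])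
  have "facet_form \<sigma> = (\<lambda>x. c \<bullet> x)"
    unfolding facet_form_def
  proof (rule the_equality)
    fix L' :: "(real, 'n) vec \<Rightarrow> real" assume "linear L' \<and> (\<forall>x\<in>\<sigma>. L' x = 1)"
    then show "L' = (\<lambda>x. c \<bullet> x)"
      using linear_eq_on_span[of L' "\<lambda>x. c \<bullet> x" \<sigma>] lin c1 sp by auto
  qed (use lin c1 in auto)
  moreover have "\<Gamma> \<subseteq> {x. c \<bullet> x \<le> 1}" using ab(2) b by (auto simp: c_def divide_le_eq)
  ultimately show thesis using that[of c] c1 b ab(1) by (auto simp: c_def)
qed

lemma linear_facet_form: "\<sigma> \<in> \<Lambda> \<Longrightarrow> linear (facet_form \<sigma>)"
  using facet_form_exists[of \<sigma>] bounded_linear.linear[OF bounded_linear_inner_right] by metis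

lemma facet_form_eq_1: "\<sigma> \<in> \<Lambda> \<Longrightarrow> x \<in> \<sigma> \<Longrightarrow> facet_form \<sigma> x = 1"
  using facet_form_exists[of \<sigma>] by metis

lemma facet_form_le_1: "\<sigma> \<in> \<Lambda> \<Longrightarrow> x \<in> \<Gamma> \<Longrightarrow> facet_form \<sigma> x \<le> 1"
  using facet_form_exists[of \<sigma>] by (metis mem_Collect_eq subsetD)

text \<open>A ray from the interior point 0 reaches the boundary, which is the union of the facets.
  That the facet forms determine the polytope, and that one of them is positive at any given nonzero
  point, is read off from this.\<close>

lemma ray_meets_facet:
  assumes "x \<noteq> 0"
  obtains d \<sigma> where "0 < d" "\<sigma> \<in> \<Lambda>" "d *\<^sub>R x \<in> \<sigma>" "facet_form \<sigma> x = 1 / d" "\<And>e. 0 \<le> e \<Longrightarrow> e < d \<Longrightarrow> e *\<^sub>R x \<in> \<Gamma>"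
proof -
  obtain d where d: "0 < d" "d *\<^sub>R x \<in> frontier \<Gamma>" "\<And>e. 0 \<le> e \<Longrightarrow> e < d \<Longrightarrow> e *\<^sub>R x \<in> interior \<Gamma>"
    using ray_to_frontier[OF polytope_imp_bounded[OF polytope] zero_interior assms] by auto
  have "rel_frontier \<Gamma> = frontier \<Gamma>"
    using zero_interior by (intro rel_frontier_nonempty_interior) auto
  then have "d *\<^sub>R x \<in> \<Union>\<Lambda>"
    using d(2) rel_frontier_of_polyhedron[OF polytope_imp_polyhedron[OF polytope]] by (simp add: newton_facets_eq)
  then obtain \<sigma> where s: "\<sigma> \<in> \<Lambda>" "d *\<^sub>R x \<in> \<sigma>" by blast
  have "d * facet_form \<sigma> x = 1"
    using facet_form_eq_1[OF s] linear_scale[OF linear_facet_form[OF s(1)]] by simp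
  then have "facet_form \<sigma> x = 1 / d" using d(1) by (simp add: field_simps)
  then show thesis using that[OF d(1) s] d(3) interior_subset by blast
qed

lemma facets_nonempty: "\<Lambda> \<noteq> {}"
proof -
  have "((\<chi> i. 1) :: (real, 'n) vec) \<noteq> 0" by (simp add: vec_eq_iff)
  then show ?thesis by (elim ray_meets_facet) auto
qed

lemma forms_nonpos_imp_0: "(\<And>\<sigma>. \<sigma> \<in> \<Lambda> \<Longrightarrow> facet_form \<sigma> x \<le> 0) \<Longrightarrow> x = 0"
  by (metis ray_meets_facet divide_pos_pos leD zero_less_one)

lemma mem_polytope_iff: "x \<in> \<Gamma> \<longleftrightarrow> (\<forall>\<sigma>\<in>\<Lambda>. facet_form \<sigma> x \<le> 1)"
proof
  assume r: "\<forall>\<sigma>\<in>\<Lambda>. facet_form \<sigma> x \<le> 1"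
  show "x \<in> \<Gamma>"
  proof (cases "x = 0")
    case True
    then show ?thesis using zero_interior interior_subset by blast
  next
    case False
    then obtain d \<sigma> where d: "0 < d" "\<sigma> \<in> \<Lambda>" "d *\<^sub>R x \<in> \<sigma>" "facet_form \<sigma> x = 1 / d" "\<And>e. 0 \<le> e \<Longrightarrow> e < d \<Longrightarrow> e *\<^sub>R x \<in> \<Gamma>"
      using ray_meets_facet by metis
    have "1 \<le> d" using r d by (auto simp: divide_le_eq)
    show ?thesis
    proof (cases "d = 1")
      case True
      moreover have "\<sigma> \<subseteq> \<Gamma>" using d(2) by (simp add: newton_facets_def face_of_imp_subset)
      ultimately show ?thesis using d(3) by auto
    next
      case False
      then show ?thesis using d(5)[of 1] \<open>1 \<le> d\<close> by simp
    qed
  qed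
qed (use facet_form_le_1 in auto)

text \<open>The facet is the hull of exponents of f; the form takes the value 1 at them, and they
  span the space.\<close>

lemma facet_denominator:
  assumes "\<sigma> \<in> \<Lambda>"
  shows "\<exists>D::nat. 0 < D \<and> (\<forall>k. real D * lform \<sigma> k \<in> \<int>)"
proof -
  have "\<sigma> face_of \<Gamma>" using assms by (simp add: newton_facets_def)
  then obtain S' where S': "S' \<subseteq> real_exponent ` (pkeys f - {0})" "\<sigma> = convex hull S'"
    unfolding newton_polytope_def
    using face_of_convex_hull_subset[OF finite_imp_compact, of "real_exponent ` (pkeys f - {0})" \<sigma>] by auto
  then obtain S where S: "S' = real_exponent ` S" by (metis subset_imageE)
  have "span \<sigma> = UNIV"
    using facet_span[OF assms linear_facet_form[OF assms]] facet_form_eq_1[OF assms] by blast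
  moreover have "span \<sigma> \<subseteq> span S'" unfolding S'(2)
    by (metis convex_hull_subset_span span_mono span_span)
  ultimately have "span S' = UNIV" by auto
  moreover have "facet_form \<sigma> (real_exponent k) \<in> \<int>" if "k \<in> S" for k
  proof -
    have "real_exponent k \<in> \<sigma>" using that S S'(2) by (simp add: hull_inc)
    then show ?thesis using facet_form_eq_1[OF assms] by simp
  qed
  ultimately show ?thesis
    using linear_form_denominator[OF linear_facet_form[OF assms], of S] S unfolding lform_def by auto
qed

text \<open>A common denominator of the facet forms on the lattice. From here on an integer T
  encodes the order T/M, so that the boundary of the polytope, of order 1, has level M.\<close>

definition M :: nat where
  "M = (SOME D. 0 < D \<and> (\<forall>\<sigma>\<in>\<Lambda>. \<forall>k. real D * lform \<sigma> k \<in> \<int>))"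

lemma M: "0 < M" "\<And>\<sigma> k. \<sigma> \<in> \<Lambda> \<Longrightarrow> real M * lform \<sigma> k \<in> \<int>"
proof -
  obtain D where D: "\<And>\<sigma>. \<sigma> \<in> \<Lambda> \<Longrightarrow> 0 < (D \<sigma> :: nat) \<and> (\<forall>k. real (D \<sigma>) * lform \<sigma> k \<in> \<int>)"
    using facet_denominator by metis
  have "0 < (\<Prod>\<sigma>\<in>\<Lambda>. D \<sigma>) \<and> (\<forall>\<sigma>\<in>\<Lambda>. \<forall>k. real (\<Prod>\<sigma>\<in>\<Lambda>. D \<sigma>) * lform \<sigma> k \<in> \<int>)"
  proof (intro conjI ballI allI)
    show "0 < (\<Prod>\<sigma>\<in>\<Lambda>. D \<sigma>)" using D by (intro prod_pos) auto
    fix \<sigma> k assume s: "\<sigma> \<in> \<Lambda>"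
    have "real (\<Prod>\<sigma>\<in>\<Lambda>. D \<sigma>) * lform \<sigma> k = real (\<Prod>\<sigma>\<in>\<Lambda> - {\<sigma>}. D \<sigma>) * (real (D \<sigma>) * lform \<sigma> k)"
      unfolding prod.remove[OF finite_facets s] by simp
    also have "\<dots> \<in> \<int>" by (rule Ints_mult[OF Ints_of_nat]) (use D s in blast)
    finally show "real (\<Prod>\<sigma>\<in>\<Lambda>. D \<sigma>) * lform \<sigma> k \<in> \<int>" .
  qed
  then have "0 < M \<and> (\<forall>\<sigma>\<in>\<Lambda>. \<forall>k. real M * lform \<sigma> k \<in> \<int>)" unfolding M_def by (rule someI)
  then show "0 < M" "\<And>\<sigma> k. \<sigma> \<in> \<Lambda> \<Longrightarrow> real M * lform \<sigma> k \<in> \<int>" by auto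
qed

definition wt :: "(real, 'n) vec set \<Rightarrow> (int, 'n) vec \<Rightarrow> int" where
  "wt \<sigma> a = \<lfloor>real M * lform \<sigma> a\<rfloor>"

lemma of_int_wt: "\<sigma> \<in> \<Lambda> \<Longrightarrow> of_int (wt \<sigma> a) = real M * lform \<sigma> a"
  using M(2)[of \<sigma> a] by (auto simp: wt_def elim!: Ints_cases)

lemma wt_add: "\<sigma> \<in> \<Lambda> \<Longrightarrow> wt \<sigma> (a + b) = wt \<sigma> a + wt \<sigma> b"
proof -
  assume s: "\<sigma> \<in> \<Lambda>"
  have "of_int (wt \<sigma> (a + b)) = (of_int (wt \<sigma> a + wt \<sigma> b) :: real)"
    using s by (simp add: of_int_wt lform_def real_exponent_add linear_add[OF linear_facet_form] distrib_left)
  then show ?thesis by (simp only: of_int_eq_iff)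
qed

lemma wt_scale: "\<sigma> \<in> \<Lambda> \<Longrightarrow> wt \<sigma> (\<chi> i. c * a $ i) = c * wt \<sigma> a"
proof -
  assume s: "\<sigma> \<in> \<Lambda>"
  have "real_exponent (\<chi> i. c * a $ i) = of_int c *\<^sub>R real_exponent a"
    by (simp add: real_exponent_def vec_eq_iff)
  then have "of_int (wt \<sigma> (\<chi> i. c * a $ i)) = (of_int (c * wt \<sigma> a) :: real)"
    using s by (simp add: of_int_wt lform_def linear_scale[OF linear_facet_form])
  then show ?thesis by (simp only: of_int_eq_iff)
qed

lemma wt_0: "\<sigma> \<in> \<Lambda> \<Longrightarrow> wt \<sigma> 0 = 0"
  using wt_add[of \<sigma> 0 0] by simp

lemma wt_key_le: assumes "\<sigma> \<in> \<Lambda>" "k \<in> pkeys f" shows "wt \<sigma> k \<le> int M"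
proof (cases "k = 0")
  case True
  then show ?thesis using assms(1) by (simp add: wt_0)
next
  case False
  then have "real_exponent k \<in> \<Gamma>" using assms(2) unfolding newton_polytope_def by (intro hull_inc) auto
  then have "lform \<sigma> k \<le> 1" using assms(1) facet_form_le_1 by (simp add: lform_def)
  then have "real M * lform \<sigma> k \<le> real M" using M(1) by simp
  then have "(of_int (wt \<sigma> k) :: real) \<le> of_int (int M)" using of_int_wt[OF assms(1)] by simp
  then show ?thesis by linarith
qed

lemma wt_nonpos_imp_0: "(\<And>\<sigma>. \<sigma> \<in> \<Lambda> \<Longrightarrow> wt \<sigma> a \<le> 0) \<Longrightarrow> a = 0"
proof -
  assume a: "\<And>\<sigma>. \<sigma> \<in> \<Lambda> \<Longrightarrow> wt \<sigma> a \<le> 0"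
  have "facet_form \<sigma> (real_exponent a) \<le> 0" if "\<sigma> \<in> \<Lambda>" for \<sigma>
  proof -
    have "real M * lform \<sigma> a \<le> 0" using a[OF that] of_int_wt[OF that, of a] by (metis of_int_0_le_iff of_int_le_0_iff)
    then show ?thesis using M(1) by (simp add: lform_def mult_le_0_iff)
  qed
  from forms_nonpos_imp_0[OF this] show "a = 0" by simp
qed

end

section \<open>Exactness for the homogenised Newton filtration\<close>

definition lift_t :: "int \<Rightarrow> ('e \<Rightarrow>\<^sub>0 complex) \<Rightarrow> ('e \<times> int \<Rightarrow>\<^sub>0 complex)" where
  "lift_t T g = (\<Sum>a\<in>pkeys g. psingle (a, T) (plookup g a))"

definition slice_t :: "int \<Rightarrow> ('e \<times> int \<Rightarrow>\<^sub>0 complex) \<Rightarrow> ('e \<Rightarrow>\<^sub>0 complex)" where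
  "slice_t T p = Poly_Mapping.map_key (\<lambda>a. (a, T)) p"

lemma lookup_lift_t: "plookup (lift_t T g) (a, S) = (if S = T then plookup g a else 0)"
  by (simp add: lift_t_def lookup_sum lookup_single when_def in_keys_iff cong: if_cong)

lemma keys_lift_t: "pkeys (lift_t T g) = (\<lambda>a. (a, T)) ` pkeys g"
  by (auto simp: in_keys_iff lookup_lift_t image_iff split: if_splits)

lemma lookup_slice_t: "plookup (slice_t T p) a = plookup p (a, T)"
  by (simp add: slice_t_def map_key.rep_eq inj_def)

lemma slice_lift_t: "slice_t S (lift_t T g) = (if S = T then g else 0)"
  by (rule poly_mapping_eqI) (simp add: lookup_slice_t lookup_lift_t)

lemma slice_t_add: "slice_t T (p + q) = slice_t T p + slice_t T q"
  by (rule poly_mapping_eqI) (simp add: lookup_slice_t lookup_add)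

lemma slice_t_diff: "slice_t T (p - q) = slice_t T p - slice_t T q"
  by (rule poly_mapping_eqI) (simp add: lookup_slice_t lookup_minus)

lemma slice_t_uminus: "slice_t T (- p) = - slice_t T p"
  by (rule poly_mapping_eqI) (simp add: lookup_slice_t)

lemma slice_t_0 [simp]: "slice_t T 0 = 0"
  by (rule poly_mapping_eqI) (simp add: lookup_slice_t)

lemma slice_t_sum: "slice_t T (sum p A) = (\<Sum>x\<in>A. slice_t T (p x))"
  by (induction A rule: infinite_finite_induct) (simp_all add: slice_t_add)

lemma lift_t_add: "lift_t T (g + h) = lift_t T g + lift_t T h"
  by (rule poly_mapping_eqI) (auto simp: lookup_lift_t lookup_add split: prod.splits)

lemma lift_t_diff: "lift_t T (g - h) = lift_t T g - lift_t T h"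
  by (rule poly_mapping_eqI) (auto simp: lookup_lift_t lookup_minus split: prod.splits)

lemma lift_t_0 [simp]: "lift_t T 0 = 0"
  by (simp add: lift_t_def)

lemma lift_t_sum: "lift_t T (sum g A) = (\<Sum>x\<in>A. lift_t T (g x))"
  by (induction A rule: infinite_finite_induct) (simp_all add: lift_t_add)

lemma lift_t_single: "lift_t T (psingle a c) = psingle (a, T) c"
proof (rule poly_mapping_eqI)
  fix x show "plookup (lift_t T (psingle a c)) x = plookup (psingle (a, T) c) x"
    by (cases x) (auto simp add: lookup_lift_t lookup_single when_def)
qed

lemma slice_lift_t_mult:
  fixes g :: "'e::ab_group_add \<Rightarrow>\<^sub>0 complex"
  shows "slice_t T (lift_t S g * p) = g * slice_t (T - S) p"
proof -
  have single: "slice_t T (psingle (a, S) c * p) = psingle a c * slice_t (T - S) p" for a c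
    by (rule poly_mapping_eqI) (simp add: lookup_slice_t lookup_single_mult)
  have "lift_t S g * p = (\<Sum>a\<in>pkeys g. psingle (a, S) (plookup g a) * p)"
    by (simp add: lift_t_def sum_distrib_right)
  then have "slice_t T (lift_t S g * p) = (\<Sum>a\<in>pkeys g. psingle a (plookup g a) * slice_t (T - S) p)"
    by (simp add: slice_t_sum single)
  also have "\<dots> = g * slice_t (T - S) p"
    using poly_mapping_sum_single[of g] by (simp add: sum_distrib_right[symmetric])
  finally show ?thesis .
qed

lemma lift_t_mult:
  fixes g :: "'e::ab_group_add \<Rightarrow>\<^sub>0 complex"
  shows "lift_t S g * lift_t T h = lift_t (S + T) (g * h)"
proof (rule poly_mapping_eqI)
  fix x :: "'e \<times> int"
  obtain a R where x: "x = (a, R)" by (cases x)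
  have "plookup (lift_t S g * lift_t T h) x = plookup (slice_t R (lift_t S g * lift_t T h)) a"
    by (simp add: x lookup_slice_t)
  also have "\<dots> = plookup (lift_t (S + T) (g * h)) x"
    unfolding slice_lift_t_mult slice_lift_t x lookup_lift_t by auto
  finally show "plookup (lift_t S g * lift_t T h) x = plookup (lift_t (S + T) (g * h)) x" .
qed

lemma slice_t_koszul_sign:
  fixes p :: "'b::ab_group_add \<times> int \<Rightarrow>\<^sub>0 complex"
  shows "slice_t T (koszul_sign i J * p) = koszul_sign i J * slice_t T p"
proof -
  have "(koszul_sign i J = (1 :: 'b \<times> int \<Rightarrow>\<^sub>0 complex) \<and> koszul_sign i J = (1 :: 'b \<Rightarrow>\<^sub>0 complex)) \<or>
    (koszul_sign i J = (-1 :: 'b \<times> int \<Rightarrow>\<^sub>0 complex) \<and> koszul_sign i J = (-1 :: 'b \<Rightarrow>\<^sub>0 complex))"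
    unfolding koszul_sign_def minus_one_power_iff by simp
  then show ?thesis by (metis mult_1 mult_minus1 slice_t_uminus)
qed

text \<open>Translation by an element of the subgroup maps the complement of \<open>H\<close> to
  itself, so projecting to \<open>H\<close> is linear over Laurent polynomials supported on
  \<open>H\<close>.\<close>

lemma pm_restrict_mult_subgroup:
  fixes p q :: "'e::ab_group_add \<Rightarrow>\<^sub>0 complex"
  assumes "pkeys p \<subseteq> H" and add: "\<And>a b. a \<in> H \<Longrightarrow> b \<in> H \<Longrightarrow> a + b \<in> H"
    and um: "\<And>a. a \<in> H \<Longrightarrow> - a \<in> H"
  shows "pm_restrict H (p * q) = p * pm_restrict H q"
proof -
  have 1: "pkeys (p * pm_restrict H q) \<subseteq> H"
    by (rule keys_subset_mult[OF assms(1), of _ H]) (auto simp: keys_pm_restrict add)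
  have 2: "pkeys (p * pm_restrict (- H) q) \<subseteq> - H"
  proof (rule keys_subset_mult[OF assms(1), of _ "- H"])
    show "a + b \<in> - H" if "a \<in> H" "b \<in> - H" for a b
    proof
      assume "a + b \<in> H"
      then have "- a + (a + b) \<in> H" using that um add by blast
      then show False using that by simp
    qed
  qed (auto simp: keys_pm_restrict)
  have "p * q = p * pm_restrict H q + p * pm_restrict (- H) q"
    using poly_mapping_split_single[of q H] by (simp add: distrib_left[symmetric])
  also have "pm_restrict H \<dots> = p * pm_restrict H q"
  proof (rule poly_mapping_eqI)
    fix k
    show "plookup (pm_restrict H (p * pm_restrict H q + p * pm_restrict (- H) q)) k = plookup (p * pm_restrict H q) k"
      using 1 2 by (auto simp: lookup_pm_restrict lookup_add in_keys_iff subset_iff)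
  qed
  finally show ?thesis .
qed

abbreviation df_wedge :: "'n::{finite,linorder} laurent \<Rightarrow> 'n form \<Rightarrow> 'n form" where
  "df_wedge f \<equiv> koszul (\<lambda>i. (*) (log_deriv i f))"

section \<open>The cone over the Newton polytope fulfils the hypotheses of the face
  induction\<close>

locale nondegenerate_laurent = convenient_laurent f for f :: "'n::{finite,linorder} laurent" +
  assumes nondegenerate: "nondegenerate f"
begin

text \<open>The pair (a, T) encodes u^a t^T; all \<open>ev \<sigma>\<close> are nonnegative there
  exactly if u^a has Newton order at most T/M.\<close>

definition ev :: "(real, 'n) vec set \<Rightarrow> (int, 'n) vec \<times> int \<Rightarrow> int" where
  "ev \<sigma> y = snd y - wt \<sigma> (fst y)"

definition smul :: "int \<Rightarrow> (int, 'n) vec \<times> int \<Rightarrow> (int, 'n) vec \<times> int" where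
  "smul c y = ((\<chi> i. c * fst y $ i), c * snd y)"

definition tF :: "'n \<Rightarrow> ((int, 'n) vec \<times> int \<Rightarrow>\<^sub>0 complex)" where
  "tF i = lift_t (int M) (log_deriv i f)"

definition cone :: "((int, 'n) vec \<times> int) set" where
  "cone = {b. \<forall>\<sigma>\<in>\<Lambda>. 0 \<le> ev \<sigma> b}"

lemma ev_add: "\<sigma> \<in> \<Lambda> \<Longrightarrow> ev \<sigma> (a + b) = ev \<sigma> a + ev \<sigma> b"
  by (simp add: ev_def wt_add)

lemma ev_smul: "\<sigma> \<in> \<Lambda> \<Longrightarrow> ev \<sigma> (smul c a) = c * ev \<sigma> a"
  by (simp add: ev_def smul_def wt_scale right_diff_distrib)

lemma ev_0: "\<sigma> \<in> \<Lambda> \<Longrightarrow> ev \<sigma> 0 = 0"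
  by (simp add: ev_def wt_0)

lemma ev_uminus: "\<sigma> \<in> \<Lambda> \<Longrightarrow> ev \<sigma> (- a) = - ev \<sigma> a"
  using ev_add[of \<sigma> a "- a"] ev_0 by simp

lemma cone_height_pos:
  assumes "y \<in> cone" "y \<noteq> 0" shows "0 < snd y"
proof (rule ccontr)
  assume n: "\<not> 0 < snd y"
  then have "wt \<sigma> (fst y) \<le> 0" if "\<sigma> \<in> \<Lambda>" for \<sigma>
    using assms(1) that by (fastforce simp: cone_def ev_def)
  then have "fst y = 0" by (rule wt_nonpos_imp_0)
  moreover obtain \<sigma> where "\<sigma> \<in> \<Lambda>" using facets_nonempty by blast
  ultimately have "0 \<le> snd y" using assms(1) by (fastforce simp: cone_def ev_def wt_0)
  then show False using n \<open>fst y = 0\<close> assms(2) by (simp add: prod_eq_iff)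
qed

lemma pointed: assumes "\<forall>\<sigma>\<in>\<Lambda>. ev \<sigma> y = 0" shows "y = 0"
proof (rule ccontr)
  assume y: "y \<noteq> 0"
  have "y \<in> cone" "- y \<in> cone" using assms by (auto simp: cone_def ev_uminus)
  then show False using cone_height_pos[of y] cone_height_pos[of "- y"] y by simp
qed

lemma keys_log_deriv: "pkeys (log_deriv i g) \<subseteq> pkeys g - {0}"
  by (auto simp: in_keys_iff lookup_log_deriv)

lemma keys_tF: "pkeys (tF i) \<subseteq> cone"
  using keys_log_deriv[of i f] wt_key_le by (fastforce simp: tF_def keys_lift_t cone_def ev_def)

text \<open>The exponent of \<open>y\<close>, scaled to height M, is a point of the face
  \<open>D\<close> cut out by \<open>J\<close>, so \<open>D\<close> is nonempty; it is proper
  because it misses 0. Nondegeneracy applies to \<open>D\<close>, and the Nullstellensatz turns the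
  absence of common zeros into a relation with value 1.\<close>

lemma face_unit_ideal:
  assumes J: "J \<subseteq> \<Lambda>" "J \<noteq> {}" and y: "y \<noteq> 0" "\<forall>\<sigma>\<in>J. ev \<sigma> y = 0" "\<forall>\<sigma>\<in>\<Lambda> - J. 0 < ev \<sigma> y"
  obtains g where "(\<Sum>i\<in>UNIV. log_deriv i (pm_restrict {k. \<forall>\<sigma>\<in>J. wt \<sigma> k = int M} f) * g i) = 1"
proof -
  have yc: "y \<in> cone" unfolding cone_def
  proof (intro CollectI ballI)
    fix \<sigma> assume "\<sigma> \<in> \<Lambda>" then show "0 \<le> ev \<sigma> y" using y by (cases "\<sigma> \<in> J") (auto intro: less_imp_le)
  qed
  have T: "0 < snd y" by (rule cone_height_pos[OF yc y(1)])
  define D where "D = {x \<in> \<Gamma>. \<forall>\<sigma>\<in>J. facet_form \<sigma> x = 1}"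
  define x where "x = (real M / of_int (snd y)) *\<^sub>R real_exponent (fst y)"
  have fx: "facet_form \<sigma> x = of_int (wt \<sigma> (fst y)) / of_int (snd y)" if "\<sigma> \<in> \<Lambda>" for \<sigma>
    using that T by (simp add: x_def linear_scale[OF linear_facet_form] of_int_wt lform_def)
  have "x \<in> \<Gamma>" unfolding mem_polytope_iff
  proof
    fix \<sigma> assume s: "\<sigma> \<in> \<Lambda>"
    have "wt \<sigma> (fst y) \<le> snd y" using yc s by (auto simp: cone_def ev_def)
    then show "facet_form \<sigma> x \<le> 1" using T fx[OF s] by (simp add: divide_le_eq)
  qed
  moreover have "facet_form \<sigma> x = 1" if "\<sigma> \<in> J" for \<sigma>
  proof -
    have "wt \<sigma> (fst y) = snd y" using y(2) that by (auto simp: ev_def)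
    then show ?thesis using fx[of \<sigma>] that J(1) T by auto
  qed
  ultimately have "D \<noteq> {}" by (auto simp: D_def)
  have "D = \<Inter>((\<lambda>\<sigma>. {x \<in> \<Gamma>. facet_form \<sigma> x = 1}) ` J)" using J(2) by (auto simp: D_def)
  also have "\<dots> face_of \<Gamma>"
  proof (rule face_of_Inter)
    fix T assume "T \<in> (\<lambda>\<sigma>. {x \<in> \<Gamma>. facet_form \<sigma> x = 1}) ` J"
    then obtain \<sigma> where s: "\<sigma> \<in> \<Lambda>" "T = {x \<in> \<Gamma>. facet_form \<sigma> x = 1}" using J(1) by auto
    obtain c where c: "facet_form \<sigma> = (\<lambda>x. c \<bullet> x)" "\<Gamma> \<subseteq> {x. c \<bullet> x \<le> 1}"
      using facet_form_exists[OF s(1)] by metis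
    have "(\<Gamma> \<inter> {x. c \<bullet> x = 1}) face_of \<Gamma>"
      by (rule face_of_Int_supporting_hyperplane_le) (use c(2) polytope_imp_convex[OF polytope] in auto)
    moreover have "T = \<Gamma> \<inter> {x. c \<bullet> x = 1}" using s(2) c(1) by auto
    ultimately show "T face_of \<Gamma>" by simp
  qed (use J(2) in auto)
  finally have face: "D face_of \<Gamma>" .
  have z: "0 \<in> \<Gamma>" using zero_interior interior_subset by blast
  have "0 \<notin> D"
  proof
    assume "0 \<in> D"
    moreover obtain \<sigma> where "\<sigma> \<in> J" "\<sigma> \<in> \<Lambda>" using J by blast
    ultimately show False using linear_0[OF linear_facet_form] by (force simp: D_def)
  qed
  then have "D \<noteq> \<Gamma>" using z by auto
  then have nz: "\<And>u. (\<forall>i. u $ i \<noteq> 0) \<Longrightarrow> \<exists>i. eval_laurent (log_deriv i (face_part f D)) u \<noteq> 0"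
    using nondegenerate face \<open>D \<noteq> {}\<close> unfolding nondegenerate_def by blast
  have "face_part f D = pm_restrict {k. \<forall>\<sigma>\<in>J. wt \<sigma> k = int M} f"
  proof (rule poly_mapping_eqI)
    fix k
    have "real_exponent k \<in> D \<longleftrightarrow> (\<forall>\<sigma>\<in>J. wt \<sigma> k = int M)" if "plookup f k \<noteq> 0"
    proof -
      have eq: "facet_form \<sigma> (real_exponent k) = 1 \<longleftrightarrow> wt \<sigma> k = int M" if "\<sigma> \<in> J" for \<sigma>
      proof -
        have s: "\<sigma> \<in> \<Lambda>" using that J by auto
        have "facet_form \<sigma> (real_exponent k) = 1 \<longleftrightarrow> real M * lform \<sigma> k = real M" using M(1) by (simp add: lform_def)
        also have "\<dots> \<longleftrightarrow> (of_int (wt \<sigma> k) :: real) = of_int (int M)" using of_int_wt[OF s] by simp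
        finally show ?thesis by (simp only: of_int_eq_iff)
      qed
      have "real_exponent k \<in> \<Gamma>"
      proof (cases "k = 0")
        case False
        then show ?thesis unfolding newton_polytope_def using that by (intro hull_inc) (auto simp: in_keys_iff)
      qed (use z in simp)
      then show ?thesis using eq by (auto simp: D_def)
    qed
    then show "plookup (face_part f D) k = plookup (pm_restrict {k. \<forall>\<sigma>\<in>J. wt \<sigma> k = int M} f) k"
      by (auto simp: face_part_eq_restrict lookup_pm_restrict)
  qed
  then show thesis using laurent_nullstellensatz[of "\<lambda>i. log_deriv i (face_part f D)", OF nz] that by auto
qed

text \<open>A relation with constant term \<open>1\<close> on the face is moved into the cone by multiplying with an interior
  monomial; replacing the face part of \<open>f\<close> by \<open>f\<close> produces only terms off the face.\<close>

lemma face_nilpotent: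
  assumes J: "J \<subseteq> \<Lambda>" "J \<noteq> {}" and y: "y \<noteq> 0" "\<forall>\<sigma>\<in>J. ev \<sigma> y = 0" "\<forall>\<sigma>\<in>\<Lambda> - J. 0 < ev \<sigma> y"
  shows "\<exists>w h r. (\<forall>\<sigma>\<in>J. ev \<sigma> w = 0) \<and> (\<forall>\<sigma>\<in>\<Lambda> - J. 0 < ev \<sigma> w) \<and> psingle w 1 = (\<Sum>i\<in>UNIV. tF i * h i) + r \<and>
        (\<forall>i. pkeys (h i) \<subseteq> cone) \<and> (\<forall>b\<in>pkeys r. \<exists>\<sigma>\<in>J. 0 < ev \<sigma> b) \<and> pkeys r \<subseteq> cone"
proof -
  define fJ where "fJ = pm_restrict {k. \<forall>\<sigma>\<in>J. wt \<sigma> k = int M} f"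
  obtain g where g: "(\<Sum>i\<in>UNIV. log_deriv i fJ * g i) = 1"
    using face_unit_ideal[OF J y] unfolding fJ_def by blast
  define H where "H = {y. \<forall>\<sigma>\<in>J. ev \<sigma> y = 0}"
  have H: "a + b \<in> H" "- a \<in> H" if "a \<in> H" "b \<in> H" for a b
    using that J(1) by (auto simp: H_def ev_add ev_uminus subset_iff)
  define G where "G = (\<lambda>i. lift_t (int M) (log_deriv i fJ))"
  have keysG: "pkeys (G i) \<subseteq> H" for i
  proof -
    have "pkeys (log_deriv i fJ) \<subseteq> {k. \<forall>\<sigma>\<in>J. wt \<sigma> k = int M}"
      using keys_log_deriv[of i fJ] by (auto simp: fJ_def keys_pm_restrict)
    then show ?thesis by (auto simp: G_def keys_lift_t H_def ev_def)
  qed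
  \<comment> \<open>The cofactors are lifted at height -M, opposite to the \<open>G i\<close>, so
    the relation lives at height 0. The \<open>G i\<close> are supported on the subgroup
    \<open>H\<close>, hence the relation survives projecting the cofactors to
    \<open>H\<close>.\<close>
  define g' where "g' = (\<lambda>i. pm_restrict H (lift_t (- int M) (g i)))"
  have one: "(\<Sum>i\<in>UNIV. G i * g' i) = 1"
  proof -
    have "(\<Sum>i\<in>UNIV. G i * g' i) = (\<Sum>i\<in>UNIV. pm_restrict H (G i * lift_t (- int M) (g i)))"
      unfolding g'_def by (intro sum.cong refl pm_restrict_mult_subgroup[symmetric] keysG H)
    also have "\<dots> = pm_restrict H (\<Sum>i\<in>UNIV. G i * lift_t (- int M) (g i))" by (rule pm_restrict_sum[symmetric])
    also have "(\<Sum>i\<in>UNIV. G i * lift_t (- int M) (g i)) = lift_t 0 (\<Sum>i\<in>UNIV. log_deriv i fJ * g i)"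
      by (simp add: G_def lift_t_mult lift_t_sum)
    also have "\<dots> = 1" unfolding g using lift_t_single[of 0 0 1] by (simp add: zero_prod_def[symmetric])
    also have "pm_restrict H 1 = (1 :: (int, 'n) vec \<times> int \<Rightarrow>\<^sub>0 complex)"
      using J(1) by (intro poly_mapping_eqI) (auto simp: lookup_pm_restrict lookup_one when_def H_def ev_0 subset_iff)
    finally show ?thesis .
  qed
  \<comment> \<open>\<open>N\<close> exceeds |\<open>ev \<sigma> c\<close>| for all exponents c of
    the \<open>g' i\<close>, so adding the N-fold of \<open>y\<close> carries them into the cone;
    the forms of \<open>J\<close> vanish at them by the projection to \<open>H\<close>.\<close>
  define N where "N = 1 + (\<Sum>\<sigma>\<in>\<Lambda>. \<Sum>c\<in>(\<Union>i. pkeys (g' i)). \<bar>ev \<sigma> c\<bar>)"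
  have N: "- N < ev \<sigma> c" if "\<sigma> \<in> \<Lambda>" "c \<in> pkeys (g' i)" for \<sigma> c i
  proof -
    have "\<bar>ev \<sigma> c\<bar> \<le> (\<Sum>c\<in>(\<Union>i. pkeys (g' i)). \<bar>ev \<sigma> c\<bar>)"
      using that by (intro member_le_sum) auto
    also have "\<dots> \<le> (\<Sum>\<sigma>\<in>\<Lambda>. \<Sum>c\<in>(\<Union>i. pkeys (g' i)). \<bar>ev \<sigma> c\<bar>)"
      using that finite_facets by (intro member_le_sum[of \<sigma> \<Lambda> "\<lambda>\<sigma>. \<Sum>c\<in>(\<Union>i. pkeys (g' i)). \<bar>ev \<sigma> c\<bar>"]) (auto intro: sum_nonneg)
    finally show ?thesis by (simp add: N_def)
  qed
  have N0: "0 < N" by (simp add: N_def add_pos_nonneg sum_nonneg)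
  define w where "w = smul N y"
  define h where "h = (\<lambda>i. psingle w 1 * g' i)"
  define r where "r = (\<Sum>i\<in>UNIV. (G i - tF i) * h i)"
  have wJ: "\<forall>\<sigma>\<in>J. ev \<sigma> w = 0" and w: "\<forall>\<sigma>\<in>\<Lambda> - J. N \<le> ev \<sigma> w"
  proof -
    show "\<forall>\<sigma>\<in>J. ev \<sigma> w = 0" using y J(1) by (auto simp: w_def ev_smul subset_iff)
    show "\<forall>\<sigma>\<in>\<Lambda> - J. N \<le> ev \<sigma> w"
    proof
      fix \<sigma> assume s: "\<sigma> \<in> \<Lambda> - J"
      then have "1 \<le> ev \<sigma> y" using y(3) by force
      then show "N \<le> ev \<sigma> w" using mult_left_mono[of 1 "ev \<sigma> y" N] N0 s by (simp add: w_def ev_smul)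
    qed
  qed
  have "psingle w 1 = (\<Sum>i\<in>UNIV. G i * h i)"
    using arg_cong[OF one, of "\<lambda>x. psingle w 1 * x"] by (simp add: h_def sum_distrib_left mult_ac)
  then have eq: "psingle w 1 = (\<Sum>i\<in>UNIV. tF i * h i) + r"
    by (simp add: r_def sum.distrib[symmetric] left_diff_distrib)
  have keysh: "pkeys (h i) \<subseteq> cone" for i
  proof
    fix b assume "b \<in> pkeys (h i)"
    then obtain c where c: "c \<in> pkeys (g' i)" "b = w + c" by (auto simp: h_def keys_single_mult)
    have "c \<in> H" using c(1) by (auto simp: g'_def keys_pm_restrict)
    show "b \<in> cone" unfolding cone_def
    proof (intro CollectI ballI)
      fix \<sigma> assume s: "\<sigma> \<in> \<Lambda>"
      show "0 \<le> ev \<sigma> b"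
      proof (cases "\<sigma> \<in> J")
        case True
        then show ?thesis using s c(2) wJ \<open>c \<in> H\<close> by (simp add: ev_add H_def)
      next
        case False
        then have "N \<le> ev \<sigma> w" using w s by auto
        then show ?thesis using N[OF s c(1)] s c(2) by (simp add: ev_add)
      qed
    qed
  qed
  \<comment> \<open>Exponents at which f and its face part differ satisfy some inequality of
    \<open>J\<close> strictly, and this persists when points of the cone are added.\<close>
  define Y where "Y = {b \<in> cone. \<exists>\<sigma>\<in>J. 0 < ev \<sigma> b}"
  have "pkeys (G i - tF i) \<subseteq> Y" for i
  proof -
    have "G i - tF i = lift_t (int M) (log_deriv i fJ - log_deriv i f)"
      by (simp add: G_def tF_def lift_t_diff)
    moreover have "(k, int M) \<in> Y" if "k \<in> pkeys (log_deriv i fJ - log_deriv i f)" for k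
    proof -
      have "plookup fJ k \<noteq> plookup f k"
        using that by (auto simp: in_keys_iff lookup_minus lookup_log_deriv)
      then have k: "k \<in> pkeys f" "\<not> (\<forall>\<sigma>\<in>J. wt \<sigma> k = int M)"
        by (auto simp: fJ_def lookup_pm_restrict in_keys_iff split: if_splits)
      have le: "wt \<sigma> k \<le> int M" if "\<sigma> \<in> \<Lambda>" for \<sigma> using wt_key_le[OF that k(1)] .
      then show ?thesis using k(2) J(1) by (force simp: Y_def cone_def ev_def subset_iff)
    qed
    ultimately show ?thesis by (auto simp: keys_lift_t)
  qed
  then have "pkeys (r) \<subseteq> Y" unfolding r_def
  proof (intro keys_subset_sum)
    fix i
    assume *: "\<And>i. pkeys (G i - tF i) \<subseteq> Y"
    show "pkeys ((G i - tF i) * h i) \<subseteq> Y"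
    proof (rule keys_subset_mult[OF * keysh])
      fix a b assume a: "a \<in> Y" and b: "b \<in> cone"
      have *: "ev \<sigma> (a + b) = ev \<sigma> a + ev \<sigma> b" "0 \<le> ev \<sigma> a" "0 \<le> ev \<sigma> b" if "\<sigma> \<in> \<Lambda>" for \<sigma>
        using a b that by (auto simp: Y_def cone_def ev_add)
      obtain \<sigma> where s: "\<sigma> \<in> J" "0 < ev \<sigma> a" using a by (auto simp: Y_def)
      then have "0 < ev \<sigma> (a + b)" using *[of \<sigma>] J(1) by auto
      moreover have "a + b \<in> cone" using * by (simp add: cone_def)
      ultimately show "a + b \<in> Y" using s(1) by (auto simp: Y_def)
    qed
  qed
  then have "\<forall>b\<in>pkeys r. \<exists>\<sigma>\<in>J. 0 < ev \<sigma> b" "pkeys r \<subseteq> cone" by (auto simp: Y_def)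
  moreover have "\<forall>\<sigma>\<in>\<Lambda> - J. 0 < ev \<sigma> w" using w N0 by (meson order_less_le_trans)
  ultimately show ?thesis using wJ eq keysh by blast
qed

sublocale cone_koszul \<Lambda> ev smul tF cone
proof
  show "\<exists>w h r. (\<forall>\<sigma>\<in>J. ev \<sigma> w = 0) \<and> (\<forall>\<sigma>\<in>\<Lambda> - J. 0 < ev \<sigma> w) \<and> psingle w 1 = (\<Sum>i\<in>UNIV. tF i * h i) + r \<and>
        (\<forall>i. pkeys (h i) \<subseteq> cone) \<and> (\<forall>b\<in>pkeys r. \<exists>\<sigma>\<in>J. 0 < ev \<sigma> b) \<and> pkeys r \<subseteq> cone"
    if "J \<subseteq> \<Lambda>" "J \<noteq> {}" "y \<noteq> 0" "\<forall>\<sigma>\<in>J. ev \<sigma> y = 0" "\<forall>\<sigma>\<in>\<Lambda> - J. 0 < ev \<sigma> y" for J y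
    using that by (rule face_nilpotent)
qed (simp_all only: finite_facets ev_add ev_smul pointed keys_tF cone_def[symmetric])

lemma wt_sum_axis:
  assumes "\<sigma> \<in> \<Lambda>" shows "wt \<sigma> (\<chi> t. z t) = (\<Sum>t\<in>UNIV. z t * wt \<sigma> (axis t 1))"
proof -
  have sum: "wt \<sigma> (\<Sum>t\<in>A. b t) = (\<Sum>t\<in>A. wt \<sigma> (b t))" for A :: "'n set" and b
    by (induction A rule: infinite_finite_induct) (simp_all add: wt_0[OF assms] wt_add[OF assms])
  have "(\<chi> t. z t) = (\<Sum>t\<in>UNIV. (\<chi> i. z t * axis t 1 $ i))"
    by (simp add: vec_eq_iff axis_def if_distrib cong: if_cong)
  then show ?thesis by (simp add: sum wt_scale[OF assms])
qed

text \<open>The lattice has rank n + 1. All \<open>ev \<sigma>\<close> with \<sigma> in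
  \<open>G\<close> vanish at (a, T) exactly if the weights of a for these facets all equal T; for
  nonempty \<open>G\<close> this leaves card G - 1 < n equations for a, which are solved over \<rat>
  and cleared of denominators.\<close>

lemma corank: "corank_ge {} (Suc CARD('n))"
  unfolding corank_ge_def
proof (intro allI impI)
  fix G assume G: "G \<subseteq> \<Lambda>" "card G < Suc CARD('n)"
  show "\<exists>y. y \<noteq> 0 \<and> (\<forall>\<sigma>\<in>{} \<union> G. ev \<sigma> y = 0)"
  proof (cases "G = {}")
    case True
    then show ?thesis by (intro exI[of _ "(0, 1)"]) (simp add: zero_prod_def)
  next
    case False
    then obtain s1 where s1: "s1 \<in> G" by blast
    have fin: "finite G" using G finite_facets finite_subset by blast
    then have "Suc (card (G - {s1})) = card G" using s1 by (intro card.remove[symmetric])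
    then have "card (G - {s1}) < card (UNIV :: 'n set)" using G by simp
    then obtain x where x: "\<exists>t. x t \<noteq> 0"
      "\<And>\<sigma>. \<sigma> \<in> G - {s1} \<Longrightarrow> (\<Sum>t\<in>UNIV. x t * (of_int (wt \<sigma> (axis t 1) - wt s1 (axis t 1)) :: rat)) = 0"
      using homogeneous_system[of "G - {s1}" "UNIV :: 'n set" "\<lambda>\<sigma> t. of_int (wt \<sigma> (axis t 1) - wt s1 (axis t 1)) :: rat"] fin by auto
    define D where "D = (\<Prod>t\<in>UNIV. snd (quotient_of (x t)))"
    have Dpos: "0 < D" unfolding D_def by (intro prod_pos) (simp add: quotient_of_denom_pos')
    have "\<exists>z. of_int D * x t = of_int z" for t
    proof -
      have "x t = of_int (fst (quotient_of (x t))) / of_int (snd (quotient_of (x t)))"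
        by (rule quotient_of_div) simp
      moreover have "D = snd (quotient_of (x t)) * (\<Prod>t\<in>UNIV - {t}. snd (quotient_of (x t)))"
        unfolding D_def by (rule prod.remove) auto
      moreover have "snd (quotient_of (x t)) \<noteq> 0" using quotient_of_denom_pos'[of "x t"] by simp
      ultimately have "of_int D * x t = of_int (fst (quotient_of (x t)) * (\<Prod>t\<in>UNIV - {t}. snd (quotient_of (x t))))"
        by (simp add: field_simps)
      then show ?thesis by blast
    qed
    then obtain z where z: "\<And>t. of_int D * x t = of_int (z t)" by metis
    define a where "a = (\<chi> t. z t)"
    have "wt \<sigma> a = wt s1 a" if s: "\<sigma> \<in> G" for \<sigma>
    proof (cases "\<sigma> = s1")
      case False
      have "(of_int (wt \<sigma> a - wt s1 a) :: rat) = (\<Sum>t\<in>UNIV. of_int (z t) * of_int (wt \<sigma> (axis t 1) - wt s1 (axis t 1)))"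
        using s s1 G(1) by (simp add: a_def wt_sum_axis subset_iff sum_subtractf[symmetric] right_diff_distrib)
      also have "\<dots> = of_int D * (\<Sum>t\<in>UNIV. x t * of_int (wt \<sigma> (axis t 1) - wt s1 (axis t 1)))"
        by (simp add: z[symmetric] sum_distrib_left mult.assoc)
      also have "\<dots> = 0" using x(2)[of \<sigma>] s False by simp
      finally show ?thesis by simp
    qed simp
    moreover have "a \<noteq> 0"
    proof -
      obtain t where "x t \<noteq> 0" using x(1) by blast
      then have "z t \<noteq> 0" using z[of t] Dpos by auto
      then show ?thesis by (auto simp: a_def vec_eq_iff)
    qed
    ultimately show ?thesis by (intro exI[of _ "(a, wt s1 a)"]) (auto simp: ev_def zero_prod_def)
  qed
qed

lemma cone_exact: "koszul_exact tF CARD('n) cone ((+) (0, 1) ` cone)"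
  and cone_cofinite: "koszul_cofinite tF cone ((+) (0, 1) ` cone)"
  using cone_quotient[of "(0, 1)"] facets_nonempty corank by (auto simp: ev_def wt_0)

section \<open>Exactness and finiteness read off in the Newton filtration\<close>

definition newton_le :: "int \<Rightarrow> 'n laurent set" where
  "newton_le T = {g. \<forall>a\<in>pkeys g. \<forall>\<sigma>\<in>\<Lambda>. wt \<sigma> a \<le> T}"

lemma keys_lift_t_cone: "g \<in> newton_le T \<longleftrightarrow> pkeys (lift_t T g) \<subseteq> cone"
  by (auto simp: newton_le_def keys_lift_t cone_def ev_def)

lemma slice_t_cone: "pkeys p \<subseteq> cone \<Longrightarrow> slice_t T p \<in> newton_le T"
  by (auto simp: newton_le_def in_keys_iff lookup_slice_t cone_def ev_def subset_iff)

lemma shift_cone_iff: "y \<in> (+) (0, 1) ` cone \<longleftrightarrow> (\<forall>\<sigma>\<in>\<Lambda>. 1 \<le> ev \<sigma> y)"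
proof -
  have "y \<in> (+) (0, 1) ` cone \<longleftrightarrow> y - (0, 1) \<in> cone"
    by (metis (no_types, lifting) add_diff_cancel_left' diff_add_cancel add.commute image_iff)
  also have "\<dots> \<longleftrightarrow> (\<forall>\<sigma>\<in>\<Lambda>. 1 \<le> ev \<sigma> y)" by (auto simp: cone_def ev_def)
  finally show ?thesis .
qed

lemma slice_t_shift_cone: "pkeys p \<subseteq> (+) (0, 1) ` cone \<Longrightarrow> slice_t T p \<in> newton_le (T - 1)"
  unfolding newton_le_def subset_iff shift_cone_iff
  by (force simp: in_keys_iff lookup_slice_t ev_def)

lemma keys_lift_t_shift_cone: "g \<in> newton_le (T - 1) \<Longrightarrow> pkeys (lift_t T g) \<subseteq> (+) (0, 1) ` cone"
  unfolding subset_iff shift_cone_iff by (force simp: newton_le_def keys_lift_t ev_def)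

text \<open>The degree T part of \<open>cone_exact\<close>: modulo t, homogeneous elements of degree
  T are Laurent polynomials of order at most T/M modulo those of order at most (T - 1)/M, and the
  \<open>tF i\<close> raise the degree by M.\<close>

lemma newton_graded_exact:
  assumes \<omega>: "\<And>I. \<omega> $ I \<in> newton_le T" "\<And>I. CARD('n) \<le> card I \<Longrightarrow> \<omega> $ I = 0"
    and d\<omega>: "\<And>I. df_wedge f \<omega> $ I \<in> newton_le (T + int M - 1)"
  obtains \<zeta> where "\<And>I. \<zeta> $ I \<in> newton_le (T - int M)" "\<And>I. CARD('n) \<le> Suc (card I) \<Longrightarrow> \<zeta> $ I = 0"
    "\<And>I. (\<omega> - df_wedge f \<zeta>) $ I \<in> newton_le (T - 1)"
proof -
  define w where "w = (\<chi> I. lift_t T (\<omega> $ I))"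
  have sl: "koszul_sign i I * lift_t S p = lift_t S (koszul_sign i I * p)" for i I S and p :: "'n laurent"
    by (rule poly_mapping_eqI)
      (use slice_t_koszul_sign[of _ i I "lift_t S p"] in \<open>metis (no_types, lifting) lookup_slice_t mult_zero_right slice_lift_t surj_pair\<close>)
  have dw: "koszul (\<lambda>i. (*) (tF i)) w $ I = lift_t (T + int M) (df_wedge f \<omega> $ I)" for I
    by (simp add: koszul_def w_def tF_def lift_t_mult sl lift_t_sum add.commute)
  have "\<forall>I. pkeys (w $ I) \<subseteq> cone" using \<omega>(1) by (simp add: w_def keys_lift_t_cone[symmetric])
  moreover have "\<forall>I. CARD('n) \<le> card I \<longrightarrow> w $ I = 0" using \<omega>(2) by (simp add: w_def)
  moreover have "\<forall>I. pkeys (koszul (\<lambda>i. (*) (tF i)) w $ I) \<subseteq> (+) (0, 1) ` cone"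
    unfolding dw using d\<omega> by (intro allI keys_lift_t_shift_cone)
  ultimately obtain \<eta> where \<eta>: "\<forall>I. pkeys (\<eta> $ I) \<subseteq> cone" "\<forall>I. CARD('n) \<le> Suc (card I) \<longrightarrow> \<eta> $ I = 0"
    "\<forall>I. pkeys ((w - koszul (\<lambda>i. (*) (tF i)) \<eta>) $ I) \<subseteq> (+) (0, 1) ` cone"
    using cone_exact unfolding koszul_exact_def by blast
  define \<zeta> where "\<zeta> = (\<chi> I. slice_t (T - int M) (\<eta> $ I))"
  have "slice_t T ((w - koszul (\<lambda>i. (*) (tF i)) \<eta>) $ I) = (\<omega> - df_wedge f \<zeta>) $ I" for I
    by (simp add: slice_t_diff w_def slice_lift_t koszul_def slice_t_sum slice_t_koszul_sign tF_def slice_lift_t_mult \<zeta>_def)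
  then have "(\<omega> - df_wedge f \<zeta>) $ I \<in> newton_le (T - 1)" for I
    using slice_t_shift_cone[of _ T] \<eta>(3) by metis
  moreover have "\<zeta> $ I \<in> newton_le (T - int M)" for I using slice_t_cone \<eta>(1) by (simp add: \<zeta>_def)
  moreover have "\<zeta> $ I = 0" if "CARD('n) \<le> Suc (card I)" for I using \<eta>(2) that by (simp add: \<zeta>_def)
  ultimately show thesis using that by blast
qed

text \<open>\<open>T0\<close> bounds the heights in the finite exponent set, and beyond it the
  graded cokernel vanishes.\<close>

lemma newton_graded_cofinite:
  obtains T0 where "\<And>T g. T0 < T \<Longrightarrow> g \<in> newton_le T \<Longrightarrow>
    \<exists>h. (\<forall>i. h i \<in> newton_le (T - int M)) \<and> g - (\<Sum>i\<in>UNIV. log_deriv i f * h i) \<in> newton_le (T - 1)"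
proof -
  obtain E where E: "finite E" "\<And>g. pkeys g \<subseteq> cone \<Longrightarrow> \<exists>h e s. g = (\<Sum>i\<in>UNIV. tF i * h i) + e + s \<and>
         (\<forall>i. pkeys (h i) \<subseteq> cone) \<and> pkeys e \<subseteq> E \<and> pkeys s \<subseteq> (+) (0, 1) ` cone"
    using cone_cofinite unfolding koszul_cofinite_def by blast
  define T0 where "T0 = Max (insert 0 (snd ` E))"
  show thesis
  proof (rule that[of T0])
    fix T g assume T: "T0 < T" and g: "g \<in> newton_le T"
    obtain h e s where h: "lift_t T g = (\<Sum>i\<in>UNIV. tF i * h i) + e + s" "\<forall>i. pkeys (h i) \<subseteq> cone" "pkeys e \<subseteq> E"
      "pkeys s \<subseteq> (+) (0, 1) ` cone"
      using E(2)[of "lift_t T g"] g keys_lift_t_cone by blast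
    have "slice_t T e = 0"
    proof (rule poly_mapping_eqI)
      fix a
      have "(a, T) \<notin> E"
      proof
        assume "(a, T) \<in> E"
        then have "T \<le> T0" unfolding T0_def using E(1) by (intro Max_ge) force+
        then show False using T by simp
      qed
      then show "plookup (slice_t T e) a = plookup 0 a" using h(3) by (auto simp: lookup_slice_t in_keys_iff subset_iff)
    qed
    then have "g = (\<Sum>i\<in>UNIV. log_deriv i f * slice_t (T - int M) (h i)) + slice_t T s"
      using arg_cong[OF h(1), of "slice_t T"]
      by (simp add: slice_lift_t slice_t_add slice_t_sum tF_def slice_lift_t_mult)
    then have "g - (\<Sum>i\<in>UNIV. log_deriv i f * slice_t (T - int M) (h i)) = slice_t T s"
      unfolding diff_eq_eq by (subst add.commute)
    then show "\<exists>h. (\<forall>i. h i \<in> newton_le (T - int M)) \<and> g - (\<Sum>i\<in>UNIV. log_deriv i f * h i) \<in> newton_le (T - 1)"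
      using h(2) slice_t_cone slice_t_shift_cone[OF h(4), of T]
      by (intro exI[of _ "\<lambda>i. slice_t (T - int M) (h i)"] conjI allI) simp_all
  qed
qed

end

section \<open>The Gauss-Manin system and the Weyl algebra\<close>

lemma additive_log_deriv: "Modules.additive (log_deriv i)"
  by unfold_locales (rule poly_mapping_eqI, simp add: lookup_log_deriv lookup_add distrib_left)

lemma log_deriv_0 [simp]: "log_deriv i 0 = 0"
  by (rule poly_mapping_eqI) (simp add: lookup_log_deriv)

lemma log_deriv_commute: "log_deriv i (log_deriv j g) = log_deriv j (log_deriv i g)"
  by (rule poly_mapping_eqI) (simp add: lookup_log_deriv)

lemma log_deriv_mult: "log_deriv i (g * h) = log_deriv i g * h + g * log_deriv i h"
proof -
  note add = Modules.additive.add[OF additive_log_deriv] and sum = Modules.additive.sum[OF additive_log_deriv]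
  have 1: "log_deriv i (psingle a c * h) = log_deriv i (psingle a c) * h + psingle a c * log_deriv i h" for a c
  proof (rule poly_mapping_eqI)
    fix k
    have s: "log_deriv i (psingle a c) = psingle a (of_int (a $ i) * c)"
      by (rule poly_mapping_eqI) (auto simp: lookup_log_deriv lookup_single when_def)
    show "plookup (log_deriv i (psingle a c * h)) k = plookup (log_deriv i (psingle a c) * h + psingle a c * log_deriv i h) k"
      unfolding s by (simp add: lookup_log_deriv lookup_add lookup_single_mult) (simp add: algebra_simps)
  qed
  have "log_deriv i ((\<Sum>a\<in>pkeys g. psingle a (plookup g a)) * h)
    = log_deriv i (\<Sum>a\<in>pkeys g. psingle a (plookup g a)) * h + (\<Sum>a\<in>pkeys g. psingle a (plookup g a)) * log_deriv i h"
    by (simp add: sum_distrib_right sum 1 sum.distrib)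
  then show ?thesis using poly_mapping_sum_single[of g] by simp
qed

lemma log_deriv_scal: "log_deriv i (psingle 0 c * g) = psingle 0 c * log_deriv i g"
  by (rule poly_mapping_eqI) (simp add: lookup_log_deriv lookup_single_mult)

lemma ext_deriv_eq_koszul: "ext_deriv = koszul log_deriv"
  by (simp add: fun_eq_iff ext_deriv_def koszul_def koszul_sign_def)

lemma ext_deriv_fun_form: "ext_deriv (fun_form f) $ I = (if \<exists>i. I = {i} then log_deriv (the_elem I) f else 0)"
proof (cases "\<exists>i. I = {i}")
  case True
  then obtain i where I: "I = {i}" by blast
  show ?thesis by (simp add: I ext_deriv_def fun_form_def axis_def cong: conj_cong)
next
  case False
  have "log_deriv i (fun_form f $ (I - {i})) = 0" if "i \<in> I" for i
  proof -
    have "I - {i} \<noteq> {}" using False that by blast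
    then show ?thesis by (simp add: fun_form_def axis_def)
  qed
  then show ?thesis using False by (simp add: ext_deriv_def)
qed

text \<open>The form df has coordinates only at singletons, so only the summands I = {i} survive,
  and their sign is the Koszul sign.\<close>

lemma wedge_df: "wedge (ext_deriv (fun_form f)) \<omega> = df_wedge f \<omega>"
proof (rule vec_eq_iff[THEN iffD2], rule allI)
  fix J
  let ?t = "\<lambda>I. (-1) ^ card {(i, j). i \<in> I \<and> j \<in> J - I \<and> j < i} * (ext_deriv (fun_form f) $ I) * (\<omega> $ (J - I))"
  have "wedge (ext_deriv (fun_form f)) \<omega> $ J = sum ?t (Pow J)" by (simp add: wedge_def)
  also have "\<dots> = sum ?t ((\<lambda>i. {i}) ` J)"
    by (rule sum.mono_neutral_right) (auto simp: ext_deriv_fun_form)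
  also have "\<dots> = (\<Sum>i\<in>J. ?t {i})" by (subst sum.reindex) auto
  also have "\<dots> = df_wedge f \<omega> $ J"
    unfolding koszul_def vec_lambda_beta
  proof (intro sum.cong refl)
    fix i assume "i \<in> J"
    have "{(i', j). i' \<in> {i} \<and> j \<in> J - {i} \<and> j < i'} = Pair i ` {j \<in> J. j < i}" by auto
    then have "card {(i', j). i' \<in> {i} \<and> j \<in> J - {i} \<and> j < i'} = card {j \<in> J. j < i}"
      by (simp add: card_image inj_on_def)
    then show "?t {i} = koszul_sign i J * (log_deriv i f * \<omega> $ (J - {i}))"
      by (simp add: ext_deriv_fun_form koszul_sign_def mult.assoc)
  qed
  finally show "wedge (ext_deriv (fun_form f)) \<omega> $ J = df_wedge f \<omega> $ J" .
qed

lemma ext_deriv_add: "ext_deriv (\<omega> + \<eta>) = ext_deriv \<omega> + ext_deriv \<eta>"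
  unfolding ext_deriv_eq_koszul by (rule koszul_add) (rule additive_log_deriv)

lemma ext_deriv_diff: "ext_deriv (\<omega> - \<eta>) = ext_deriv \<omega> - ext_deriv \<eta>"
  unfolding ext_deriv_eq_koszul by (rule koszul_diff) (rule additive_log_deriv)

lemma ext_deriv_0 [simp]: "ext_deriv 0 = 0"
  unfolding ext_deriv_eq_koszul by (rule koszul_zero) (rule additive_log_deriv)

lemmas df_wedge_add = koszul_add[OF additive_mult]
lemmas df_wedge_diff = koszul_diff[OF additive_mult]
lemmas df_wedge_0 [simp] = koszul_zero[OF additive_mult]

lemma ext_deriv_scale: "ext_deriv (psingle 0 c *s \<omega>) = psingle 0 c *s ext_deriv \<omega>"
  by (simp add: vec_eq_iff ext_deriv_eq_koszul koszul_def log_deriv_scal sum_distrib_left mult_ac)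

lemma ext_deriv_mult: "ext_deriv (g *s \<omega>) = df_wedge g \<omega> + g *s ext_deriv \<omega>"
  by (simp add: vec_eq_iff ext_deriv_eq_koszul koszul_def log_deriv_mult sum_distrib_left sum.distrib algebra_simps)

lemma ext_deriv_df_wedge: "ext_deriv (df_wedge f \<omega>) = - df_wedge f (ext_deriv \<omega>)"
  unfolding ext_deriv_eq_koszul
  by (rule koszul_anticommute[OF additive_log_deriv additive_mult]) (simp add: log_deriv_mult log_deriv_commute)

lemma df_wedge_square: "df_wedge f (df_wedge f \<omega>) = 0"
  by (rule koszul_square) (auto simp: additive_mult mult_ac)

lemma of_int_eq_single: "(of_int m :: 'e::comm_monoid_add \<Rightarrow>\<^sub>0 complex) = psingle 0 (of_int m)"
  by simp

section \<open>The operators in terms of the coefficients of powers of \<tau>\<close>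

lemma lookup_gm_tau: "plookup (gm_tau p) m = plookup p (m - 1)"
proof -
  have "plookup (gm_tau p) m = (\<Sum>k\<in>pkeys p. plookup p k when k + 1 = m)"
    by (simp add: gm_tau_def lookup_sum lookup_single)
  also have "\<dots> = (\<Sum>k\<in>pkeys p. if k = m - 1 then plookup p k else 0)"
    by (intro sum.cong) (auto simp: when_def)
  finally show ?thesis by (simp add: in_keys_iff)
qed

lemma lookup_gm_dtau:
  "plookup (gm_dtau f p) m = of_int (m + 1) *s plookup p (m + 1) - f *s plookup p m"
proof -
  have "plookup (gm_dtau f p) m = (\<Sum>k\<in>pkeys p. (of_int k *s plookup p k when k - 1 = m)) - (\<Sum>k\<in>pkeys p. (f *s plookup p k when k = m))"
    by (simp add: gm_dtau_def lookup_sum lookup_minus lookup_single sum_subtractf)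
  also have "(\<Sum>k\<in>pkeys p. (of_int k *s plookup p k when k - 1 = m)) = (\<Sum>k\<in>pkeys p. if k = m + 1 then of_int k *s plookup p k else 0)"
    by (intro sum.cong) (auto simp: when_def)
  also have "(\<Sum>k\<in>pkeys p. (f *s plookup p k when k = m)) = (\<Sum>k\<in>pkeys p. if k = m then f *s plookup p k else 0)"
    by (intro sum.cong) (auto simp: when_def)
  finally show ?thesis by (simp add: in_keys_iff)
qed

lemma lookup_gm_scale: "plookup (gm_scale c p) m = psingle 0 c *s plookup p m"
  by (auto simp: gm_scale_def map.rep_eq when_def)

lemma lookup_twisted_d:
  "plookup (twisted_d f p) m = ext_deriv (plookup p m) - df_wedge f (plookup p (m - 1))"
proof -
  have "plookup (twisted_d f p) m = (\<Sum>k\<in>pkeys p. (ext_deriv (plookup p k) when k = m)) - (\<Sum>k\<in>pkeys p. (df_wedge f (plookup p k) when k + 1 = m))"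
    by (simp add: twisted_d_def wedge_df lookup_sum lookup_minus lookup_single sum_subtractf)
  also have "(\<Sum>k\<in>pkeys p. (df_wedge f (plookup p k) when k + 1 = m)) = (\<Sum>k\<in>pkeys p. if k = m - 1 then df_wedge f (plookup p k) else 0)"
    by (intro sum.cong) (auto simp: when_def)
  also have "(\<Sum>k\<in>pkeys p. (ext_deriv (plookup p k) when k = m)) = (\<Sum>k\<in>pkeys p. if k = m then ext_deriv (plookup p k) else 0)"
    by (intro sum.cong) (auto simp: when_def)
  finally show ?thesis by (simp add: in_keys_iff)
qed

lemmas lookup_gm = lookup_gm_tau lookup_gm_dtau lookup_gm_scale lookup_twisted_d lookup_add lookup_minus

lemma vector_scale_diff: "(c::'a::ring) *s (x - y) = c *s x - c *s y"
  by (simp add: vec_eq_iff right_diff_distrib)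

lemma gm_tau_add: "gm_tau (p + q) = gm_tau p + gm_tau q"
  by (rule poly_mapping_eqI) (simp add: lookup_gm)

lemma gm_dtau_add: "gm_dtau f (p + q) = gm_dtau f p + gm_dtau f q"
  by (rule poly_mapping_eqI) (simp add: lookup_gm vector_add_ldistrib)

lemma gm_scale_add: "gm_scale c (p + q) = gm_scale c p + gm_scale c q"
  by (rule poly_mapping_eqI) (simp add: lookup_gm vector_add_ldistrib)

lemma gm_scale_scale: "gm_scale c (gm_scale d p) = gm_scale (c * d) p"
  by (rule poly_mapping_eqI) (simp add: lookup_gm vector_smult_assoc mult_single)

lemma gm_scale_plus: "gm_scale (c + d) p = gm_scale c p + gm_scale d p"
  by (rule poly_mapping_eqI) (simp add: lookup_gm single_add vector_sadd_rdistrib)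

lemma gm_scale_1 [simp]: "gm_scale 1 p = p"
  by (rule poly_mapping_eqI) (simp add: lookup_gm)

lemma gm_scale_0 [simp]: "gm_scale 0 p = 0"
  by (rule poly_mapping_eqI) (simp add: lookup_gm)

lemma gm_scale_minus_1: "gm_scale (-1) p = - p"
  by (rule poly_mapping_eqI) (simp add: lookup_gm vec_eq_iff single_uminus)

lemma gm_tau_scale: "gm_tau (gm_scale c p) = gm_scale c (gm_tau p)"
  by (rule poly_mapping_eqI) (simp add: lookup_gm)

lemma gm_dtau_scale: "gm_dtau f (gm_scale c p) = gm_scale c (gm_dtau f p)"
  by (rule poly_mapping_eqI) (simp add: lookup_gm vec_eq_iff algebra_simps)

lemma gm_dtau_tau: "gm_dtau f (gm_tau p) = gm_tau (gm_dtau f p) + p"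
  by (rule poly_mapping_eqI) (simp add: lookup_gm vec_eq_iff algebra_simps)

lemma twisted_d_add: "twisted_d f (p + q) = twisted_d f p + twisted_d f q"
  by (rule poly_mapping_eqI) (simp add: lookup_gm ext_deriv_add df_wedge_add)

lemma twisted_d_tau: "twisted_d f (gm_tau p) = gm_tau (twisted_d f p)"
  by (rule poly_mapping_eqI) (simp add: lookup_gm)

lemma twisted_d_scale: "twisted_d f (gm_scale c p) = gm_scale c (twisted_d f p)"
  by (rule poly_mapping_eqI) (simp add: lookup_gm ext_deriv_scale koszul_scale vector_scale_diff)

text \<open>Formally the two operators are d and the \<tau>-derivative conjugated by exp(\<tau> f),
  so they commute. In coefficients, the df that d produces from the factor f is the df that
  differentiating \<tau> df produces.\<close>

lemma twisted_d_dtau: "twisted_d f (gm_dtau f p) = gm_dtau f (twisted_d f p)"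
proof (rule poly_mapping_eqI)
  fix m
  have e: "ext_deriv (of_int k *s \<omega>) = of_int k *s ext_deriv \<omega>" for k :: int and \<omega> :: "'a form"
    unfolding of_int_eq_single by (rule ext_deriv_scale)
  show "plookup (twisted_d f (gm_dtau f p)) m = plookup (gm_dtau f (twisted_d f p)) m"
    by (simp add: lookup_gm ext_deriv_diff ext_deriv_add e ext_deriv_mult[of f] df_wedge_diff koszul_scale vec_eq_iff algebra_simps)
qed

section \<open>Form degrees and the submodule of relations\<close>

lemma k_forms_0: "0 \<in> k_forms k"
  by (simp add: k_forms_def)

lemma k_forms_add: "\<omega> \<in> k_forms k \<Longrightarrow> \<eta> \<in> k_forms k \<Longrightarrow> \<omega> + \<eta> \<in> k_forms k"
  by (simp add: k_forms_def)

lemma k_forms_diff: "\<omega> \<in> k_forms k \<Longrightarrow> \<eta> \<in> k_forms k \<Longrightarrow> \<omega> - \<eta> \<in> k_forms k"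
  by (simp add: k_forms_def)

lemma k_forms_scale: "\<omega> \<in> k_forms k \<Longrightarrow> g *s \<omega> \<in> k_forms k"
  by (simp add: k_forms_def)

lemma koszul_k_forms:
  assumes "\<And>i. T i 0 = 0" "\<omega> \<in> k_forms k"
  shows "koszul T \<omega> \<in> k_forms (Suc k)"
  unfolding k_forms_def
proof (intro CollectI allI impI)
  fix I :: "'a set" assume I: "card I \<noteq> Suc k"
  have "\<omega> $ (I - {i}) = 0" if "i \<in> I" for i
  proof -
    have "card (I - {i}) \<noteq> k" using I card_Suc_Diff1[of I i] that by auto
    then show ?thesis using assms(2) by (simp add: k_forms_def)
  qed
  then show "koszul T \<omega> $ I = 0" by (simp add: koszul_def assms(1))
qed

lemma tau_forms_add: "p \<in> tau_forms k \<Longrightarrow> q \<in> tau_forms k \<Longrightarrow> p + q \<in> tau_forms k"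
  by (simp add: tau_forms_def lookup_add k_forms_add)

lemma tau_forms_diff: "p \<in> tau_forms k \<Longrightarrow> q \<in> tau_forms k \<Longrightarrow> p - q \<in> tau_forms k"
  by (simp add: tau_forms_def lookup_minus k_forms_diff)

lemma tau_forms_0: "0 \<in> tau_forms k"
  by (simp add: tau_forms_def k_forms_0)

lemma tau_forms_sum: "(\<And>i. i \<in> A \<Longrightarrow> p i \<in> tau_forms k) \<Longrightarrow> sum p A \<in> tau_forms k"
  by (induction A rule: infinite_finite_induct) (auto simp: tau_forms_0 tau_forms_add)

lemma tau_forms_tau: "p \<in> tau_forms k \<Longrightarrow> gm_tau p \<in> tau_forms k"
  by (simp add: tau_forms_def lookup_gm)

lemma tau_forms_dtau: "p \<in> tau_forms k \<Longrightarrow> gm_dtau f p \<in> tau_forms k"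
  by (simp add: tau_forms_def lookup_gm k_forms_diff k_forms_add k_forms_scale)

lemma tau_forms_scale: "p \<in> tau_forms k \<Longrightarrow> gm_scale c p \<in> tau_forms k"
  by (simp add: tau_forms_def lookup_gm k_forms_scale)

lemma gm_relations_0: "0 \<in> gm_relations f"
proof -
  have "twisted_d f 0 = 0" by (rule poly_mapping_eqI) (simp add: lookup_gm)
  then show ?thesis unfolding gm_relations_def using tau_forms_0 by (metis imageI)
qed

lemma gm_relations_add: "p \<in> gm_relations f \<Longrightarrow> q \<in> gm_relations f \<Longrightarrow> p + q \<in> gm_relations f"
  unfolding gm_relations_def by (auto simp flip: twisted_d_add intro!: imageI tau_forms_add)

lemma gm_relations_tau: "p \<in> gm_relations f \<Longrightarrow> gm_tau p \<in> gm_relations f"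
  unfolding gm_relations_def by (auto simp flip: twisted_d_tau intro!: imageI tau_forms_tau)

lemma gm_relations_dtau: "p \<in> gm_relations f \<Longrightarrow> gm_dtau f p \<in> gm_relations f"
  unfolding gm_relations_def by (auto simp flip: twisted_d_dtau intro!: imageI tau_forms_dtau)

lemma gm_relations_scale: "p \<in> gm_relations f \<Longrightarrow> gm_scale c p \<in> gm_relations f"
  unfolding gm_relations_def by (auto simp flip: twisted_d_scale intro!: imageI tau_forms_scale)

lemma gm_relations_uminus: "p \<in> gm_relations f \<Longrightarrow> - p \<in> gm_relations f"
  using gm_relations_scale[of p f "-1"] by (simp add: gm_scale_minus_1)

lemma gm_relations_diff: "p \<in> gm_relations f \<Longrightarrow> q \<in> gm_relations f \<Longrightarrow> p - q \<in> gm_relations f"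
  using gm_relations_add[of p f "- q"] gm_relations_uminus[of q f] by simp

lemma gm_class_eq_iff: "gm_class f p = gm_class f q \<longleftrightarrow> p - q \<in> gm_relations f"
proof
  assume "gm_class f p = gm_class f q"
  moreover have "p + 0 \<in> gm_class f p" unfolding gm_class_def using gm_relations_0 by blast
  ultimately have "p \<in> gm_class f q" by simp
  then show "p - q \<in> gm_relations f" by (auto simp: gm_class_def)
next
  assume pq: "p - q \<in> gm_relations f"
  have "gm_class f p \<subseteq> gm_class f q" if "p - q \<in> gm_relations f" for p q
  proof
    fix x assume "x \<in> gm_class f p"
    then obtain w where "x = p + w" "w \<in> gm_relations f" by (auto simp: gm_class_def)
    then have "x = q + ((p - q) + w)" "(p - q) + w \<in> gm_relations f"
      using that by (simp_all add: gm_relations_add)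
    then show "x \<in> gm_class f q" unfolding gm_class_def by blast
  qed
  moreover have "q - p \<in> gm_relations f" using gm_relations_uminus[OF pq] by simp
  ultimately show "gm_class f p = gm_class f q" using pq by blast
qed

lemma gm_dtau_0 [simp]: "gm_dtau f 0 = 0"
  by (rule poly_mapping_eqI) (simp add: lookup_gm_dtau)

text \<open>The conditions under which an operator on forms descends to G. All operators of the Weyl
  algebra pieces satisfy them, so they may be applied to equations between classes.\<close>

definition gm_operator :: "'n::{finite,linorder} laurent \<Rightarrow> ('n tau_form \<Rightarrow> 'n tau_form) \<Rightarrow> bool" where
  "gm_operator f P \<longleftrightarrow> (\<forall>p q. P (p + q) = P p + P q) \<and> (\<forall>p\<in>tau_forms CARD('n). P p \<in> tau_forms CARD('n)) \<and>
     (\<forall>p\<in>gm_relations f. P p \<in> gm_relations f)"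

lemma gm_operator_tau: "gm_operator f gm_tau"
  by (simp add: gm_operator_def gm_tau_add tau_forms_tau gm_relations_tau)

lemma gm_operator_dtau: "gm_operator f (gm_dtau f)"
  by (simp add: gm_operator_def gm_dtau_add tau_forms_dtau gm_relations_dtau)

lemma gm_operator_scale: "gm_operator f (gm_scale c)"
  by (simp add: gm_operator_def gm_scale_add tau_forms_scale gm_relations_scale)

lemma gm_operator_comp: "gm_operator f P \<Longrightarrow> gm_operator f Q \<Longrightarrow> gm_operator f (P \<circ> Q)"
  by (simp add: gm_operator_def)

lemma gm_operator_plus: "gm_operator f P \<Longrightarrow> gm_operator f Q \<Longrightarrow> gm_operator f (\<lambda>p. P p + Q p)"
  by (auto simp: gm_operator_def tau_forms_add gm_relations_add)

lemma gm_operator_funpow: "gm_operator f P \<Longrightarrow> gm_operator f (P ^^ k)"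
proof (induction k)
  case 0
  then show ?case by (simp add: gm_operator_def)
next
  case (Suc k)
  then show ?case by (simp only: funpow.simps gm_operator_comp)
qed

lemma gm_operator_weyl_V0: "P \<in> weyl_V0 f \<Longrightarrow> gm_operator f P"
proof (induction rule: weyl_V0.induct)
  case (add P Q)
  show ?case by (rule gm_operator_plus[OF add.IH])
next
  case (mult P Q)
  show ?case by (rule gm_operator_comp[OF mult.IH])
qed (rule gm_operator_scale gm_operator_tau gm_operator_comp[OF gm_operator_tau gm_operator_dtau])+

lemma gm_operator_weyl_V_pos: "P \<in> weyl_V_pos f k \<Longrightarrow> gm_operator f P"
proof (induction k arbitrary: P)
  case 0
  then show ?case by (simp add: gm_operator_weyl_V0)
next
  case (Suc k)
  then obtain Q R where P: "P = (\<lambda>p. Q p + gm_dtau f (R p))" "gm_operator f Q" "gm_operator f R" by auto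
  then have "gm_operator f (\<lambda>p. Q p + (gm_dtau f \<circ> R) p)"
    by (intro gm_operator_plus gm_operator_comp gm_operator_dtau)
  then show ?case by (simp add: P(1))
qed

lemma gm_operator_weyl_V: "P \<in> weyl_V f k \<Longrightarrow> gm_operator f P"
  unfolding weyl_V_def
  by (auto split: if_splits intro: gm_operator_weyl_V_pos gm_operator_comp gm_operator_funpow gm_operator_tau gm_operator_weyl_V0)

lemma gm_operator_add: "gm_operator f P \<Longrightarrow> P (p + q) = P p + P q"
  by (simp add: gm_operator_def)

lemma gm_operator_0: "gm_operator f P \<Longrightarrow> P 0 = 0"
  using gm_operator_add[of f P 0 0] by simp

lemma gm_operator_diff: "gm_operator f P \<Longrightarrow> P (p - q) = P p - P q"
  using gm_operator_add[of f P "p - q" q] by simp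

lemma gm_operator_sum: "gm_operator f P \<Longrightarrow> P (sum g A) = (\<Sum>x\<in>A. P (g x))"
  by (induction A rule: infinite_finite_induct) (simp_all add: gm_operator_0 gm_operator_add)

lemma gm_operator_class:
  "gm_operator f P \<Longrightarrow> gm_class f p = gm_class f q \<Longrightarrow> gm_class f (P p) = gm_class f (P q)"
  unfolding gm_class_eq_iff by (metis gm_operator_diff gm_operator_def)

section \<open>The V-filtration of the Weyl algebra is multiplicative\<close>

lemma weyl_V0_tau: "P \<in> weyl_V0 (f :: 'n::{finite,linorder} laurent) \<Longrightarrow> \<exists>P'\<in>weyl_V0 f. P \<circ> gm_tau = gm_tau \<circ> P'"
proof (induction rule: weyl_V0.induct)
  case (const c)
  show ?case by (intro bexI[of _ "gm_scale c"]) (auto simp: fun_eq_iff gm_tau_scale weyl_V0.const)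
next
  case tau
  show ?case by (intro bexI[of _ gm_tau]) (auto simp: weyl_V0.tau)
next
  case euler
  have "(\<lambda>p. (gm_tau \<circ> gm_dtau f) p + gm_scale 1 p) \<in> weyl_V0 f"
    by (intro weyl_V0.add weyl_V0.euler weyl_V0.const)
  then show ?case by (rule bexI[rotated]) (simp add: fun_eq_iff gm_dtau_tau)
next
  case (add P Q)
  then obtain P' Q' where P': "P' \<in> weyl_V0 f" "P \<circ> gm_tau = gm_tau \<circ> P'" and Q': "Q' \<in> weyl_V0 f" "Q \<circ> gm_tau = gm_tau \<circ> Q'"
    by blast
  have "(\<lambda>p. P' p + Q' p) \<in> weyl_V0 f" by (intro weyl_V0.add P' Q')
  then show ?case by (rule bexI[rotated]) (use P'(2) Q'(2) in \<open>simp add: fun_eq_iff gm_tau_add\<close>)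
next
  case (mult P Q)
  then obtain P' Q' where P': "P' \<in> weyl_V0 f" "P \<circ> gm_tau = gm_tau \<circ> P'" and Q': "Q' \<in> weyl_V0 f" "Q \<circ> gm_tau = gm_tau \<circ> Q'"
    by blast
  have "P' \<circ> Q' \<in> weyl_V0 f" by (intro weyl_V0.mult P' Q')
  then show ?case by (rule bexI[rotated]) (use P'(2) Q'(2) in \<open>simp add: fun_eq_iff\<close>)
qed

lemma weyl_V0_tau_funpow: "P \<in> weyl_V0 (f :: 'n::{finite,linorder} laurent) \<Longrightarrow> \<exists>P'\<in>weyl_V0 f. P \<circ> (gm_tau ^^ k) = (gm_tau ^^ k) \<circ> P'"
proof (induction k arbitrary: P)
  case 0
  then show ?case by auto
next
  case (Suc k)
  obtain P' where P': "P' \<in> weyl_V0 f" "P \<circ> gm_tau = gm_tau \<circ> P'" using weyl_V0_tau[OF Suc.prems] by blast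
  obtain P'' where P'': "P'' \<in> weyl_V0 f" "P' \<circ> (gm_tau ^^ k) = (gm_tau ^^ k) \<circ> P''" using Suc.IH[OF P'(1)] by blast
  have "P \<circ> (gm_tau ^^ Suc k) = (gm_tau ^^ Suc k) \<circ> P''"
    using P'(2) P''(2) by (simp add: fun_eq_iff)
  then show ?case using P''(1) by blast
qed

text \<open>Moving \<open>\<partial>\<^sub>\<tau>\<close> to the left of
  \<open>\<tau>\<partial>\<^sub>\<tau>\<close> costs a scalar; the operator \<tau> in front of
  \<open>\<partial>\<^sub>\<tau>\<close> yields \<open>\<tau>\<partial>\<^sub>\<tau>\<close> itself,
  which goes into the second summand \<open>P''\<close>. With the corresponding rule for \<tau> this
  leads to \<open>weyl_V_mult\<close>, which the one-sided definition of the pieces does not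
  display.\<close>

lemma weyl_V0_dtau:
  "P \<in> weyl_V0 (f :: 'n::{finite,linorder} laurent) \<Longrightarrow> \<exists>P'\<in>weyl_V0 f. \<exists>P''\<in>weyl_V0 f. \<forall>p. P (gm_dtau f p) = gm_dtau f (P' p) + P'' p"
proof (induction rule: weyl_V0.induct)
  case (const c)
  show ?case by (intro bexI[of _ "gm_scale c"] bexI[of _ "gm_scale 0"]) (auto simp: gm_dtau_scale weyl_V0.const)
next
  case tau
  show ?case
    by (intro bexI[of _ "gm_scale 0"] bexI[of _ "gm_tau \<circ> gm_dtau f"])
      (auto simp: comp_def intro: weyl_V0.const weyl_V0.euler[unfolded comp_def])
next
  case euler
  show ?case
  proof (rule bexI[of _ "\<lambda>p. (gm_tau \<circ> gm_dtau f) p + gm_scale (-1) p"], rule bexI[of _ "gm_scale 0"], rule allI)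
    show "(\<lambda>p. (gm_tau \<circ> gm_dtau f) p + gm_scale (-1) p) \<in> weyl_V0 f"
      by (intro weyl_V0.add weyl_V0.euler weyl_V0.const)
    fix p
    show "(gm_tau \<circ> gm_dtau f) (gm_dtau f p) = gm_dtau f ((gm_tau \<circ> gm_dtau f) p + gm_scale (- 1) p) + gm_scale 0 p"
      by (simp only: comp_apply gm_dtau_add gm_dtau_scale gm_dtau_tau gm_scale_0) (simp add: gm_scale_minus_1)
  qed (rule weyl_V0.const)
next
  case (add P Q)
  then obtain P' P'' Q' Q'' where P: "P' \<in> weyl_V0 f" "P'' \<in> weyl_V0 f" "\<forall>p. P (gm_dtau f p) = gm_dtau f (P' p) + P'' p"
    and Q: "Q' \<in> weyl_V0 f" "Q'' \<in> weyl_V0 f" "\<forall>p. Q (gm_dtau f p) = gm_dtau f (Q' p) + Q'' p" by blast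
  have "(\<lambda>p. P' p + Q' p) \<in> weyl_V0 f" "(\<lambda>p. P'' p + Q'' p) \<in> weyl_V0 f" by (intro weyl_V0.add P Q)+
  moreover have "P (gm_dtau f p) + Q (gm_dtau f p) = gm_dtau f (P' p + Q' p) + (P'' p + Q'' p)" for p
    using P(3) Q(3) by (simp add: gm_dtau_add)
  ultimately show ?case by (intro bexI[of _ "\<lambda>p. P' p + Q' p"] bexI[of _ "\<lambda>p. P'' p + Q'' p"]) auto
next
  case (mult P Q)
  then obtain P' P'' Q' Q'' where P: "P' \<in> weyl_V0 f" "P'' \<in> weyl_V0 f" "\<forall>p. P (gm_dtau f p) = gm_dtau f (P' p) + P'' p"
    and Q: "Q' \<in> weyl_V0 f" "Q'' \<in> weyl_V0 f" "\<forall>p. Q (gm_dtau f p) = gm_dtau f (Q' p) + Q'' p" by blast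
  have "(\<lambda>p. (P'' \<circ> Q') p + (P \<circ> Q'') p) \<in> weyl_V0 f" "P' \<circ> Q' \<in> weyl_V0 f"
    by (intro weyl_V0.add weyl_V0.mult P Q mult.hyps)+
  moreover have "(P \<circ> Q) (gm_dtau f p) = gm_dtau f ((P' \<circ> Q') p) + ((P'' \<circ> Q') p + (P \<circ> Q'') p)" for p
    using P(3) Q(3) gm_operator_add[OF gm_operator_weyl_V0[OF mult.hyps(1)]] by (simp add: add.assoc)
  ultimately show ?case by (intro bexI[of _ "P' \<circ> Q'"] bexI[of _ "\<lambda>p. (P'' \<circ> Q') p + (P \<circ> Q'') p"]) auto
qed

lemma weyl_V0_zero: "(\<lambda>p. 0) \<in> weyl_V0 (f :: 'n::{finite,linorder} laurent)"
proof -
  have "gm_scale 0 = (\<lambda>p :: 'n tau_form. 0)" by (rule ext) simp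
  then show ?thesis using weyl_V0.const[of 0 f] by simp
qed

lemma weyl_V_pos_SucI:
  "A \<in> weyl_V_pos (f :: 'n::{finite,linorder} laurent) k \<Longrightarrow> B \<in> weyl_V_pos f k \<Longrightarrow> (\<lambda>p. A p + gm_dtau f (B p)) \<in> weyl_V_pos f (Suc k)"
  by auto

lemma weyl_V_pos_SucE:
  assumes "Q \<in> weyl_V_pos f (Suc k)"
  obtains A B where "Q = (\<lambda>p. A p + gm_dtau f (B p))" "A \<in> weyl_V_pos f k" "B \<in> weyl_V_pos f k"
  using assms by auto

lemma weyl_V_pos_zero: "(\<lambda>p. 0) \<in> weyl_V_pos (f :: 'n::{finite,linorder} laurent) k"
proof (induction k)
  case (Suc k)
  from weyl_V_pos_SucI[OF Suc Suc] show ?case by simp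
qed (simp add: weyl_V0_zero)

lemma weyl_V_pos_mono: "P \<in> weyl_V_pos (f :: 'n::{finite,linorder} laurent) k \<Longrightarrow> P \<in> weyl_V_pos f (Suc k)"
  using weyl_V_pos_SucI[OF _ weyl_V_pos_zero, of P f k] by simp

lemma weyl_V_pos_add: "P \<in> weyl_V_pos (f :: 'n::{finite,linorder} laurent) k \<Longrightarrow> Q \<in> weyl_V_pos f k \<Longrightarrow> (\<lambda>p. P p + Q p) \<in> weyl_V_pos f k"
proof (induction k arbitrary: P Q)
  case 0
  then show ?case by (simp add: weyl_V0.add)
next
  case (Suc k)
  then obtain A B A' B' where P: "P = (\<lambda>p. A p + gm_dtau f (B p))" "A \<in> weyl_V_pos f k" "B \<in> weyl_V_pos f k"
    and Q: "Q = (\<lambda>p. A' p + gm_dtau f (B' p))" "A' \<in> weyl_V_pos f k" "B' \<in> weyl_V_pos f k" by auto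
  have "(\<lambda>p. P p + Q p) = (\<lambda>p. (A p + A' p) + gm_dtau f (B p + B' p))"
    by (simp add: P Q gm_dtau_add algebra_simps)
  moreover have "(\<lambda>p. A p + A' p) \<in> weyl_V_pos f k" "(\<lambda>p. B p + B' p) \<in> weyl_V_pos f k"
    using Suc.IH P Q by blast+
  ultimately show ?case using weyl_V_pos_SucI by (simp only:)
qed

lemma weyl_V_add:
  fixes f :: "'n::{finite,linorder} laurent"
  shows "P \<in> weyl_V f k \<Longrightarrow> Q \<in> weyl_V f k \<Longrightarrow> (\<lambda>p. P p + Q p) \<in> weyl_V f k"
proof (cases "k \<le> 0")
  case True
  assume "P \<in> weyl_V f k" "Q \<in> weyl_V f k"
  then obtain P' Q' where P: "P = (gm_tau ^^ nat (- k)) \<circ> P'" "P' \<in> weyl_V0 f" and Q: "Q = (gm_tau ^^ nat (- k)) \<circ> Q'" "Q' \<in> weyl_V0 f"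
    using True by (auto simp: weyl_V_def)
  have "(\<lambda>p. P p + Q p) = (gm_tau ^^ nat (- k)) \<circ> (\<lambda>p. P' p + Q' p)"
    by (simp add: P Q fun_eq_iff gm_operator_add[OF gm_operator_funpow[OF gm_operator_tau]])
  moreover have "(\<lambda>p. P' p + Q' p) \<in> weyl_V0 f" by (intro weyl_V0.add P Q)
  ultimately show ?thesis using True unfolding weyl_V_def by auto
qed (auto simp: weyl_V_def weyl_V_pos_add)

lemma weyl_V0_V_pos: "P \<in> weyl_V0 (f :: 'n::{finite,linorder} laurent) \<Longrightarrow> Q \<in> weyl_V_pos f k \<Longrightarrow> P \<circ> Q \<in> weyl_V_pos f k"
proof (induction k arbitrary: P Q)
  case 0
  then show ?case unfolding weyl_V_pos.simps by (intro weyl_V0.mult)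
next
  case (Suc k)
  then obtain A B where Q: "Q = (\<lambda>p. A p + gm_dtau f (B p))" "A \<in> weyl_V_pos f k" "B \<in> weyl_V_pos f k" by auto
  obtain P' P'' where P: "P' \<in> weyl_V0 f" "P'' \<in> weyl_V0 f" "\<forall>p. P (gm_dtau f p) = gm_dtau f (P' p) + P'' p"
    using weyl_V0_dtau[OF Suc.prems(1)] by blast
  have "P \<circ> Q = (\<lambda>p. ((P \<circ> A) p + (P'' \<circ> B) p) + gm_dtau f ((P' \<circ> B) p))"
    using P(3) by (simp add: Q fun_eq_iff gm_operator_add[OF gm_operator_weyl_V0[OF Suc.prems(1)]] add_ac)
  moreover have "(\<lambda>p. (P \<circ> A) p + (P'' \<circ> B) p) \<in> weyl_V_pos f k"
    by (intro weyl_V_pos_add Suc.IH Suc.prems(1) Q P)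
  moreover have "P' \<circ> B \<in> weyl_V_pos f k" by (intro Suc.IH P Q)
  ultimately show ?case using weyl_V_pos_SucI by (simp only:)
qed

lemma weyl_V0_V: "P \<in> weyl_V0 (f :: 'n::{finite,linorder} laurent) \<Longrightarrow> Q \<in> weyl_V f k \<Longrightarrow> P \<circ> Q \<in> weyl_V f k"
proof (cases "k \<le> 0")
  case True
  assume P: "P \<in> weyl_V0 f" and "Q \<in> weyl_V f k"
  then obtain Q' where Q: "Q = (gm_tau ^^ nat (- k)) \<circ> Q'" "Q' \<in> weyl_V0 f"
    using True by (auto simp: weyl_V_def)
  obtain P' where P': "P' \<in> weyl_V0 f" "P \<circ> (gm_tau ^^ nat (- k)) = (gm_tau ^^ nat (- k)) \<circ> P'"
    using weyl_V0_tau_funpow[OF P] by blast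
  have "P \<circ> Q = (gm_tau ^^ nat (- k)) \<circ> (P' \<circ> Q')" by (simp only: Q(1) comp_assoc[symmetric] P'(2))
  then show ?thesis using True weyl_V0.mult[OF P'(1) Q(2)] unfolding weyl_V_def by auto
qed (auto simp: weyl_V_def weyl_V0_V_pos)

lemma weyl_V_mono_Suc: "P \<in> weyl_V (f :: 'n::{finite,linorder} laurent) k \<Longrightarrow> P \<in> weyl_V f (k + 1)"
proof (cases "k < 0")
  case True
  assume "P \<in> weyl_V f k"
  then obtain P' where P: "P = (gm_tau ^^ nat (- k)) \<circ> P'" "P' \<in> weyl_V0 f" using True by (auto simp: weyl_V_def)
  have "nat (- k) = Suc (nat (- (k + 1)))" using True by simp
  then have "P = (gm_tau ^^ nat (- (k + 1))) \<circ> (gm_tau \<circ> P')" using P(1) by (simp add: funpow_swap1 fun_eq_iff)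
  then show ?thesis using True weyl_V0.mult[OF weyl_V0.tau P(2)] unfolding weyl_V_def by auto
next
  case False
  assume "P \<in> weyl_V f k"
  then have "P \<in> weyl_V_pos f (nat k)" using False by (cases "k = 0") (auto simp: weyl_V_def)
  then have "P \<in> weyl_V_pos f (Suc (nat k))" by (rule weyl_V_pos_mono)
  then show ?thesis using False by (simp add: weyl_V_def Suc_nat_eq_nat_zadd1 add.commute)
qed

lemma weyl_V_mono: "j \<le> k \<Longrightarrow> P \<in> weyl_V (f :: 'n::{finite,linorder} laurent) j \<Longrightarrow> P \<in> weyl_V f k"
  by (induction k rule: int_ge_induct) (auto intro: weyl_V_mono_Suc)

lemma weyl_V_tau: "Q \<in> weyl_V (f :: 'n::{finite,linorder} laurent) k \<Longrightarrow> gm_tau \<circ> Q \<in> weyl_V f (k - 1)"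
proof (cases "k \<le> 0")
  case True
  assume "Q \<in> weyl_V f k"
  then obtain Q' where Q: "Q = (gm_tau ^^ nat (- k)) \<circ> Q'" "Q' \<in> weyl_V0 f" using True by (auto simp: weyl_V_def)
  have "nat (- (k - 1)) = Suc (nat (- k))" using True by simp
  then have "gm_tau \<circ> Q = (gm_tau ^^ nat (- (k - 1))) \<circ> Q'" by (simp add: Q(1) fun_eq_iff)
  then show ?thesis using True Q(2) unfolding weyl_V_def by auto
next
  case False
  have *: "gm_tau \<circ> Q \<in> weyl_V f (int j)" if "Q \<in> weyl_V_pos f (Suc j)" for j Q
    using that
  proof (induction j arbitrary: Q)
    case 0
    then obtain A B where Q: "Q = (\<lambda>p. A p + gm_dtau f (B p))" "A \<in> weyl_V0 f" "B \<in> weyl_V0 f" by auto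
    have "gm_tau \<circ> Q = (\<lambda>p. (gm_tau \<circ> A) p + ((gm_tau \<circ> gm_dtau f) \<circ> B) p)"
      by (simp add: Q fun_eq_iff gm_tau_add)
    also have "\<dots> \<in> weyl_V0 f" by (intro weyl_V0.add weyl_V0.mult weyl_V0.tau weyl_V0.euler Q)
    finally show ?case unfolding weyl_V_def by (auto simp: comp_def)
  next
    case (Suc j)
    from Suc.prems obtain A B where Q: "Q = (\<lambda>p. A p + gm_dtau f (B p))" "A \<in> weyl_V_pos f (Suc j)" "B \<in> weyl_V_pos f (Suc j)"
      by (rule weyl_V_pos_SucE)
    have "gm_tau \<circ> A \<in> weyl_V f (int j)" by (rule Suc.IH[OF Q(2)])
    then have "gm_tau \<circ> A \<in> weyl_V f (int (Suc j))" by (rule weyl_V_mono[rotated]) simp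
    moreover have "(gm_tau \<circ> gm_dtau f) \<circ> B \<in> weyl_V f (int (Suc j))"
      using weyl_V0_V_pos[OF weyl_V0.euler Q(3)] by (simp add: weyl_V_def del: weyl_V_pos.simps of_nat_Suc)
    moreover have "gm_tau \<circ> Q = (\<lambda>p. (gm_tau \<circ> A) p + ((gm_tau \<circ> gm_dtau f) \<circ> B) p)"
      by (simp add: Q fun_eq_iff gm_tau_add)
    ultimately show ?case using weyl_V_add by (simp only:)
  qed
  assume "Q \<in> weyl_V f k"
  moreover have "k = int (Suc (nat (k - 1)))" using False by simp
  ultimately have "Q \<in> weyl_V_pos f (Suc (nat (k - 1)))" using False
    by (metis weyl_V_def nat_int)
  from *[OF this] show ?thesis using False by simp
qed

text \<open>Commuting \<open>\<partial>\<^sub>\<tau>\<close> past the powers of \<tau> leaves one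
  power less, followed by an element of the degree 0 piece. This is what \<open>weyl_V_dtau\<close>
  requires in negative degrees.\<close>

lemma gm_dtau_tau_funpow: "gm_dtau f ((gm_tau ^^ Suc k) p) = (gm_tau ^^ k) (gm_tau (gm_dtau f p) + gm_scale (of_nat (Suc k)) p)"
proof (induction k arbitrary: p)
  case 0
  then show ?case by (simp add: gm_dtau_tau)
next
  case (Suc k)
  have s: "gm_scale (of_nat (Suc j)) q = gm_scale (of_nat j) q + q" for j and q :: "'a tau_form"
    using gm_scale_plus[of "of_nat j" 1 q] by (simp add: add.commute)
  have "gm_dtau f ((gm_tau ^^ Suc (Suc k)) p) = gm_dtau f ((gm_tau ^^ Suc k) (gm_tau p))"
    by (simp add: funpow_swap1)
  also have "\<dots> = (gm_tau ^^ k) (gm_tau (gm_tau (gm_dtau f p) + gm_scale (of_nat (Suc (Suc k))) p))"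
    unfolding Suc.IH gm_dtau_tau s[of "Suc k"] gm_tau_add gm_tau_scale by (simp only: add_ac)
  also have "\<dots> = (gm_tau ^^ Suc k) (gm_tau (gm_dtau f p) + gm_scale (of_nat (Suc (Suc k))) p)"
    by (simp add: funpow_swap1)
  finally show ?case .
qed

lemma weyl_V_dtau: "Q \<in> weyl_V (f :: 'n::{finite,linorder} laurent) k \<Longrightarrow> gm_dtau f \<circ> Q \<in> weyl_V f (k + 1)"
proof (cases "k < 0")
  case True
  assume "Q \<in> weyl_V f k"
  then obtain Q' where Q: "Q = (gm_tau ^^ nat (- k)) \<circ> Q'" "Q' \<in> weyl_V0 f" using True by (auto simp: weyl_V_def)
  define j where "j = nat (- (k + 1))"
  have j: "nat (- k) = Suc j" using True by (simp add: j_def)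
  have "gm_dtau f \<circ> Q = (gm_tau ^^ j) \<circ> (\<lambda>p. ((gm_tau \<circ> gm_dtau f) \<circ> Q') p + (gm_scale (of_nat (Suc j)) \<circ> Q') p)"
    unfolding Q(1) j by (simp only: fun_eq_iff comp_apply gm_dtau_tau_funpow) simp
  moreover have "(\<lambda>p. ((gm_tau \<circ> gm_dtau f) \<circ> Q') p + (gm_scale (of_nat (Suc j)) \<circ> Q') p) \<in> weyl_V0 f"
    by (intro weyl_V0.add weyl_V0.mult weyl_V0.euler weyl_V0.const Q)
  ultimately show ?thesis using True unfolding weyl_V_def j_def by auto
next
  case False
  assume "Q \<in> weyl_V f k"
  then have "Q \<in> weyl_V_pos f (nat k)" using False by (cases "k = 0") (auto simp: weyl_V_def)
  then have "(\<lambda>p. 0 + gm_dtau f (Q p)) \<in> weyl_V_pos f (Suc (nat k))"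
    by (rule weyl_V_pos_SucI[OF weyl_V_pos_zero])
  then show ?thesis using False by (simp add: weyl_V_def Suc_nat_eq_nat_zadd1 add.commute comp_def del: weyl_V_pos.simps)
qed

lemma weyl_V_funpow_tau: "P \<in> weyl_V (f :: 'n::{finite,linorder} laurent) k \<Longrightarrow> (gm_tau ^^ j) \<circ> P \<in> weyl_V f (k - int j)"
proof (induction j)
  case 0
  then show ?case by simp
next
  case (Suc j)
  have "gm_tau \<circ> ((gm_tau ^^ j) \<circ> P) \<in> weyl_V f (k - int j - 1)" by (rule weyl_V_tau[OF Suc.IH[OF Suc.prems]])
  moreover have "k - int j - 1 = k - int (Suc j)" by simp
  ultimately show ?case by (simp only: funpow.simps comp_assoc)
qed

lemma weyl_V_mult:
  assumes "P \<in> weyl_V (f :: 'n::{finite,linorder} laurent) j" "Q \<in> weyl_V f k"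
  shows "P \<circ> Q \<in> weyl_V f (j + k)"
proof (cases "j \<le> 0")
  case True
  then obtain P' where P: "P = (gm_tau ^^ nat (- j)) \<circ> P'" "P' \<in> weyl_V0 f" using assms(1) by (auto simp: weyl_V_def)
  have "(gm_tau ^^ nat (- j)) \<circ> (P' \<circ> Q) \<in> weyl_V f (k - int (nat (- j)))"
    by (rule weyl_V_funpow_tau[OF weyl_V0_V[OF P(2) assms(2)]])
  moreover have "k - int (nat (- j)) = j + k" using True by simp
  ultimately show ?thesis by (simp only: P(1) comp_assoc)
next
  case False
  have *: "P \<circ> Q \<in> weyl_V f (int i + k)" if "P \<in> weyl_V_pos f i" for i P
    using that
  proof (induction i arbitrary: P)
    case 0
    then have "P \<in> weyl_V0 f" by simp
    then have "P \<circ> Q \<in> weyl_V f k" by (rule weyl_V0_V[OF _ assms(2)])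
    then show ?case by (simp only: of_nat_0 add_0)
  next
    case (Suc i)
    from Suc.prems obtain A B where P: "P = (\<lambda>p. A p + gm_dtau f (B p))" "A \<in> weyl_V_pos f i" "B \<in> weyl_V_pos f i"
      by (rule weyl_V_pos_SucE)
    have a: "A \<circ> Q \<in> weyl_V f (int (Suc i) + k)"
      by (rule weyl_V_mono[OF _ Suc.IH[OF P(2)]]) simp
    have b: "gm_dtau f \<circ> (B \<circ> Q) \<in> weyl_V f (int (Suc i) + k)"
    proof -
      have "int i + k + 1 = int (Suc i) + k" by simp
      then show ?thesis using weyl_V_dtau[OF Suc.IH[OF P(3)]] by (simp only:)
    qed
    have "P \<circ> Q = (\<lambda>p. (A \<circ> Q) p + (gm_dtau f \<circ> (B \<circ> Q)) p)" by (simp add: P(1) fun_eq_iff)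
    then show ?case using weyl_V_add[OF a b] by (simp only:)
  qed
  have "P \<in> weyl_V_pos f (nat j)" using assms(1) False by (simp add: weyl_V_def)
  from *[OF this] show ?thesis using False by simp
qed

lemma weyl_V0_in_V: "P \<in> weyl_V0 f \<Longrightarrow> P \<in> weyl_V f 0"
  by (simp add: weyl_V_def)

section \<open>Uniqueness of the Malgrange-Kashiwara filtration\<close>

lemma good_filtrationE:
  fixes f :: "'n::{finite,linorder} laurent"
  assumes "good_filtration f U"
  obtains r m l where "\<And>j. j < r \<Longrightarrow> m j \<in> tau_forms CARD('n)"
    "\<And>k. U k = {gm_class f (\<Sum>j<(r::nat). P j (m j)) | P. \<forall>j<r. P j \<in> weyl_V f (k - l j)}"
  using assms unfolding good_filtration_def by auto

lemma good_filtration_add: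
  fixes f :: "'n::{finite,linorder} laurent"
  assumes "good_filtration f U" "gm_class f p \<in> U k" "gm_class f q \<in> U k"
  shows "gm_class f (p + q) \<in> U k"
proof -
  obtain r m l where U: "\<And>k. U k = {gm_class f (\<Sum>j<(r::nat). P j (m j)) | P. \<forall>j<r. P j \<in> weyl_V f (k - l j)}"
    by (rule good_filtrationE[OF assms(1)]) blast
  obtain P Q where P: "gm_class f p = gm_class f (\<Sum>j<r. P j (m j))" "\<forall>j<r. P j \<in> weyl_V f (k - l j)"
    and Q: "gm_class f q = gm_class f (\<Sum>j<r. Q j (m j))" "\<forall>j<r. Q j \<in> weyl_V f (k - l j)"
    using assms(2,3) unfolding U by blast
  have "(p - (\<Sum>j<r. P j (m j))) + (q - (\<Sum>j<r. Q j (m j))) \<in> gm_relations f"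
    using P(1) Q(1) by (intro gm_relations_add) (simp_all add: gm_class_eq_iff)
  then have "gm_class f (p + q) = gm_class f (\<Sum>j<r. (\<lambda>x. P j x + Q j x) (m j))"
    by (simp add: gm_class_eq_iff sum.distrib algebra_simps)
  moreover have "\<forall>j<r. (\<lambda>x. P j x + Q j x) \<in> weyl_V f (k - l j)" using P(2) Q(2) weyl_V_add by blast
  ultimately show ?thesis unfolding U by (intro CollectI exI[of _ "\<lambda>j x. P j x + Q j x"] conjI)
qed

lemma good_filtration_weyl:
  fixes f :: "'n::{finite,linorder} laurent"
  assumes "good_filtration f U" "gm_class f p \<in> U k" "R \<in> weyl_V f i"
  shows "gm_class f (R p) \<in> U (k + i)"
proof -
  obtain r m l where U: "\<And>k. U k = {gm_class f (\<Sum>j<(r::nat). P j (m j)) | P. \<forall>j<r. P j \<in> weyl_V f (k - l j)}"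
    by (rule good_filtrationE[OF assms(1)]) blast
  obtain P where P: "gm_class f p = gm_class f (\<Sum>j<r. P j (m j))" "\<forall>j<r. P j \<in> weyl_V f (k - l j)"
    using assms(2) unfolding U by blast
  have op: "gm_operator f R" by (rule gm_operator_weyl_V[OF assms(3)])
  have "gm_class f (R p) = gm_class f (\<Sum>j<r. (R \<circ> P j) (m j))"
    using gm_operator_class[OF op P(1)] by (simp add: gm_operator_sum[OF op])
  moreover have "R \<circ> P j \<in> weyl_V f (k + i - l j)" if "j < r" for j
    using weyl_V_mult[OF assms(3), of "P j" "k - l j"] P(2) that by (simp add: algebra_simps)
  ultimately show ?thesis unfolding U by (intro CollectI exI[of _ "\<lambda>j. R \<circ> P j"] conjI) auto
qed

lemma good_filtration_zero:
  fixes f :: "'n::{finite,linorder} laurent"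
  assumes "good_filtration f U" shows "gm_class f 0 \<in> U k"
proof -
  obtain r m l where U: "\<And>k. U k = {gm_class f (\<Sum>j<(r::nat). P j (m j)) | P. \<forall>j<r. P j \<in> weyl_V f (k - l j)}"
    by (rule good_filtrationE[OF assms(1)]) blast
  have "(\<lambda>p. 0) \<in> weyl_V f k" for k
  proof (cases "k \<le> 0")
    case True
    have "(gm_tau ^^ nat (- k)) \<circ> (\<lambda>p. 0) = (\<lambda>p :: 'n tau_form. 0 :: 'n tau_form)"
      by (simp add: fun_eq_iff gm_operator_0[OF gm_operator_funpow[OF gm_operator_tau]])
    then show ?thesis using weyl_V0_zero[of f] unfolding weyl_V_def if_P[OF True]
      by (intro CollectI exI[of _ "\<lambda>p. 0"] conjI) simp_all
  qed (simp add: weyl_V_def weyl_V_pos_zero)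
  then show ?thesis unfolding U by (auto intro!: exI[of _ "\<lambda>j p. 0"])
qed

text \<open>The operator whose nilpotency on the graded piece at \<beta> is demanded. Products over
  several \<beta> are formed below; all these operators commute.\<close>

definition euler_shift :: "'n::{finite,linorder} laurent \<Rightarrow> rat \<Rightarrow> 'n tau_form \<Rightarrow> 'n tau_form" where
  "euler_shift f \<beta> q = gm_tau (gm_dtau f q) + gm_scale (of_rat \<beta>) q"

lemma euler_shift_eq: "euler_shift f \<beta> = (\<lambda>q. gm_tau (gm_dtau f q) + gm_scale (of_rat \<beta>) q)"
  by (simp add: fun_eq_iff euler_shift_def)

lemma euler_shift_commute: "euler_shift f \<beta> (euler_shift f \<gamma> q) = euler_shift f \<gamma> (euler_shift f \<beta> q)"
  by (simp add: euler_shift_def gm_tau_add gm_dtau_add gm_scale_add gm_tau_scale gm_dtau_scale gm_scale_scale mult.commute add_ac)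

lemma euler_shift_V0: "euler_shift f \<beta> \<in> weyl_V0 f"
proof -
  have "(\<lambda>q. (gm_tau \<circ> gm_dtau f) q + gm_scale (of_rat \<beta>) q) \<in> weyl_V0 f"
    by (intro weyl_V0.add weyl_V0.euler weyl_V0.const)
  then show ?thesis by (simp add: euler_shift_def[abs_def])
qed

lemma euler_shift_tau_forms: "p \<in> tau_forms k \<Longrightarrow> euler_shift f \<beta> p \<in> tau_forms k"
  by (simp add: euler_shift_def tau_forms_add tau_forms_scale tau_forms_tau tau_forms_dtau)

lemma euler_shift_funpow_tau_forms: "p \<in> tau_forms k \<Longrightarrow> (euler_shift f \<beta> ^^ N) p \<in> tau_forms k"
  by (induction N) (simp_all add: euler_shift_tau_forms)

text \<open>The defining conditions with the finite set \<open>A\<close> made explicit, so that one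
  can speak of the discrete set of possible jumps.\<close>

locale mk_filtration =
  fixes f :: "'n::{finite,linorder} laurent" and V :: "rat \<Rightarrow> 'n tau_form set set" and A :: "rat set"
  assumes V_mono: "mono V" and exhaustive: "(\<Union>\<beta>. V \<beta>) = gauss_manin f"
    and finite_A: "finite A"
    and V_jump: "\<And>\<beta>. V \<beta> = \<Union>{V (\<alpha> + of_int k) | \<alpha> k. \<alpha> \<in> A \<and> \<alpha> + of_int k \<le> \<beta>}"
    and good: "\<And>\<alpha>. \<alpha> \<in> A \<Longrightarrow> good_filtration f (\<lambda>k. V (\<alpha> + of_int k))"
    and nilpotent: "\<And>\<beta>. \<exists>N::nat. \<forall>p\<in>tau_forms CARD('n). gm_class f p \<in> V \<beta> \<longrightarrow>
        gm_class f ((euler_shift f \<beta> ^^ N) p) \<in> (\<Union>\<gamma>\<in>{..<\<beta>}. V \<gamma>)"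
begin

abbreviation mem :: "'n tau_form \<Rightarrow> rat \<Rightarrow> bool" where
  "mem p \<beta> \<equiv> gm_class f p \<in> V \<beta>"

definition jumps :: "rat set" where
  "jumps = {\<alpha> + of_int k | \<alpha> k. \<alpha> \<in> A}"

lemma mem_mono: "mem p \<beta> \<Longrightarrow> \<beta> \<le> \<gamma> \<Longrightarrow> mem p \<gamma>"
  using V_mono by (auto simp: mono_def)

lemma mem_jump: assumes "mem p \<beta>" obtains \<alpha> k where "\<alpha> \<in> A" "\<alpha> + of_int k \<le> \<beta>" "mem p (\<alpha> + of_int k)"
  using assms V_jump[of \<beta>] by blast

text \<open>Descents in the index terminate by induction on the number of jumps in such an
  interval.\<close>

lemma finite_jumps: "finite {\<delta> \<in> jumps. c < \<delta> \<and> \<delta> \<le> d}"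
proof -
  have "{\<delta> \<in> jumps. c < \<delta> \<and> \<delta> \<le> d} \<subseteq> (\<Union>\<alpha>\<in>A. (\<lambda>k. \<alpha> + of_int k) ` {\<lfloor>c - \<alpha>\<rfloor>..\<lceil>d - \<alpha>\<rceil>})"
  proof
    fix \<delta> assume "\<delta> \<in> {\<delta> \<in> jumps. c < \<delta> \<and> \<delta> \<le> d}"
    then obtain \<alpha> k where a: "\<alpha> \<in> A" "\<delta> = \<alpha> + of_int k" "c < \<alpha> + of_int k" "\<alpha> + of_int k \<le> d" by (auto simp: jumps_def)
    then have "\<lfloor>c - \<alpha>\<rfloor> \<le> k" "k \<le> \<lceil>d - \<alpha>\<rceil>" by linarith+
    then show "\<delta> \<in> (\<Union>\<alpha>\<in>A. (\<lambda>k. \<alpha> + of_int k) ` {\<lfloor>c - \<alpha>\<rfloor>..\<lceil>d - \<alpha>\<rceil>})"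
      using a by (intro UN_I[of \<alpha>] image_eqI[of _ _ k]) auto
  qed
  then show ?thesis by (rule finite_subset) (simp add: finite_A)
qed

lemma mem_add: assumes "mem p \<beta>" "mem q \<beta>" shows "mem (p + q) \<beta>"
proof -
  obtain \<alpha> k where a: "\<alpha> \<in> A" "\<alpha> + of_int k \<le> \<beta>" "mem p (\<alpha> + of_int k)" by (rule mem_jump[OF assms(1)])
  obtain \<alpha>' k' where a': "\<alpha>' \<in> A" "\<alpha>' + of_int k' \<le> \<beta>" "mem q (\<alpha>' + of_int k')" by (rule mem_jump[OF assms(2)])
  have *: "mem (p + q) \<beta>" if "\<alpha> \<in> A" "\<alpha> + of_int k \<le> \<beta>" "mem p (\<alpha> + of_int k)" "mem q (\<alpha> + of_int k)" for \<alpha> k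
    using good_filtration_add[OF good[OF that(1)] that(3,4)] that(2) mem_mono by blast
  show ?thesis
  proof (cases "\<alpha> + of_int k \<le> \<alpha>' + of_int k'")
    case True
    then show ?thesis using *[OF a'(1,2)] a(3) a'(3) mem_mono by blast
  next
    case False
    then have "\<alpha>' + of_int k' \<le> \<alpha> + of_int k" by simp
    then show ?thesis using *[OF a(1,2)] a(3) a'(3) mem_mono by blast
  qed
qed

lemma mem_weyl: assumes "mem p \<beta>" "R \<in> weyl_V f i" shows "mem (R p) (\<beta> + of_int i)"
proof -
  obtain \<alpha> k where a: "\<alpha> \<in> A" "\<alpha> + of_int k \<le> \<beta>" "mem p (\<alpha> + of_int k)" by (rule mem_jump[OF assms(1)])
  have "mem (R p) (\<alpha> + of_int (k + i))" by (rule good_filtration_weyl[OF good[OF a(1)] a(3) assms(2)])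
  then show ?thesis by (rule mem_mono) (use a(2) in simp)
qed

lemma mem_weyl_V0: "mem p \<beta> \<Longrightarrow> R \<in> weyl_V0 f \<Longrightarrow> mem (R p) \<beta>"
  using mem_weyl[of p \<beta> R 0] weyl_V0_in_V[of R f] by simp

lemma mem_exhaustive: "p \<in> tau_forms CARD('n) \<Longrightarrow> \<exists>\<beta>. mem p \<beta>"
proof -
  assume "p \<in> tau_forms CARD('n)"
  then have "gm_class f p \<in> (\<Union>\<beta>. V \<beta>)" unfolding exhaustive gauss_manin_def by blast
  then show ?thesis by blast
qed

text \<open>Products of the commuting operators \<open>\<tau>\<partial>\<^sub>\<tau> + d\<close> with \<open>d \<le> \<beta>\<close> push \<open>V\<^sub>\<beta>\<close> arbitrarily far down.\<close>

lemma descend: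
  assumes "p \<in> tau_forms CARD('n)" "mem p \<beta>"
  shows "\<exists>ds. (\<forall>d\<in>set ds. d \<le> \<beta>) \<and> mem (fold (euler_shift f) ds p) c"
  using assms
proof (induction "card {\<delta> \<in> jumps. c < \<delta> \<and> \<delta> \<le> \<beta>}" arbitrary: p \<beta> rule: less_induct)
  case less
  obtain \<alpha> k where a: "\<alpha> \<in> A" "\<alpha> + of_int k \<le> \<beta>" "mem p (\<alpha> + of_int k)" by (rule mem_jump[OF less.prems(2)])
  define \<delta> where "\<delta> = \<alpha> + of_int k"
  have d: "\<delta> \<in> jumps" "\<delta> \<le> \<beta>" "mem p \<delta>" using a by (auto simp: \<delta>_def jumps_def)
  show ?case
  proof (cases "\<delta> \<le> c")
    case True
    then show ?thesis using mem_mono[OF d(3)] by (intro exI[of _ "[]"]) simp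
  next
    case False
    obtain N where "mem p \<delta> \<longrightarrow> gm_class f ((euler_shift f \<delta> ^^ N) p) \<in> (\<Union>\<gamma>\<in>{..<\<delta>}. V \<gamma>)"
      using nilpotent[of \<delta>] less.prems(1) by blast
    then obtain \<gamma> where g: "\<gamma> < \<delta>" "mem ((euler_shift f \<delta> ^^ N) p) \<gamma>" using d(3) by auto
    have "card {\<delta> \<in> jumps. c < \<delta> \<and> \<delta> \<le> \<gamma>} < card {\<delta> \<in> jumps. c < \<delta> \<and> \<delta> \<le> \<beta>}"
    proof (rule psubset_card_mono[OF finite_jumps])
      have "\<delta> \<in> {\<delta> \<in> jumps. c < \<delta> \<and> \<delta> \<le> \<beta>}" "\<delta> \<notin> {\<delta> \<in> jumps. c < \<delta> \<and> \<delta> \<le> \<gamma>}" using d False g(1) by auto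
      moreover have "{\<delta> \<in> jumps. c < \<delta> \<and> \<delta> \<le> \<gamma>} \<subseteq> {\<delta> \<in> jumps. c < \<delta> \<and> \<delta> \<le> \<beta>}" using d(2) g(1) by auto
      ultimately show "{\<delta> \<in> jumps. c < \<delta> \<and> \<delta> \<le> \<gamma>} \<subset> {\<delta> \<in> jumps. c < \<delta> \<and> \<delta> \<le> \<beta>}" by blast
    qed
    from less.hyps[OF this euler_shift_funpow_tau_forms[OF less.prems(1)] g(2)]
    obtain ds where ds: "\<forall>d\<in>set ds. d \<le> \<gamma>" "mem (fold (euler_shift f) ds ((euler_shift f \<delta> ^^ N) p)) c" by blast
    have "fold (euler_shift f) (replicate N \<delta> @ ds) p = fold (euler_shift f) ds ((euler_shift f \<delta> ^^ N) p)"
      by (simp add: fold_replicate)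
    then show ?thesis using ds d(2) g(1) by (intro exI[of _ "replicate N \<delta> @ ds"]) (auto simp: set_replicate_conv_if)
  qed
qed

end

lemma mk_filtrationI:
  assumes "is_MK_filtration f V" shows "\<exists>A. mk_filtration f V A"
proof -
  from assms[unfolded is_MK_filtration_def, folded euler_shift_eq] obtain A where "mono V" "(\<Union>\<beta>. V \<beta>) = gauss_manin f" "finite A"
    "\<forall>\<beta>. V \<beta> = \<Union>{V (\<alpha> + of_int k) | \<alpha> k. \<alpha> \<in> A \<and> \<alpha> + of_int k \<le> \<beta>}"
    "\<forall>\<alpha>\<in>A. good_filtration f (\<lambda>k. V (\<alpha> + of_int k))"
    "\<forall>\<beta>. \<exists>N::nat. \<forall>p\<in>tau_forms CARD('a). gm_class f p \<in> V \<beta> \<longrightarrow>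
        gm_class f ((euler_shift f \<beta> ^^ N) p) \<in> (\<Union>\<gamma>\<in>{..<\<beta>}. V \<gamma>)"
    by (elim conjE exE) (rule that)
  then have "mk_filtration f V A" by (intro mk_filtration.intro) (assumption | erule spec | erule (1) bspec)+
  then show ?thesis by blast
qed

text \<open>Since \<open>\<tau>\<partial>\<^sub>\<tau> + \<delta>\<close> and \<open>\<tau>\<partial>\<^sub>\<tau> + d\<close> differ by a nonzero scalar for \<open>d \<noteq> \<delta>\<close>, only \<open>0\<close> is annihilated
  by a power of the former and a product of the latter.\<close>

lemma coprime_shifts:
  assumes W: "\<And>p q. p \<in> W \<Longrightarrow> q \<in> W \<Longrightarrow> p + q \<in> W" "\<And>c p. p \<in> W \<Longrightarrow> gm_scale c p \<in> W"
      "\<And>p \<beta>. p \<in> W \<Longrightarrow> euler_shift f \<beta> p \<in> W"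
    and N: "(euler_shift f \<delta> ^^ N) q \<in> W" and ds: "\<forall>d\<in>set ds. d \<noteq> \<delta>" "fold (euler_shift f) ds q \<in> W"
  shows "q \<in> W"
  using N ds
proof (induction ds arbitrary: q)
  case Nil
  then show ?case by simp
next
  case (Cons d ds)
  have comm: "(euler_shift f \<delta> ^^ N) (euler_shift f d q) = euler_shift f d ((euler_shift f \<delta> ^^ N) q)" for N q
    by (induction N) (simp_all add: euler_shift_commute[of f d])
  have "euler_shift f d q \<in> W"
  proof (rule Cons.IH)
    show "(euler_shift f \<delta> ^^ N) (euler_shift f d q) \<in> W" unfolding comm by (rule W(3)[OF Cons.prems(1)])
  qed (use Cons.prems in auto)
  with Cons.prems(1) show ?case
  proof (induction N arbitrary: q)
    case 0
    then show ?case by simp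
  next
    case (Suc N)
    have 1: "euler_shift f \<delta> q \<in> W"
    proof (rule Suc.IH)
      show "(euler_shift f \<delta> ^^ N) (euler_shift f \<delta> q) \<in> W" using Suc.prems(1) by (simp add: funpow_swap1)
      show "euler_shift f d (euler_shift f \<delta> q) \<in> W"
        unfolding euler_shift_commute[of f d] by (rule W(3)[OF Suc.prems(2)])
    qed
    \<comment> \<open>The two commuting operators differ by the scalar c = \<delta> - d, a Bezout
      identity that recovers q from its two images.\<close>
    define c where "c = (of_rat \<delta> - of_rat d :: complex)"
    have c0: "c \<noteq> 0" using Cons.prems(2) by (simp add: c_def)
    have "gm_scale (of_rat \<delta>) q = gm_scale c q + gm_scale (of_rat d) q"
      unfolding gm_scale_plus[symmetric] by (simp add: c_def)
    then have "gm_scale c q = euler_shift f \<delta> q + gm_scale (-1) (euler_shift f d q)"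
      by (simp add: euler_shift_def gm_scale_minus_1)
    then have "gm_scale c q \<in> W" using W(1)[OF 1 W(2)[OF Suc.prems(2)]] by simp
    from W(2)[OF this, of "inverse c"] show ?case using c0 by (simp add: gm_scale_scale)
  qed
qed

text \<open>For each class of indices V is generated by finitely many elements. Each of them lies in
  some step of V', and operators of degree i raise the index by i in both filtrations, so one shift
  serves all indices.\<close>

lemma mk_filtration_shift:
  assumes "mk_filtration f V A" "mk_filtration f V' A'"
  obtains c where "\<And>\<beta>. V \<beta> \<subseteq> V' (\<beta> + c)"
proof -
  interpret V: mk_filtration f V A by fact
  interpret V': mk_filtration f V' A' by fact
  have "\<exists>c. \<forall>k. V (\<alpha> + of_int k) \<subseteq> V' (\<alpha> + of_int k + c)" if a: "\<alpha> \<in> A" for \<alpha>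
  proof -
    obtain r m l where m: "\<And>j. j < r \<Longrightarrow> m j \<in> tau_forms CARD('a)"
      and U: "\<And>k. V (\<alpha> + of_int k) = {gm_class f (\<Sum>j<(r::nat). P j (m j)) | P. \<forall>j<r. P j \<in> weyl_V f (k - l j)}"
      by (rule good_filtrationE[OF V.good[OF a]]) blast
    have "\<forall>j. \<exists>\<gamma>. j < r \<longrightarrow> V'.mem (m j) \<gamma>" using V'.mem_exhaustive m by blast
    then obtain \<gamma> where g: "\<And>j. j < r \<Longrightarrow> V'.mem (m j) (\<gamma> j)" by metis
    obtain c0 where c0: "\<And>j. j < r \<Longrightarrow> \<gamma> j - of_int (l j) - \<alpha> \<le> c0"
    proof
      show "\<gamma> j - of_int (l j) - \<alpha> \<le> Max (insert 0 ((\<lambda>j. \<gamma> j - of_int (l j) - \<alpha>) ` {..<r}))" if "j < r" for j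
        using that by (intro Max_ge) auto
    qed
    obtain c1 where c1: "V'.mem 0 c1" using V'.mem_exhaustive[OF tau_forms_0] by blast
    have "V (\<alpha> + of_int k) \<subseteq> V' (\<alpha> + of_int k + c0)" for k
    proof
      fix x assume "x \<in> V (\<alpha> + of_int k)"
      then obtain P where P: "x = gm_class f (\<Sum>j<r. P j (m j))" "\<forall>j<r. P j \<in> weyl_V f (k - l j)"
        unfolding U by blast
      have 1: "V'.mem (P j (m j)) (\<alpha> + of_int k + c0)" if "j < r" for j
      proof (rule V'.mem_mono)
        show "V'.mem (P j (m j)) (\<gamma> j + of_int (k - l j))" by (rule V'.mem_weyl[OF g[OF that]]) (use P(2) that in blast)
        show "\<gamma> j + of_int (k - l j) \<le> \<alpha> + of_int k + c0" using c0[OF that] by simp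
      qed
      have 0: "V'.mem 0 \<beta>" for \<beta>
      proof -
        obtain \<alpha>' where "\<alpha>' \<in> A'" by (rule V'.mem_jump[OF c1])
        then have "V'.mem 0 (\<alpha>' + of_int \<lfloor>\<beta> - \<alpha>'\<rfloor>)" using good_filtration_zero[OF V'.good] by blast
        then show ?thesis by (rule V'.mem_mono) linarith
      qed
      have "V'.mem (\<Sum>j\<in>S. P j (m j)) (\<alpha> + of_int k + c0)" if "S \<subseteq> {..<r}" for S
        using finite_subset[OF that finite_lessThan] that
        by (induction S rule: finite_induct) (auto intro!: V'.mem_add 1 0)
      then show "x \<in> V' (\<alpha> + of_int k + c0)" using P(1) by blast
    qed
    then show ?thesis by blast
  qed
  then obtain c where c: "\<And>\<alpha> k. \<alpha> \<in> A \<Longrightarrow> V (\<alpha> + of_int k) \<subseteq> V' (\<alpha> + of_int k + c \<alpha>)" by metis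
  show thesis
  proof (rule that[of "Max (insert 0 (c ` A))"], rule subsetI)
    fix \<beta> x assume "x \<in> V \<beta>"
    then obtain \<alpha> k where a: "\<alpha> \<in> A" "\<alpha> + of_int k \<le> \<beta>" "x \<in> V (\<alpha> + of_int k)" using V.V_jump[of \<beta>] by blast
    have "c \<alpha> \<le> Max (insert 0 (c ` A))" using a(1) V.finite_A by (intro Max_ge) auto
    then have "\<alpha> + of_int k + c \<alpha> \<le> \<beta> + Max (insert 0 (c ` A))" using a(2) by linarith
    then show "x \<in> V' (\<beta> + Max (insert 0 (c ` A)))"
      using c[OF a(1), of k] a(3) V'.V_mono unfolding mono_def by blast
  qed
qed

text \<open>Let p in V at \<beta> have V'-index \<delta> > \<beta>. A power of
  \<open>euler_shift f \<delta>\<close> lowers its V'-index, and a product of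
  \<open>euler_shift f d\<close> with d \<le> \<beta> pushes p so far down in V that the comparison
  up to a shift puts the result into V' at \<beta>. All d differ from \<delta>, so
  \<open>coprime_shifts\<close> lowers the V'-index of p itself, and fewer jumps remain above
  \<beta>.\<close>

lemma mk_filtration_le:
  assumes "mk_filtration f V A" "mk_filtration f V' A'"
  shows "V \<beta> \<subseteq> V' \<beta>"
proof
  interpret V: mk_filtration f V A by fact
  interpret V': mk_filtration f V' A' by fact
  obtain c where c: "\<And>\<beta>. V \<beta> \<subseteq> V' (\<beta> + c)" using mk_filtration_shift[OF assms] by blast
  have main: "V'.mem p \<beta>" if pW: "p \<in> tau_forms CARD('a)" and pV: "V.mem p \<beta>" and pV': "V'.mem p \<gamma>" for p \<gamma>
    using pV'
  proof (induction "card {\<delta> \<in> V'.jumps. \<beta> < \<delta> \<and> \<delta> \<le> \<gamma>}" arbitrary: \<gamma> rule: less_induct)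
    case less
    obtain \<alpha> k where a: "\<alpha> \<in> A'" "\<alpha> + of_int k \<le> \<gamma>" "V'.mem p (\<alpha> + of_int k)" by (rule V'.mem_jump[OF less.prems])
    define \<delta> where "\<delta> = \<alpha> + of_int k"
    have d: "\<delta> \<in> V'.jumps" "\<delta> \<le> \<gamma>" "V'.mem p \<delta>" using a by (auto simp: \<delta>_def V'.jumps_def)
    show ?case
    proof (cases "\<delta> \<le> \<beta>")
      case True
      then show ?thesis using V'.mem_mono[OF d(3)] by blast
    next
      case False
      define W where "W = {q. \<exists>\<gamma><\<delta>. V'.mem q \<gamma>}"
      obtain N where "V'.mem p \<delta> \<longrightarrow> gm_class f ((euler_shift f \<delta> ^^ N) p) \<in> (\<Union>\<gamma>\<in>{..<\<delta>}. V' \<gamma>)"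
        using V'.nilpotent[of \<delta>] pW by blast
      then have N: "(euler_shift f \<delta> ^^ N) p \<in> W" using d(3) by (auto simp: W_def)
      \<comment> \<open>Descending to \<beta> - c instead of \<beta> pays for the shift c between V
        and V'.\<close>
      obtain ds where ds: "\<forall>d\<in>set ds. d \<le> \<beta>" "V.mem (fold (euler_shift f) ds p) (\<beta> - c)"
        using V.descend[OF pW pV] by blast
      have "V'.mem (fold (euler_shift f) ds p) \<beta>" using ds(2) c[of "\<beta> - c"] by auto
      then have 2: "fold (euler_shift f) ds p \<in> W" using False unfolding W_def by (intro CollectI exI[of _ \<beta>]) simp
      have "p \<in> W"
      proof (rule coprime_shifts[where W = W and f = f and \<delta> = \<delta> and N = N and ds = ds, OF _ _ _ N _ 2])
        fix q q' assume "q \<in> W" "q' \<in> W"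
        then obtain g g' where g: "g < \<delta>" "V'.mem q g" "g' < \<delta>" "V'.mem q' g'" by (auto simp: W_def)
        then have "V'.mem (q + q') (max g g')" by (intro V'.mem_add) (auto intro: V'.mem_mono)
        then show "q + q' \<in> W" using g unfolding W_def by (intro CollectI exI[of _ "max g g'"]) simp
      next
        show "gm_scale x q \<in> W" if "q \<in> W" for x q
          using that V'.mem_weyl_V0[OF _ weyl_V0.const] unfolding W_def by blast
        show "euler_shift f b q \<in> W" if "q \<in> W" for b q
          using that V'.mem_weyl_V0[OF _ euler_shift_V0] unfolding W_def by blast
        show "\<forall>d\<in>set ds. d \<noteq> \<delta>" using ds(1) False by auto
      qed
      then obtain g where g: "g < \<delta>" "V'.mem p g" by (auto simp: W_def)
      have "card {\<delta> \<in> V'.jumps. \<beta> < \<delta> \<and> \<delta> \<le> g} < card {\<delta> \<in> V'.jumps. \<beta> < \<delta> \<and> \<delta> \<le> \<gamma>}"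
      proof (rule psubset_card_mono[OF V'.finite_jumps])
        have "\<delta> \<in> {\<delta> \<in> V'.jumps. \<beta> < \<delta> \<and> \<delta> \<le> \<gamma>}" "\<delta> \<notin> {\<delta> \<in> V'.jumps. \<beta> < \<delta> \<and> \<delta> \<le> g}" using d False g(1) by auto
        moreover have "{\<delta> \<in> V'.jumps. \<beta> < \<delta> \<and> \<delta> \<le> g} \<subseteq> {\<delta> \<in> V'.jumps. \<beta> < \<delta> \<and> \<delta> \<le> \<gamma>}" using d(2) g(1) by auto
        ultimately show "{\<delta> \<in> V'.jumps. \<beta> < \<delta> \<and> \<delta> \<le> g} \<subset> {\<delta> \<in> V'.jumps. \<beta> < \<delta> \<and> \<delta> \<le> \<gamma>}" by blast
      qed
      then show ?thesis using less.hyps g(2) by blast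
    qed
  qed
  fix x assume x: "x \<in> V \<beta>"
  then have "x \<in> gauss_manin f" using V.exhaustive by blast
  then obtain p where p: "p \<in> tau_forms CARD('a)" "x = gm_class f p" by (auto simp: gauss_manin_def)
  obtain \<gamma> where "V'.mem p \<gamma>" using V'.mem_exhaustive[OF p(1)] by blast
  then show "x \<in> V' \<beta>" using main p x by blast
qed

theorem MK_filtration_eq:
  assumes "is_MK_filtration f V" shows "MK_filtration f = V"
  unfolding MK_filtration_def
proof (rule the_equality)
  show "is_MK_filtration f V" by (rule assms)
  fix V' assume "is_MK_filtration f V'"
  then obtain A A' where "mk_filtration f V A" "mk_filtration f V' A'" using assms mk_filtrationI by metis
  then show "V' = V" using mk_filtration_le by (intro ext equalityI) blast+
qed

section \<open>The Newton filtration on the Gauss-Manin system\<close>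

definition top_coeff :: "'n::finite tau_form \<Rightarrow> int \<Rightarrow> 'n laurent" where
  "top_coeff p m = plookup p m $ UNIV"

definition vol_tau :: "'n::finite laurent \<Rightarrow> int \<Rightarrow> 'n tau_form" where
  "vol_tau g m = psingle m (g *s vol_form)"

lemma vol_form_nth: "vol_form $ I = (if I = UNIV then 1 else 0)"
  by (simp add: vol_form_def axis_def)

lemma top_coeff_vol_tau: "top_coeff (vol_tau g m) k = (if k = m then g else 0)"
  by (auto simp: top_coeff_def vol_tau_def lookup_single when_def vol_form_def)

lemma top_form_eq:
  fixes \<omega> :: "'n::finite form"
  shows "\<omega> \<in> k_forms CARD('n) \<Longrightarrow> \<omega> = (\<omega> $ UNIV) *s vol_form"
proof -
  assume "\<omega> \<in> k_forms CARD('n)"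
  then have "\<omega> $ I = 0" if "I \<noteq> UNIV" for I
    using that card_eq_UNIV_imp_eq_UNIV[of I] by (auto simp: k_forms_def)
  then show ?thesis by (simp add: vec_eq_iff vol_form_nth)
qed

lemma vol_tau_tau_forms:
  fixes g :: "'n::finite laurent"
  shows "vol_tau g m \<in> tau_forms CARD('n)"
proof -
  have "(g *s vol_form) $ I = 0" if "card I \<noteq> CARD('n)" for I :: "'n set"
    using that by (auto simp: vol_form_nth)
  then show ?thesis by (auto simp: vol_tau_def tau_forms_def k_forms_def lookup_single when_def)
qed

lemma tau_forms_eqI:
  fixes p q :: "'n::finite tau_form"
  assumes "p \<in> tau_forms CARD('n)" "q \<in> tau_forms CARD('n)" "\<And>m. top_coeff p m = top_coeff q m"
  shows "p = q"
proof (rule poly_mapping_eqI)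
  fix m
  have "plookup p m = top_coeff p m *s vol_form" "plookup q m = top_coeff q m *s vol_form"
    using assms(1,2) top_form_eq unfolding top_coeff_def tau_forms_def by blast+
  then show "plookup p m = plookup q m" using assms(3) by simp
qed

lemma top_coeff_add: "top_coeff (p + q) m = top_coeff p m + top_coeff q m"
  and top_coeff_diff: "top_coeff (p - q) m = top_coeff p m - top_coeff q m"
  and top_coeff_0 [simp]: "top_coeff 0 m = 0"
  and top_coeff_tau: "top_coeff (gm_tau p) m = top_coeff p (m - 1)"
  and top_coeff_dtau: "top_coeff (gm_dtau f p) m = of_int (m + 1) * top_coeff p (m + 1) - f * top_coeff p m"
  and top_coeff_scale: "top_coeff (gm_scale c p) m = psingle 0 c * top_coeff p m"
  unfolding top_coeff_def lookup_gm by (simp_all add: distrib_right)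

lemma top_coeff_sum: "top_coeff (sum p A) m = (\<Sum>x\<in>A. top_coeff (p x) m)"
  by (induction A rule: infinite_finite_induct) (simp_all add: top_coeff_add)

lemma tau_forms_vol_expansion:
  fixes p :: "'n::finite tau_form"
  assumes "p \<in> tau_forms CARD('n)"
  shows "p = (\<Sum>m\<in>pkeys p. \<Sum>a\<in>pkeys (top_coeff p m). vol_tau (psingle a (plookup (top_coeff p m) a)) m)"
proof (rule tau_forms_eqI[OF assms])
  show "(\<Sum>m\<in>pkeys p. \<Sum>a\<in>pkeys (top_coeff p m). vol_tau (psingle a (plookup (top_coeff p m) a)) m) \<in> tau_forms CARD('n)"
    by (intro tau_forms_sum vol_tau_tau_forms)
  fix k
  have "top_coeff (\<Sum>m\<in>pkeys p. \<Sum>a\<in>pkeys (top_coeff p m). vol_tau (psingle a (plookup (top_coeff p m) a)) m) k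
     = (\<Sum>m\<in>pkeys p. \<Sum>a\<in>pkeys (top_coeff p m). if k = m then psingle a (plookup (top_coeff p m) a) else 0)"
    by (simp add: top_coeff_sum top_coeff_vol_tau)
  also have "\<dots> = (\<Sum>m\<in>pkeys p. if k = m then top_coeff p m else 0)"
    by (intro sum.cong refl) (simp add: poly_mapping_sum_single[symmetric])
  also have "\<dots> = top_coeff p k" by (simp add: top_coeff_def in_keys_iff)
  finally show "top_coeff p k = top_coeff (\<Sum>m\<in>pkeys p. \<Sum>a\<in>pkeys (top_coeff p m). vol_tau (psingle a (plookup (top_coeff p m) a)) m) k" by simp
qed

text \<open>On forms \<tau> is invertible, although its inverse does not belong to the Weyl algebra.
  This reduces the lower steps of the Newton filtration to a single one.\<close>

definition tau_inverse :: "'n::finite tau_form \<Rightarrow> 'n tau_form" where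
  "tau_inverse p = Poly_Mapping.map_key (\<lambda>m. m + 1) p"

lemma lookup_tau_inverse: "plookup (tau_inverse p) m = plookup p (m + 1)"
  by (simp add: tau_inverse_def map_key.rep_eq inj_def)

lemma gm_tau_inverse: "gm_tau (tau_inverse p) = p"
  by (rule poly_mapping_eqI) (simp add: lookup_gm_tau lookup_tau_inverse)

text \<open>The \<open>(n-1)\<close>-form whose contraction data are the \<open>h i\<close>; the signs are chosen so that
  both differentials become plain sums over \<open>i\<close>.\<close>

definition coprincipal_form :: "('n::{finite,linorder} \<Rightarrow> 'n laurent) \<Rightarrow> 'n form" where
  "coprincipal_form h = (\<chi> J. \<Sum>i\<in>UNIV. if J = UNIV - {i} then koszul_sign i UNIV * h i else 0)"

lemma coprincipal_form_nth: "coprincipal_form h $ (UNIV - {j}) = koszul_sign j UNIV * h j"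
proof -
  have "UNIV - {j} = UNIV - {i} \<longleftrightarrow> i = j" for i :: 'a by blast
  then show ?thesis by (simp add: coprincipal_form_def)
qed

lemma coprincipal_form_k_forms:
  fixes h :: "'n::{finite,linorder} \<Rightarrow> 'n laurent"
  shows "coprincipal_form h \<in> k_forms (CARD('n) - 1)"
proof -
  have "card (UNIV - {i}) = CARD('n) - 1" for i :: 'n by simp
  then show ?thesis unfolding k_forms_def coprincipal_form_def by (auto intro!: sum.neutral)
qed

lemma koszul_coprincipal_form:
  assumes "\<And>i. Modules.additive (T i)"
  shows "koszul T (coprincipal_form h) = (\<Sum>i\<in>UNIV. T i (h i)) *s vol_form"
proof -
  have "koszul T (coprincipal_form h) \<in> k_forms (Suc (CARD('a) - 1))"
    using coprincipal_form_k_forms Modules.additive.zero[OF assms] by (intro koszul_k_forms) auto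
  then have "koszul T (coprincipal_form h) = (koszul T (coprincipal_form h) $ UNIV) *s vol_form"
    using top_form_eq by simp
  also have "koszul T (coprincipal_form h) $ UNIV = (\<Sum>i\<in>UNIV. T i (h i))"
    by (simp add: koszul_def coprincipal_form_nth additive_koszul_sign[OF assms])
  finally show ?thesis .
qed

text \<open>The working form of the relations: a multiple of df at \<tau>^(m+1) is traded for a
  derivative at \<tau>^m. If the \<open>h i\<close> have order at most one less than the bound for
  the multiple, the trade keeps the bound, because lowering the power of \<tau> costs exactly
  1.\<close>

lemma gm_relation_vol:
  fixes f :: "'n::{finite,linorder} laurent"
  shows "vol_tau (\<Sum>i\<in>UNIV. log_deriv i (h i)) m - vol_tau (\<Sum>i\<in>UNIV. log_deriv i f * h i) (m + 1) \<in> gm_relations f"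
proof -
  have e: "ext_deriv (coprincipal_form h) = (\<Sum>i\<in>UNIV. log_deriv i (h i)) *s vol_form"
    unfolding ext_deriv_eq_koszul by (rule koszul_coprincipal_form) (rule additive_log_deriv)
  have d: "df_wedge f (coprincipal_form h) = (\<Sum>i\<in>UNIV. log_deriv i f * h i) *s vol_form"
    by (rule koszul_coprincipal_form) (rule additive_mult)
  have "twisted_d f (psingle m (coprincipal_form h)) =
    vol_tau (\<Sum>i\<in>UNIV. log_deriv i (h i)) m - vol_tau (\<Sum>i\<in>UNIV. log_deriv i f * h i) (m + 1)"
    by (rule poly_mapping_eqI) (auto simp: lookup_gm lookup_single when_def vol_tau_def e d)
  moreover have "psingle m (coprincipal_form h) \<in> tau_forms (CARD('n) - 1)"
    using coprincipal_form_k_forms[of h] k_forms_0 by (auto simp: tau_forms_def lookup_single when_def)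
  ultimately show ?thesis unfolding gm_relations_def by (metis imageI)
qed

section \<open>Strictness of the wedge product with df, and the Newton filtration on forms\<close>

context nondegenerate_laurent
begin

lemma newton_le_mono: "S \<le> T \<Longrightarrow> g \<in> newton_le S \<Longrightarrow> g \<in> newton_le T"
  unfolding newton_le_def by fastforce

lemma newton_le_add: "g \<in> newton_le T \<Longrightarrow> h \<in> newton_le T \<Longrightarrow> g + h \<in> newton_le T"
  unfolding newton_le_def using keys_add[of g h] by blast

lemma newton_le_0: "0 \<in> newton_le T"
  by (simp add: newton_le_def)

lemma newton_le_uminus: "g \<in> newton_le T \<Longrightarrow> - g \<in> newton_le T"
  by (simp add: newton_le_def)

lemma newton_le_diff: "g \<in> newton_le T \<Longrightarrow> h \<in> newton_le T \<Longrightarrow> g - h \<in> newton_le T"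
  using newton_le_add[of g T "- h"] newton_le_uminus[of h T] by simp

lemma newton_le_sum: "(\<And>i. i \<in> A \<Longrightarrow> g i \<in> newton_le T) \<Longrightarrow> sum g A \<in> newton_le T"
  by (induction A rule: infinite_finite_induct) (auto simp: newton_le_0 newton_le_add)

lemma newton_le_mult: "g \<in> newton_le S \<Longrightarrow> h \<in> newton_le T \<Longrightarrow> g * h \<in> newton_le (S + T)"
  using keys_mult[of g h] unfolding newton_le_def by (fastforce simp: wt_add intro: add_mono)

lemma newton_le_scal: "g \<in> newton_le T \<Longrightarrow> psingle 0 c * g \<in> newton_le T"
  using newton_le_mult[of "psingle 0 c" 0 g T] by (simp add: newton_le_def wt_0)

lemma newton_le_log_deriv: "g \<in> newton_le T \<Longrightarrow> log_deriv i g \<in> newton_le T"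
  using keys_log_deriv[of i g] unfolding newton_le_def by blast

lemma newton_le_f: "f \<in> newton_le (int M)"
  using wt_key_le by (simp add: newton_le_def)

lemma newton_le_exists: "\<exists>T. g \<in> newton_le T"
proof
  show "g \<in> newton_le (Max (insert 0 ((\<lambda>(\<sigma>, a). wt \<sigma> a) ` (\<Lambda> \<times> pkeys g))))"
    unfolding newton_le_def using finite_facets by (auto intro!: Max_ge)
qed

text \<open>The facet forms are never all negative at an exponent. Here the descending inductions on
  the order come to an end.\<close>

lemma newton_le_neg: assumes "g \<in> newton_le T" "T < 0" shows "g = 0"
proof -
  have "a \<notin> pkeys g" for a
  proof
    assume a: "a \<in> pkeys g"
    then have "wt \<sigma> a \<le> T" if "\<sigma> \<in> \<Lambda>" for \<sigma> using assms(1) that by (auto simp: newton_le_def)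
    then have "a = 0" using assms(2) by (intro wt_nonpos_imp_0) fastforce
    moreover obtain \<sigma> where "\<sigma> \<in> \<Lambda>" using facets_nonempty by blast
    ultimately show False using \<open>\<And>\<sigma>. \<sigma> \<in> \<Lambda> \<Longrightarrow> wt \<sigma> a \<le> T\<close>[of \<sigma>] assms(2) by (simp add: wt_0)
  qed
  then have "pkeys g = {}" by blast
  then show ?thesis by simp
qed

definition newton_form_le :: "int \<Rightarrow> 'n form set" where
  "newton_form_le T = {\<omega>. \<forall>I. \<omega> $ I \<in> newton_le T}"

lemma newton_form_le_exists: "\<exists>T. \<omega> \<in> newton_form_le T"
proof -
  have "\<forall>I. \<exists>T. \<omega> $ I \<in> newton_le T" using newton_le_exists by blast
  then obtain t where t: "\<And>I. \<omega> $ I \<in> newton_le (t I)" by metis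
  have "\<omega> $ I \<in> newton_le (Max (range t))" for I
    by (rule newton_le_mono[OF _ t]) auto
  then show ?thesis unfolding newton_form_le_def by blast
qed

lemma newton_form_graded_exact:
  assumes "\<omega> \<in> newton_form_le T" "\<forall>I. CARD('n) \<le> card I \<longrightarrow> \<omega> $ I = 0"
    "df_wedge f \<omega> \<in> newton_form_le (T + int M - 1)"
  shows "\<exists>\<zeta>. (\<forall>I. CARD('n) \<le> Suc (card I) \<longrightarrow> \<zeta> $ I = 0) \<and> \<omega> - df_wedge f \<zeta> \<in> newton_form_le (T - 1)"
proof (rule newton_graded_exact)
  show "\<omega> $ I \<in> newton_le T" "df_wedge f \<omega> $ I \<in> newton_le (T + int M - 1)" for I
    using assms(1,3) by (simp_all add: newton_form_le_def)
  show "\<omega> $ I = 0" if "CARD('n) \<le> card I" for I using assms(2) that by simp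
  fix \<zeta> assume "\<And>I. CARD('n) \<le> Suc (card I) \<Longrightarrow> \<zeta> $ I = 0" "\<And>I. (\<omega> - df_wedge f \<zeta>) $ I \<in> newton_le (T - 1)"
  then show ?thesis unfolding newton_form_le_def by (intro exI[of _ \<zeta>]) simp
qed

lemma koszul_card_vanish:
  fixes \<zeta> :: "('a::comm_ring_1, 'i::{finite,linorder} set) vec"
  assumes "\<And>i. T i 0 = 0" "\<forall>I. N \<le> Suc (card I) \<longrightarrow> \<zeta> $ I = 0" "N \<le> card J"
  shows "koszul T \<zeta> $ J = 0"
proof -
  have "\<zeta> $ (J - {i}) = 0" if "i \<in> J" for i
    using assms(2,3) that by (simp add: card_Suc_Diff1)
  then show ?thesis by (simp add: koszul_def assms(1))
qed

text \<open>Each correction by the wedge product of df with some \<zeta> lowers the order by 1/M,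
  until it is negative and the remainder vanishes.\<close>

lemma df_wedge_exact:
  assumes "\<forall>I. CARD('n) \<le> card I \<longrightarrow> \<omega> $ I = 0" "df_wedge f \<omega> = 0"
  obtains \<zeta> where "\<forall>I. CARD('n) \<le> Suc (card I) \<longrightarrow> \<zeta> $ I = 0" "\<omega> = df_wedge f \<zeta>"
proof -
  have *: "\<exists>\<zeta>. (\<forall>I. CARD('n) \<le> Suc (card I) \<longrightarrow> \<zeta> $ I = 0) \<and> \<omega> = df_wedge f \<zeta>"
    if "\<omega> \<in> newton_form_le T" "\<forall>I. CARD('n) \<le> card I \<longrightarrow> \<omega> $ I = 0" "df_wedge f \<omega> = 0" for T \<omega>
    using that
  proof (induction "nat (T + 1)" arbitrary: T \<omega> rule: less_induct)
    case less
    show ?case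
    proof (cases "T < 0")
      case True
      then have "\<omega> = 0" using less.prems(1) newton_le_neg by (auto simp: newton_form_le_def vec_eq_iff)
      then show ?thesis by (intro exI[of _ 0]) simp
    next
      case False
      have "df_wedge f \<omega> \<in> newton_form_le (T + int M - 1)" using less.prems(3) newton_le_0 by (simp add: newton_form_le_def)
      then obtain \<zeta> where z: "\<forall>I. CARD('n) \<le> Suc (card I) \<longrightarrow> \<zeta> $ I = 0"
          "\<omega> - df_wedge f \<zeta> \<in> newton_form_le (T - 1)"
        using newton_form_graded_exact[OF less.prems(1,2)] by blast
      have "df_wedge f (\<omega> - df_wedge f \<zeta>) = 0" by (simp add: df_wedge_diff df_wedge_square less.prems(3))
      moreover have "\<forall>I. CARD('n) \<le> card I \<longrightarrow> (\<omega> - df_wedge f \<zeta>) $ I = 0"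
        using less.prems(2) koszul_card_vanish[of "\<lambda>i. (*) (log_deriv i f)", OF mult_zero_right z(1)] by simp
      moreover have "nat (T - 1 + 1) < nat (T + 1)" using False by simp
      ultimately obtain \<zeta>' where z': "\<forall>I. CARD('n) \<le> Suc (card I) \<longrightarrow> \<zeta>' $ I = 0" "\<omega> - df_wedge f \<zeta> = df_wedge f \<zeta>'"
        using less.hyps[of "T - 1" "\<omega> - df_wedge f \<zeta>"] z(2) by blast
      then show ?thesis using z(1)
        by (intro exI[of _ "\<zeta> + \<zeta>'"]) (simp add: df_wedge_add algebra_simps)
    qed
  qed
  obtain T where "\<omega> \<in> newton_form_le T" using newton_form_le_exists by blast
  from *[OF this assms] that show thesis by blast
qed

text \<open>While the level S of a primitive exceeds T - M, its image has order smaller than (S +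
  M)/M; graded exactness then removes the leading part of the primitive by a multiple of df, which
  does not change the image.\<close>

lemma df_wedge_strict:
  assumes "g \<in> newton_le T" "g = (\<Sum>i\<in>UNIV. log_deriv i f * h i)"
  obtains h' where "\<forall>i. h' i \<in> newton_le (T - int M)" "g = (\<Sum>i\<in>UNIV. log_deriv i f * h' i)"
proof -
  have *: "\<exists>\<omega>'\<in>newton_form_le (T - int M). df_wedge f \<omega>' = df_wedge f \<omega>"
    if "\<omega> \<in> newton_form_le S" "\<forall>I. CARD('n) \<le> card I \<longrightarrow> \<omega> $ I = 0" "df_wedge f \<omega> \<in> newton_form_le T" for S \<omega>
    using that
  proof (induction "nat (S - (T - int M))" arbitrary: S \<omega> rule: less_induct)
    case less
    show ?case
    proof (cases "S \<le> T - int M")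
      case True
      then have "\<omega> \<in> newton_form_le (T - int M)" using less.prems(1) newton_le_mono unfolding newton_form_le_def by blast
      then show ?thesis by blast
    next
      case False
      have "df_wedge f \<omega> \<in> newton_form_le (S + int M - 1)"
        using less.prems(3) False newton_le_mono[of T "S + int M - 1"] unfolding newton_form_le_def by simp
      then obtain \<zeta> where z: "\<forall>I. CARD('n) \<le> Suc (card I) \<longrightarrow> \<zeta> $ I = 0"
          "\<omega> - df_wedge f \<zeta> \<in> newton_form_le (S - 1)"
        using newton_form_graded_exact[OF less.prems(1,2)] by blast
      have d: "df_wedge f (\<omega> - df_wedge f \<zeta>) = df_wedge f \<omega>" by (simp add: df_wedge_diff df_wedge_square)
      moreover have "\<forall>I. CARD('n) \<le> card I \<longrightarrow> (\<omega> - df_wedge f \<zeta>) $ I = 0"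
        using less.prems(2) koszul_card_vanish[of "\<lambda>i. (*) (log_deriv i f)", OF mult_zero_right z(1)] by simp
      moreover have "nat (S - 1 - (T - int M)) < nat (S - (T - int M))" using False by simp
      ultimately show ?thesis using less.hyps[of "S - 1" "\<omega> - df_wedge f \<zeta>"] less.prems(3) z(2) by simp
    qed
  qed
  define \<omega> where "\<omega> = coprincipal_form h"
  have d: "df_wedge f \<omega> = g *s vol_form"
    unfolding \<omega>_def assms(2) by (rule koszul_coprincipal_form) (rule additive_mult)
  have "df_wedge f \<omega> \<in> newton_form_le T"
    using assms(1) newton_le_0 unfolding d newton_form_le_def by (simp add: vol_form_nth)
  moreover have "\<forall>I. CARD('n) \<le> card I \<longrightarrow> \<omega> $ I = 0"
  proof (intro allI impI)
    fix I :: "'n set" assume that: "CARD('n) \<le> card I"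
    have "card I \<noteq> CARD('n) - 1" using that zero_less_card_finite[where 'a='n] by linarith
    then show "\<omega> $ I = 0" using coprincipal_form_k_forms[of h] by (simp add: \<omega>_def k_forms_def)
  qed
  moreover obtain S where "\<omega> \<in> newton_form_le S" using newton_form_le_exists by blast
  ultimately obtain \<omega>' where w: "\<omega>' \<in> newton_form_le (T - int M)" "df_wedge f \<omega>' = g *s vol_form"
    using * d by metis
  have "df_wedge f \<omega>' $ UNIV = (\<Sum>i\<in>UNIV. log_deriv i f * (koszul_sign i UNIV * \<omega>' $ (UNIV - {i})))"
    by (simp add: koszul_def mult_ac)
  then have "g = (\<Sum>i\<in>UNIV. log_deriv i f * (koszul_sign i UNIV * \<omega>' $ (UNIV - {i})))"
    unfolding w(2) by (simp add: vol_form_nth)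
  moreover have "koszul_sign i UNIV * \<omega>' $ (UNIV - {i}) \<in> newton_le (T - int M)" for i
    using w(1) by (simp add: newton_form_le_def newton_le_def)
  ultimately show thesis using that[of "\<lambda>i. koszul_sign i UNIV * \<omega>' $ (UNIV - {i})"] by (simp only: simp_thms)
qed

text \<open>The Newton filtration on forms with all powers of \<tau>, where \<tau> has order -1,
  that is level -M. Admitting positive powers makes it induce a filtration of all of G.\<close>

definition newton_tau :: "int \<Rightarrow> 'n tau_form set" where
  "newton_tau T = {p \<in> tau_forms CARD('n). \<forall>m. top_coeff p m \<in> newton_le (T + int M * m)}"

lemma newton_tau_tau_forms: "p \<in> newton_tau T \<Longrightarrow> p \<in> tau_forms CARD('n)"
  by (simp add: newton_tau_def)

lemma newton_tau_mono: "S \<le> T \<Longrightarrow> newton_tau S \<subseteq> newton_tau T"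
  unfolding newton_tau_def by (auto intro: newton_le_mono[rotated])

lemma newton_tau_add: "p \<in> newton_tau T \<Longrightarrow> q \<in> newton_tau T \<Longrightarrow> p + q \<in> newton_tau T"
  by (simp add: newton_tau_def tau_forms_add top_coeff_add newton_le_add)

lemma newton_tau_0: "0 \<in> newton_tau T"
  by (simp add: newton_tau_def tau_forms_0 newton_le_0)

lemma newton_tau_sum: "(\<And>i. i \<in> A \<Longrightarrow> p i \<in> newton_tau T) \<Longrightarrow> sum p A \<in> newton_tau T"
  by (induction A rule: infinite_finite_induct) (auto simp: newton_tau_0 newton_tau_add)

lemma newton_tau_scale: "p \<in> newton_tau T \<Longrightarrow> gm_scale c p \<in> newton_tau T"
  by (simp add: newton_tau_def tau_forms_scale top_coeff_scale newton_le_scal)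

lemma newton_tau_tau: "p \<in> newton_tau T \<Longrightarrow> gm_tau p \<in> newton_tau (T - int M)"
  unfolding newton_tau_def
proof (intro CollectI conjI allI; elim CollectE conjE)
  fix m assume "\<forall>m. top_coeff p m \<in> newton_le (T + int M * m)"
  then have "top_coeff p (m - 1) \<in> newton_le (T + int M * (m - 1))" by blast
  then show "top_coeff (gm_tau p) m \<in> newton_le (T - int M + int M * m)"
    by (simp add: top_coeff_tau algebra_simps)
qed (simp add: tau_forms_tau)

lemma newton_tau_dtau: "p \<in> newton_tau T \<Longrightarrow> gm_dtau f p \<in> newton_tau (T + int M)"
  unfolding newton_tau_def
proof (intro CollectI conjI allI; elim CollectE conjE)
  fix m assume p: "\<forall>m. top_coeff p m \<in> newton_le (T + int M * m)"
  have "psingle 0 (of_int (m + 1)) * top_coeff p (m + 1) \<in> newton_le (T + int M * (m + 1))"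
    using p by (intro newton_le_scal) blast
  moreover have "f * top_coeff p m \<in> newton_le (int M + (T + int M * m))"
    using p by (intro newton_le_mult newton_le_f) blast
  moreover have "T + int M * (m + 1) = T + int M + int M * m" "int M + (T + int M * m) = T + int M + int M * m"
    by (simp_all add: algebra_simps)
  ultimately show "top_coeff (gm_dtau f p) m \<in> newton_le (T + int M + int M * m)"
    unfolding top_coeff_dtau of_int_eq_single by (simp only: newton_le_diff)
qed (simp add: tau_forms_dtau)

lemma newton_tau_tau_inverse: "p \<in> newton_tau T \<Longrightarrow> tau_inverse p \<in> newton_tau (T + int M)"
  unfolding newton_tau_def
proof (intro CollectI conjI allI; elim CollectE conjE)
  assume "p \<in> tau_forms CARD('n)"
  then show "tau_inverse p \<in> tau_forms CARD('n)" by (simp add: tau_forms_def lookup_tau_inverse)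
next
  fix m assume "\<forall>m. top_coeff p m \<in> newton_le (T + int M * m)"
  then have "top_coeff p (m + 1) \<in> newton_le (T + int M * (m + 1))" by blast
  then show "top_coeff (tau_inverse p) m \<in> newton_le (T + int M + int M * m)"
    by (simp add: top_coeff_def lookup_tau_inverse algebra_simps)
qed

lemma newton_tau_weyl_V0: "P \<in> weyl_V0 f \<Longrightarrow> p \<in> newton_tau T \<Longrightarrow> P p \<in> newton_tau T"
proof (induction arbitrary: p rule: weyl_V0.induct)
  case tau
  then show ?case using newton_tau_tau newton_tau_mono[of "T - int M" T] by auto
next
  case euler
  then show ?case using newton_tau_tau[OF newton_tau_dtau] by fastforce
qed (auto simp: newton_tau_scale newton_tau_add)

lemma newton_tau_weyl_V_pos: "P \<in> weyl_V_pos f k \<Longrightarrow> p \<in> newton_tau T \<Longrightarrow> P p \<in> newton_tau (T + int M * int k)"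
proof (induction k arbitrary: P)
  case 0
  then show ?case by (simp add: newton_tau_weyl_V0)
next
  case (Suc k)
  from Suc.prems(1) obtain A B where P: "P = (\<lambda>p. A p + gm_dtau f (B p))" "A \<in> weyl_V_pos f k" "B \<in> weyl_V_pos f k"
    by (rule weyl_V_pos_SucE)
  have "A p \<in> newton_tau (T + int M * int (Suc k))"
    using Suc.IH[OF P(2) Suc.prems(2)] newton_tau_mono[of "T + int M * int k" "T + int M * int (Suc k)"] by (auto simp: algebra_simps)
  moreover have "gm_dtau f (B p) \<in> newton_tau (T + int M * int (Suc k))"
    using newton_tau_dtau[OF Suc.IH[OF P(3) Suc.prems(2)]] by (simp add: algebra_simps)
  ultimately show ?case unfolding P(1) by (rule newton_tau_add)
qed

lemma newton_tau_funpow_tau: "p \<in> newton_tau T \<Longrightarrow> (gm_tau ^^ k) p \<in> newton_tau (T - int M * int k)"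
proof (induction k)
  case (Suc k)
  then show ?case using newton_tau_tau[of "(gm_tau ^^ k) p" "T - int M * int k"] by (simp add: algebra_simps)
qed simp

lemma newton_tau_weyl_V:
  assumes "P \<in> weyl_V f k" "p \<in> newton_tau T" shows "P p \<in> newton_tau (T + int M * k)"
proof (cases "k \<le> 0")
  case True
  then obtain Q where "P = (gm_tau ^^ nat (- k)) \<circ> Q" "Q \<in> weyl_V0 f" using assms(1) by (auto simp: weyl_V_def)
  then show ?thesis
    using newton_tau_funpow_tau[OF newton_tau_weyl_V0[OF _ assms(2)], of Q "nat (- k)"] True by simp
next
  case False
  then show ?thesis using newton_tau_weyl_V_pos[OF _ assms(2), of P "nat k"] assms(1) by (simp add: weyl_V_def)
qed

lemma vol_tau_newton_tau: "g \<in> newton_le (T + int M * m) \<Longrightarrow> vol_tau g m \<in> newton_tau T"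
  by (simp add: newton_tau_def vol_tau_tau_forms top_coeff_vol_tau newton_le_0)

lemma newton_tau_exists:
  assumes "p \<in> tau_forms CARD('n)" shows "\<exists>T. p \<in> newton_tau T"
proof -
  have "\<forall>m. \<exists>T. top_coeff p m \<in> newton_le T" using newton_le_exists by blast
  then obtain t where t: "\<And>m. top_coeff p m \<in> newton_le (t m)" by metis
  define T where "T = Max (insert 0 ((\<lambda>m. t m - int M * m) ` pkeys p))"
  have "top_coeff p m \<in> newton_le (T + int M * m)" for m
  proof (cases "m \<in> pkeys p")
    case True
    then have "t m - int M * m \<le> T" unfolding T_def by (intro Max_ge) auto
    then show ?thesis using newton_le_mono[OF _ t[of m], of "T + int M * m"] by simp
  next
    case False
    then have "top_coeff p m = 0" by (simp add: top_coeff_def in_keys_iff)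
    then show ?thesis by (simp add: newton_le_0)
  qed
  then show ?thesis using assms by (auto simp: newton_tau_def)
qed

end

lemma finite_bounded_int_vec: "finite {a :: (int, 'n::finite) vec. \<forall>i. \<bar>a $ i\<bar> \<le> B}"
proof -
  have "{a :: (int, 'n) vec. \<forall>i. \<bar>a $ i\<bar> \<le> B} \<subseteq> vec_lambda ` (PiE UNIV (\<lambda>_. {-B..B}))"
  proof
    fix a :: "(int, 'n) vec" assume "a \<in> {a. \<forall>i. \<bar>a $ i\<bar> \<le> B}"
    then have "a $ i \<in> {-B..B}" for i by (simp add: abs_le_iff minus_le_iff)
    then have "vec_nth a \<in> PiE UNIV (\<lambda>_. {-B..B})" by auto
    then show "a \<in> vec_lambda ` (PiE UNIV (\<lambda>_. {-B..B}))" by (rule rev_image_eqI) simp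
  qed
  then show ?thesis by (rule finite_subset) (intro finite_imageI finite_PiE; simp)
qed

section \<open>Orders, active facets and nilpotency\<close>

context nondegenerate_laurent
begin

text \<open>Rounding down loses nothing, because all Newton orders lie in (1/M)\<int>.\<close>

definition level :: "rat \<Rightarrow> int" where
  "level \<alpha> = \<lfloor>of_nat M * \<alpha>\<rfloor>"

lemma level_diff: "level (\<alpha> - of_nat k) = level \<alpha> - int M * int k"
proof -
  have "of_nat M * (\<alpha> - of_nat k) = of_nat M * \<alpha> - of_int (int M * int k)"
    by (simp add: right_diff_distrib)
  then show ?thesis unfolding level_def by (simp only: floor_diff_of_int)
qed

lemma level_add_int: "level (\<alpha> + of_int k) = level \<alpha> + int M * k"
proof -
  have "of_nat M * (\<alpha> + of_int k) = of_nat M * \<alpha> + of_int (int M * k)"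
    by (simp add: distrib_left)
  then show ?thesis unfolding level_def by (metis floor_add_int)
qed

lemma level_mono: "\<alpha> \<le> \<beta> \<Longrightarrow> level \<alpha> \<le> level \<beta>"
  unfolding level_def by (intro floor_mono mult_left_mono) auto

lemma level_quotient: "level (of_int T / of_nat M) = T"
  using M(1) by (simp add: level_def)

lemma quotient_level_le: "of_int (level \<alpha>) / of_nat M \<le> \<alpha>"
  using M(1) of_int_floor_le[of "of_nat M * \<alpha>"] by (simp add: level_def divide_le_eq mult.commute)

lemma newton_order_le_iff: "newton_order f g \<le> ereal (real_of_rat \<alpha>) \<longleftrightarrow> g \<in> newton_le (level \<alpha>)"
proof -
  have "facet_form \<sigma> (real_exponent a) \<le> real_of_rat \<alpha> \<longleftrightarrow> wt \<sigma> a \<le> level \<alpha>" if s: "\<sigma> \<in> \<Lambda>" for \<sigma> a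
  proof -
    have "facet_form \<sigma> (real_exponent a) \<le> real_of_rat \<alpha> \<longleftrightarrow> real M * lform \<sigma> a \<le> real M * real_of_rat \<alpha>"
      using M(1) by (simp add: lform_def)
    also have "\<dots> \<longleftrightarrow> real_of_rat (of_int (wt \<sigma> a)) \<le> real_of_rat (of_nat M * \<alpha>)"
      using of_int_wt[OF s, of a] by (simp add: of_rat_mult)
    also have "\<dots> \<longleftrightarrow> wt \<sigma> a \<le> level \<alpha>" by (simp only: of_rat_less_eq level_def le_floor_iff)
    finally show ?thesis .
  qed
  then show ?thesis
    by (auto simp: newton_order_def newton_order_facet_def SUP_le_iff newton_le_def)
qed

lemma newton_theta_forms_eq:
  "newton_theta_forms f \<alpha> = {p \<in> newton_tau (level \<alpha>). \<forall>m>0. plookup p m = 0}"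
proof (intro equalityI subsetI)
  fix p assume "p \<in> newton_theta_forms f \<alpha>"
  then obtain K :: nat and \<omega> where p: "p = (\<Sum>k\<le>K. psingle (- int k) (\<omega> k))" "\<forall>k\<le>K. \<omega> k \<in> newton_forms f (\<alpha> - of_nat k)"
    unfolding newton_theta_forms_def by blast
  have "psingle (- int k) (\<omega> k) \<in> newton_tau (level \<alpha>)" if "k \<le> K" for k
  proof -
    obtain g where g: "\<omega> k = g *s vol_form" "g \<in> newton_le (level (\<alpha> - of_nat k))"
      using p(2) \<open>k \<le> K\<close> unfolding newton_forms_def newton_order_le_iff by blast
    have "vol_tau g (- int k) \<in> newton_tau (level \<alpha>)"
      using g(2) by (intro vol_tau_newton_tau) (simp add: level_diff)
    then show ?thesis by (simp add: vol_tau_def g(1))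
  qed
  then have "p \<in> newton_tau (level \<alpha>)" unfolding p(1) by (intro newton_tau_sum) auto
  moreover have "plookup p m = 0" if "m > 0" for m
    unfolding p(1) lookup_sum using that by (intro sum.neutral) (auto simp: lookup_single when_def)
  ultimately show "p \<in> {p \<in> newton_tau (level \<alpha>). \<forall>m>0. plookup p m = 0}" by blast
next
  fix p assume p: "p \<in> {p \<in> newton_tau (level \<alpha>). \<forall>m>0. plookup p m = 0}"
  define K where "K = nat (Max (insert 0 (uminus ` pkeys p)))"
  have K: "nat (- m) \<le> K" if "m \<in> pkeys p" for m
    unfolding K_def using that by (intro nat_mono Max_ge) auto
  have "p = (\<Sum>k\<le>K. psingle (- int k) (plookup p (- int k)))"
  proof (rule poly_mapping_eqI)
    fix m
    have "plookup (\<Sum>k\<le>K. psingle (- int k) (plookup p (- int k))) m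
        = (\<Sum>k\<le>K. if m \<le> 0 \<and> k = nat (- m) then plookup p m else 0)"
      unfolding lookup_sum by (intro sum.cong) (auto simp: lookup_single when_def)
    also have "\<dots> = (if m \<le> 0 \<and> nat (- m) \<le> K then plookup p m else 0)" by (cases "m \<le> 0") auto
    also have "\<dots> = plookup p m"
      using K[of m] p by (auto simp: in_keys_iff)
    finally show "plookup p m = plookup (\<Sum>k\<le>K. psingle (- int k) (plookup p (- int k))) m" by simp
  qed
  moreover have "plookup p (- int k) \<in> newton_forms f (\<alpha> - of_nat k)" for k
  proof -
    have "plookup p (- int k) = top_coeff p (- int k) *s vol_form"
      using p top_form_eq unfolding newton_tau_def tau_forms_def top_coeff_def by blast
    moreover have "top_coeff p (- int k) \<in> newton_le (level (\<alpha> - of_nat k))"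
    proof -
      have "top_coeff p (- int k) \<in> newton_le (level \<alpha> + int M * (- int k))" using p unfolding newton_tau_def by blast
      then show ?thesis by (simp add: level_diff)
    qed
    ultimately show ?thesis unfolding newton_forms_def newton_order_le_iff by blast
  qed
  ultimately show "p \<in> newton_theta_forms f \<alpha>" unfolding newton_theta_forms_def
    by (intro CollectI exI[of _ K] exI[of _ "\<lambda>k. plookup p (- int k)"]) auto
qed

text \<open>\<open>active T m a\<close> collects the facets whose cones contain \<open>a\<close>, if \<open>u\<^sup>a \<tau>\<^sup>m\<close> has exact order \<open>T / M\<close>.\<close>

definition active :: "int \<Rightarrow> int \<Rightarrow> (int, 'n) vec \<Rightarrow> (real, 'n) vec set set" where
  "active T m a = {\<sigma> \<in> \<Lambda>. wt \<sigma> a = T + int M * m}"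

text \<open>A refinement of one step: with r = card \<Lambda> it contains everything of order at
  most T/M, while r = 0 forces order at most (T - 1)/M. Nilpotency is proved by decreasing
  r.\<close>

definition newton_active :: "int \<Rightarrow> nat \<Rightarrow> 'n tau_form set" where
  "newton_active T r = {p \<in> newton_tau T. \<forall>m. \<forall>a\<in>pkeys (top_coeff p m). card (active T m a) \<le> r}"

lemma newton_active_add: "p \<in> newton_active T r \<Longrightarrow> q \<in> newton_active T r \<Longrightarrow> p + q \<in> newton_active T r"
  unfolding newton_active_def using newton_tau_add keys_add by (fastforce simp: top_coeff_add)

lemma newton_active_0: "0 \<in> newton_active T r"
  by (simp add: newton_active_def newton_tau_0)

lemma newton_active_card: "newton_tau T \<subseteq> newton_active T (card \<Lambda>)"
  unfolding newton_active_def active_def by (auto intro!: card_mono finite_facets)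

lemma newton_active_zero: "newton_active T 0 \<subseteq> newton_tau (T - 1)"
proof
  fix p assume p: "p \<in> newton_active T 0"
  have "top_coeff p m \<in> newton_le (T - 1 + int M * m)" for m
    unfolding newton_le_def
  proof (intro CollectI ballI)
    fix a \<sigma> assume a: "a \<in> pkeys (top_coeff p m)" and s: "\<sigma> \<in> \<Lambda>"
    have "card (active T m a) = 0" using p a by (auto simp: newton_active_def)
    then have "active T m a = {}" using finite_facets by (simp add: active_def)
    then have "wt \<sigma> a \<noteq> T + int M * m" using s by (auto simp: active_def)
    moreover have "wt \<sigma> a \<le> T + int M * m" using p a s by (auto simp: newton_active_def newton_tau_def newton_le_def)
    ultimately show "wt \<sigma> a \<le> T - 1 + int M * m" by simp
  qed
  then show "p \<in> newton_tau (T - 1)" using p by (simp add: newton_active_def newton_tau_def)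
qed

text \<open>At the exponent a + k the bound is attained on a facet only if it is attained there by a
  and by k, so multiplying by a factor of order at most j together with \<tau>^j creates no new
  active facets.\<close>

lemma vol_tau_newton_active:
  assumes G: "\<And>k \<sigma>. k \<in> pkeys G \<Longrightarrow> \<sigma> \<in> \<Lambda> \<Longrightarrow> wt \<sigma> k \<le> int M * j"
    and a: "\<And>\<sigma>. \<sigma> \<in> \<Lambda> \<Longrightarrow> wt \<sigma> a \<le> T + int M * m"
    and r: "\<And>k. k \<in> pkeys G \<Longrightarrow> card {\<sigma> \<in> active T m a. wt \<sigma> k = int M * j} \<le> r"
  shows "vol_tau (G * psingle a c) (m + j) \<in> newton_active T r"
proof -
  have key: "\<exists>k\<in>pkeys G. b = k + a" if "b \<in> pkeys (G * psingle a c)" for b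
    using keys_mult[of G "psingle a c"] that by (auto split: if_splits)
  have "G * psingle a c \<in> newton_le (T + int M * (m + j))"
    unfolding newton_le_def
  proof (intro CollectI ballI)
    fix b \<sigma> assume "b \<in> pkeys (G * psingle a c)" and s: "\<sigma> \<in> \<Lambda>"
    then obtain k where "k \<in> pkeys G" "b = k + a" using key by blast
    then show "wt \<sigma> b \<le> T + int M * (m + j)" using G[of k \<sigma>] a[OF s] s by (simp add: wt_add distrib_left)
  qed
  moreover have "card (active T (m + j) b) \<le> r" if "b \<in> pkeys (G * psingle a c)" for b
  proof -
    obtain k where k: "k \<in> pkeys G" "b = k + a" using key[OF \<open>b \<in> pkeys (G * psingle a c)\<close>] by blast
    have "active T (m + j) b \<subseteq> {\<sigma> \<in> active T m a. wt \<sigma> k = int M * j}"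
    proof
      fix \<sigma> assume "\<sigma> \<in> active T (m + j) b"
      then have s: "\<sigma> \<in> \<Lambda>" "wt \<sigma> k + wt \<sigma> a = T + int M * m + int M * j"
        by (auto simp: active_def k(2) wt_add distrib_left)
      then have "wt \<sigma> a = T + int M * m" "wt \<sigma> k = int M * j" using G[OF k(1) s(1)] a[OF s(1)] by linarith+
      then show "\<sigma> \<in> {\<sigma> \<in> active T m a. wt \<sigma> k = int M * j}" using s(1) by (simp add: active_def)
    qed
    then have "card (active T (m + j) b) \<le> card {\<sigma> \<in> active T m a. wt \<sigma> k = int M * j}"
      using finite_facets by (intro card_mono) (auto simp: active_def)
    then show ?thesis using r[OF k(1)] by linarith
  qed
  ultimately show ?thesis
    unfolding newton_active_def by (auto simp: vol_tau_newton_tau top_coeff_vol_tau)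
qed

lemma vol_tau_diff: "vol_tau (x - y) k = vol_tau x k - vol_tau y k"
  by (rule poly_mapping_eqI) (simp add: vol_tau_def lookup_minus lookup_single when_def vec_eq_iff left_diff_distrib)

lemma vol_tau_uminus: "vol_tau (- x) k = - vol_tau x k"
  using vol_tau_diff[of 0 x k] by (simp add: vol_tau_def)

lemma euler_shift_vol_tau:
  "euler_shift f \<beta> (vol_tau g m) = vol_tau (psingle 0 (of_int m + of_rat \<beta>) * g) m - vol_tau (f * g) (m + 1)"
proof (rule tau_forms_eqI)
  show "euler_shift f \<beta> (vol_tau g m) \<in> tau_forms CARD('n)" by (intro euler_shift_tau_forms vol_tau_tau_forms)
  show "vol_tau (psingle 0 (of_int m + of_rat \<beta>) * g) m - vol_tau (f * g) (m + 1) \<in> tau_forms CARD('n)"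
    by (intro tau_forms_diff vol_tau_tau_forms)
  fix k
  show "top_coeff (euler_shift f \<beta> (vol_tau g m)) k =
      top_coeff (vol_tau (psingle 0 (of_int m + of_rat \<beta>) * g) m - vol_tau (f * g) (m + 1)) k"
    by (simp add: euler_shift_def top_coeff_add top_coeff_diff top_coeff_tau top_coeff_dtau top_coeff_scale
        top_coeff_vol_tau single_add distrib_right)
qed

text \<open>Contracting with the vector field \<open>\<Sum>\<^sub>i c\<^sub>i u\<^sub>i \<partial>/\<partial>u\<^sub>i\<close>, where \<open>L\<^sub>\<sigma> x = c \<bullet> x\<close>, turns \<open>(\<tau>\<partial>\<^sub>\<tau> + \<beta>) u\<^sup>a \<tau>\<^sup>m\<close> into a
  combination of monomials \<open>u\<^bsup>a+k\<^esup> \<tau>\<^bsup>m+1\<^esup>\<close> with \<open>L\<^sub>\<sigma> k < 1\<close>, which have lost the active facet \<open>\<sigma>\<close>.\<close>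

lemma euler_shift_monomial:
  assumes a: "\<And>\<sigma>. \<sigma> \<in> \<Lambda> \<Longrightarrow> wt \<sigma> a \<le> T + int M * m" and r: "card (active T m a) \<le> Suc r"
  shows "\<exists>q\<in>newton_active T r. euler_shift f (of_int T / of_nat M) (vol_tau (psingle a c) m) - q \<in> gm_relations f"
proof (cases "active T m a = {}")
  \<comment> \<open>No facet attains the bound, so u^a \<tau>^m already has order below T/M, and
    both terms of its image inherit this.\<close>
  case True
  have "vol_tau (psingle 0 (of_int m + of_rat (of_int T / of_nat M)) * psingle a c) (m + 0) \<in> newton_active T r"
    by (rule vol_tau_newton_active[OF _ a]) (auto simp: True wt_0 split: if_splits)
  moreover have "vol_tau ((- f) * psingle a c) (m + 1) \<in> newton_active T r"
    by (rule vol_tau_newton_active[OF _ a]) (auto simp: True wt_key_le)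
  ultimately have "vol_tau (psingle 0 (of_int m + of_rat (of_int T / of_nat M)) * psingle a c) (m + 0) +
      vol_tau ((- f) * psingle a c) (m + 1) \<in> newton_active T r" by (rule newton_active_add)
  then have "euler_shift f (of_int T / of_nat M) (vol_tau (psingle a c) m) \<in> newton_active T r"
    by (simp only: euler_shift_vol_tau mult_minus_left vol_tau_uminus add_0_right add_uminus_conv_diff)
  then show ?thesis using gm_relations_0 by (intro bexI) auto
next
  case False
  then obtain \<sigma> where s: "\<sigma> \<in> \<Lambda>" "wt \<sigma> a = T + int M * m" by (auto simp: active_def)
  obtain v where v: "facet_form \<sigma> = (\<lambda>x. v \<bullet> x)" using facet_form_exists[OF s(1)] by metis
  have lv: "complex_of_real (lform \<sigma> k) = (\<Sum>i\<in>UNIV. of_real (v $ i) * of_int (k $ i))" for k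
    by (simp add: lform_def v inner_vec_def real_exponent_def)
  define h where "h = (\<lambda>i. psingle 0 (complex_of_real (v $ i)) * psingle a c)"
  \<comment> \<open>The derivative of f along the vector field. Its coefficient at k is that of f
    times the value of the facet form at k, so fL - f has no monomial on \<sigma>.\<close>
  define fL where "fL = (\<Sum>i\<in>UNIV. psingle 0 (complex_of_real (v $ i)) * log_deriv i f)"
  have fL: "plookup fL k = of_real (lform \<sigma> k) * plookup f k" for k
    by (simp add: fL_def lookup_sum lookup_single_mult lookup_log_deriv lv sum_distrib_right mult.assoc)
  have 1: "(\<Sum>i\<in>UNIV. log_deriv i f * h i) = fL * psingle a c"
    by (simp add: h_def fL_def sum_distrib_left sum_distrib_right mult_ac)
  \<comment> \<open>Because \<sigma> is active, the facet form at a equals m + T/M; hence the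
    derivative term of the relation is exactly the scalar part of the shifted Euler
    operator.\<close>
  have la: "complex_of_real (lform \<sigma> a) = of_int m + of_rat (of_int T / of_nat M)"
  proof -
    have "lform \<sigma> a = (of_int T + real M * of_int m) / real M" using of_int_wt[OF s(1), of a] M(1) s(2) by (simp add: field_simps)
    then have "complex_of_real (lform \<sigma> a) = (of_int T + of_nat M * of_int m) / of_nat M" by simp
    then show ?thesis using M(1) by (simp add: of_rat_divide field_simps)
  qed
  have 2: "(\<Sum>i\<in>UNIV. log_deriv i (h i)) = psingle 0 (of_int m + of_rat (of_int T / of_nat M)) * psingle a c"
  proof (rule poly_mapping_eqI)
    fix k
    have "plookup (\<Sum>i\<in>UNIV. log_deriv i (h i)) k = (\<Sum>i\<in>UNIV. of_int (k $ i) * (of_real (v $ i) * (c when a = k)))"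
      by (simp add: lookup_sum lookup_log_deriv h_def lookup_single_mult lookup_single)
    also have "\<dots> = complex_of_real (lform \<sigma> k) * (c when a = k)"
      by (simp add: lv sum_distrib_left sum_distrib_right mult_ac)
    also have "\<dots> = plookup (psingle 0 (of_int m + of_rat (of_int T / of_nat M)) * psingle a c) k"
      unfolding la[symmetric] by (simp add: lookup_single_mult lookup_single when_def)
    finally show "plookup (\<Sum>i\<in>UNIV. log_deriv i (h i)) k = plookup (psingle 0 (of_int m + of_rat (of_int T / of_nat M)) * psingle a c) k" .
  qed
  define q where "q = vol_tau ((fL - f) * psingle a c) (m + 1)"
  have "q = vol_tau (fL * psingle a c) (m + 1) - vol_tau (f * psingle a c) (m + 1)"
    by (simp add: q_def left_diff_distrib vol_tau_diff)
  then have "euler_shift f (of_int T / of_nat M) (vol_tau (psingle a c) m) - q \<in> gm_relations f"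
    using gm_relation_vol[of h m f] unfolding euler_shift_vol_tau 1 2 by simp
  moreover have "q \<in> newton_active T r"
    unfolding q_def
  proof (rule vol_tau_newton_active[OF _ a])
    fix k assume "k \<in> pkeys (fL - f)"
    then have k: "k \<in> pkeys f" "lform \<sigma> k \<noteq> 1" by (auto simp: in_keys_iff lookup_minus fL)
    show "wt \<sigma>' k \<le> int M * 1" if "\<sigma>' \<in> \<Lambda>" for \<sigma>' using wt_key_le[OF that k(1)] by simp
    have "wt \<sigma> k \<noteq> int M"
    proof
      assume "wt \<sigma> k = int M"
      then have "real M * lform \<sigma> k = real M" using of_int_wt[OF s(1), of k] by simp
      then show False using k(2) M(1) by simp
    qed
    then have "{\<sigma> \<in> active T m a. wt \<sigma> k = int M * 1} \<subset> active T m a" using s by (auto simp: active_def)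
    then have "card {\<sigma> \<in> active T m a. wt \<sigma> k = int M * 1} < card (active T m a)"
      using finite_facets by (intro psubset_card_mono) (auto simp: active_def)
    then show "card {\<sigma> \<in> active T m a. wt \<sigma> k = int M * 1} \<le> r" using r by simp
  qed
  ultimately show ?thesis by blast
qed

lemma euler_shift_active:
  assumes p: "p \<in> newton_active T (Suc r)"
  shows "\<exists>q\<in>newton_active T r. euler_shift f (of_int T / of_nat M) p - q \<in> gm_relations f"
proof -
  define E where "E = euler_shift f (of_int T / of_nat M)"
  define X where "X = {p. \<exists>q\<in>newton_active T r. E p - q \<in> gm_relations f}"
  have op: "gm_operator f E" unfolding E_def by (rule gm_operator_weyl_V0[OF euler_shift_V0])
  have X_add: "x + y \<in> X" if xy: "x \<in> X" "y \<in> X" for x y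
  proof -
    obtain a b where "a \<in> newton_active T r" "E x - a \<in> gm_relations f" "b \<in> newton_active T r" "E y - b \<in> gm_relations f"
      using xy unfolding X_def by blast
    then have "a + b \<in> newton_active T r" "(E x - a) + (E y - b) \<in> gm_relations f"
      by (auto intro: newton_active_add gm_relations_add)
    then show ?thesis unfolding X_def
      by (intro CollectI bexI[of _ "a + b"]) (auto simp: gm_operator_add[OF op] algebra_simps)
  qed
  have X_0: "0 \<in> X" unfolding X_def using newton_active_0 gm_relations_0
    by (intro CollectI bexI[of _ 0]) (auto simp: gm_operator_0[OF op])
  have X_sum: "sum x A \<in> X" if "\<And>i. i \<in> A \<Longrightarrow> x i \<in> X" for x :: "'b \<Rightarrow> 'n tau_form" and A
    using that by (induction A rule: infinite_finite_induct) (auto intro: X_add X_0)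
  have "vol_tau (psingle a (plookup (top_coeff p m) a)) m \<in> X" if a: "a \<in> pkeys (top_coeff p m)" for m a
    unfolding X_def E_def
  proof (intro CollectI euler_shift_monomial)
    show "wt \<sigma> a \<le> T + int M * m" if "\<sigma> \<in> \<Lambda>" for \<sigma>
      using p a that by (auto simp: newton_active_def newton_tau_def newton_le_def)
    show "card (active T m a) \<le> Suc r" using p a by (auto simp: newton_active_def)
  qed
  then have "(\<Sum>m\<in>pkeys p. \<Sum>a\<in>pkeys (top_coeff p m). vol_tau (psingle a (plookup (top_coeff p m) a)) m) \<in> X"
    by (intro X_sum)
  then have "p \<in> X" using tau_forms_vol_expansion[of p] p by (simp add: newton_active_def newton_tau_def)
  then show ?thesis by (simp add: X_def E_def)
qed

lemma euler_shift_nilpotent: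
  assumes "p \<in> newton_active T r"
  shows "\<exists>q\<in>newton_tau (T - 1). (euler_shift f (of_int T / of_nat M) ^^ r) p - q \<in> gm_relations f"
  using assms
proof (induction r arbitrary: p)
  case 0
  then show ?case using newton_active_zero gm_relations_0 by (intro bexI[of _ p]) auto
next
  case (Suc r)
  let ?E = "euler_shift f (of_int T / of_nat M)"
  have op: "gm_operator f (?E ^^ r)" by (intro gm_operator_funpow gm_operator_weyl_V0 euler_shift_V0)
  obtain q1 where q1: "q1 \<in> newton_active T r" "?E p - q1 \<in> gm_relations f" using euler_shift_active[OF Suc.prems] by blast
  obtain q2 where q2: "q2 \<in> newton_tau (T - 1)" "(?E ^^ r) q1 - q2 \<in> gm_relations f" using Suc.IH[OF q1(1)] by blast
  have "(?E ^^ r) (?E p - q1) \<in> gm_relations f" using op q1(2) by (simp add: gm_operator_def)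
  then have "((?E ^^ r) (?E p) - (?E ^^ r) q1) + ((?E ^^ r) q1 - q2) \<in> gm_relations f"
    using q2(2) by (intro gm_relations_add) (simp_all add: gm_operator_diff[OF op])
  then have "(?E ^^ Suc r) p - q2 \<in> gm_relations f" by (simp add: funpow_swap1)
  then show ?case using q2(1) by blast
qed

text \<open>With \<beta> = T/M one has \<open>\<tau>\<partial>\<^sub>\<tau> + \<beta> =
  \<partial>\<^sub>\<tau>\<tau> + (\<beta> - 1)\<close>. The left side takes p to something with
  fewer active facets, \<tau> p has order one less, and \<beta> \<noteq> 1 since T > M; so p can be
  solved for.\<close>

lemma dtau_generates:
  assumes "p \<in> newton_active T r" and T: "int M < T"
  shows "\<exists>p1\<in>newton_tau (T - 1). \<exists>p2\<in>newton_tau (T - int M). p - (p1 + gm_dtau f p2) \<in> gm_relations f"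
  using assms(1)
proof (induction r arbitrary: p)
  case 0
  then show ?case using newton_active_zero gm_relations_0 newton_tau_0 by (intro bexI[of _ p] bexI[of _ 0]) auto
next
  case (Suc r)
  let ?\<beta> = "of_int T / of_nat M :: rat"
  let ?E = "euler_shift f ?\<beta>"
  obtain q where q: "q \<in> newton_active T r" "?E p - q \<in> gm_relations f" using euler_shift_active[OF Suc.prems] by blast
  obtain q1 q2 where q12: "q1 \<in> newton_tau (T - 1)" "q2 \<in> newton_tau (T - int M)" "q - (q1 + gm_dtau f q2) \<in> gm_relations f"
    using Suc.IH[OF q(1)] by blast
  define b where "b = (of_rat ?\<beta> - 1 :: complex)"
  have "?\<beta> \<noteq> 1" using T M(1) by (simp add: field_simps)
  then have b0: "b \<noteq> 0" unfolding b_def by (metis eq_iff_diff_eq_0 of_rat_1 of_rat_eq_iff)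
  have "gm_scale (of_rat ?\<beta>) p = gm_scale b p + p"
    using gm_scale_plus[of b 1 p] by (simp add: b_def)
  then have bp: "gm_scale b p = ?E p - gm_dtau f (gm_tau p)"
    by (simp add: euler_shift_def gm_dtau_tau)
  define p1 where "p1 = gm_scale (inverse b) q1"
  define z where "z = q2 - gm_tau p"
  define p2 where "p2 = gm_scale (inverse b) z"
  have pT: "p \<in> newton_tau T" using Suc.prems by (simp add: newton_active_def)
  have "q2 + gm_scale (-1) (gm_tau p) \<in> newton_tau (T - int M)"
    by (intro newton_tau_add newton_tau_scale newton_tau_tau q12 pT)
  then have "p2 \<in> newton_tau (T - int M)" unfolding p2_def
    by (intro newton_tau_scale) (simp add: gm_scale_minus_1 z_def)
  moreover have "p1 \<in> newton_tau (T - 1)" unfolding p1_def by (intro newton_tau_scale q12)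
  moreover have "p - (p1 + gm_dtau f p2) \<in> gm_relations f"
  proof -
    have "gm_scale b (p - (p1 + gm_dtau f p2)) = gm_scale b p - (q1 + gm_dtau f z)"
      using b0 by (simp add: p1_def p2_def gm_dtau_scale gm_operator_diff[OF gm_operator_scale[of f]] gm_scale_add gm_scale_scale)
    also have "\<dots> = (?E p - q) + (q - (q1 + gm_dtau f q2))"
      unfolding bp z_def by (simp add: gm_operator_diff[OF gm_operator_dtau])
    also have "\<dots> \<in> gm_relations f" by (intro gm_relations_add q q12)
    finally have "gm_scale (inverse b) (gm_scale b (p - (p1 + gm_dtau f p2))) \<in> gm_relations f" by (rule gm_relations_scale)
    then show ?thesis using b0 by (simp add: gm_scale_scale)
  qed
  ultimately show ?case by blast
qed

text \<open>The level is lowered by one at a time, and at most M such steps keep every element to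
  which \<open>\<partial>\<^sub>\<tau>\<close> is applied inside
  \<open>newton_tau S\<close>.\<close>

lemma dtau_generates_step:
  assumes "p \<in> newton_tau (S + int j)" "j \<le> M" "int M \<le> S"
  shows "\<exists>p1\<in>newton_tau S. \<exists>p2\<in>newton_tau S. p - (p1 + gm_dtau f p2) \<in> gm_relations f"
  using assms(1,2)
proof (induction j arbitrary: p)
  case 0
  then show ?case using gm_relations_0 newton_tau_0 by (intro bexI[of _ p] bexI[of _ 0]) auto
next
  case (Suc j)
  have "p \<in> newton_active (S + int (Suc j)) (card \<Lambda>)" using Suc.prems(1) newton_active_card by blast
  moreover have "int M < S + int (Suc j)" using assms(3) by simp
  ultimately obtain p1 p2 where p12: "p1 \<in> newton_tau (S + int (Suc j) - 1)" "p2 \<in> newton_tau (S + int (Suc j) - int M)"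
    "p - (p1 + gm_dtau f p2) \<in> gm_relations f" using dtau_generates by blast
  have p2S: "p2 \<in> newton_tau S" using p12(2) Suc.prems(2) newton_tau_mono[of "S + int (Suc j) - int M" S] by auto
  have "p1 \<in> newton_tau (S + int j)" using p12(1) by simp
  then obtain q1 q2 where q: "q1 \<in> newton_tau S" "q2 \<in> newton_tau S" "p1 - (q1 + gm_dtau f q2) \<in> gm_relations f"
    using Suc.IH[of p1] Suc.prems(2) by auto
  have "(p - (p1 + gm_dtau f p2)) + (p1 - (q1 + gm_dtau f q2)) \<in> gm_relations f" by (intro gm_relations_add p12 q)
  then have "p - (q1 + gm_dtau f (q2 + p2)) \<in> gm_relations f" by (simp add: gm_dtau_add algebra_simps)
  then show ?case using q newton_tau_add[OF q(2) p2S] by blast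
qed

section \<open>The Newton filtration of G is good and satisfies the characterization\<close>

lemma finite_newton_le_exponents: "finite {a. \<forall>\<sigma>\<in>\<Lambda>. wt \<sigma> a \<le> S}"
proof -
  obtain B where B: "\<forall>x\<in>\<Gamma>. norm x \<le> B" using polytope_imp_bounded[OF polytope] bounded_iff by blast
  \<comment> \<open>The maximum with 1 keeps the dilation factor of the bounded polytope
    positive.\<close>
  define t where "t = real_of_int (max 1 S) / real M"
  have t: "0 < t" using M(1) by (simp add: t_def)
  have "\<bar>a $ i\<bar> \<le> \<lceil>t * B\<rceil>" if a: "\<forall>\<sigma>\<in>\<Lambda>. wt \<sigma> a \<le> S" for a i
  proof -
    have "(1 / t) *\<^sub>R real_exponent a \<in> \<Gamma>"
      unfolding mem_polytope_iff
    proof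
      fix \<sigma> assume s: "\<sigma> \<in> \<Lambda>"
      have "wt \<sigma> a \<le> max 1 S" using a s by fastforce
      then have "real_of_int (wt \<sigma> a) \<le> real_of_int (max 1 S)" by (simp only: of_int_le_iff)
      then have "real M * lform \<sigma> a \<le> real M * t" using of_int_wt[OF s, of a] M(1) by (simp add: t_def)
      then have "lform \<sigma> a \<le> t" using M(1) by simp
      then show "facet_form \<sigma> ((1 / t) *\<^sub>R real_exponent a) \<le> 1"
        using t by (simp add: linear_scale[OF linear_facet_form[OF s]] lform_def divide_le_eq)
    qed
    then have "norm ((1 / t) *\<^sub>R real_exponent a) \<le> B" using B by blast
    then have "norm (real_exponent a) \<le> t * B" using t by (simp add: divide_le_eq mult.commute)
    moreover have "\<bar>real_exponent a $ i\<bar> \<le> norm (real_exponent a)" by (rule component_le_norm_cart)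
    ultimately have "real_of_int \<bar>a $ i\<bar> \<le> t * B" by (simp add: real_exponent_def)
    then show ?thesis by linarith
  qed
  then have "{a. \<forall>\<sigma>\<in>\<Lambda>. wt \<sigma> a \<le> S} \<subseteq> {a. \<forall>i. \<bar>a $ i\<bar> \<le> \<lceil>t * B\<rceil>}" by blast
  then show ?thesis by (rule finite_subset) (rule finite_bounded_int_vec)
qed

text \<open>The submodule of G generated by \<open>X\<close> over the degree 0 piece of the Weyl
  algebra, pulled back to forms. One operator per generator is enough, as the piece is closed under
  addition.\<close>

definition V0_span :: "'n tau_form set \<Rightarrow> 'n tau_form set" where
  "V0_span X = {p. \<exists>P. (\<forall>x\<in>X. P x \<in> weyl_V0 f) \<and> p - (\<Sum>x\<in>X. P x x) \<in> gm_relations f}"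

lemma V0_span_add: assumes "p \<in> V0_span X" "q \<in> V0_span X" shows "p + q \<in> V0_span X"
proof -
  obtain P Q where P: "\<forall>x\<in>X. P x \<in> weyl_V0 f" "p - (\<Sum>x\<in>X. P x x) \<in> gm_relations f"
    and Q: "\<forall>x\<in>X. Q x \<in> weyl_V0 f" "q - (\<Sum>x\<in>X. Q x x) \<in> gm_relations f"
    using assms unfolding V0_span_def by blast
  have "(p - (\<Sum>x\<in>X. P x x)) + (q - (\<Sum>x\<in>X. Q x x)) \<in> gm_relations f" by (intro gm_relations_add P Q)
  then have "(p + q) - (\<Sum>x\<in>X. (\<lambda>y. P x y + Q x y) x) \<in> gm_relations f" by (simp add: sum.distrib algebra_simps)
  moreover have "\<forall>x\<in>X. (\<lambda>y. P x y + Q x y) \<in> weyl_V0 f" using P(1) Q(1) weyl_V0.add by blast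
  ultimately show ?thesis unfolding V0_span_def by (intro CollectI exI[of _ "\<lambda>x y. P x y + Q x y"] conjI)
qed

lemma V0_span_generator: assumes "finite X" "x \<in> X" "P \<in> weyl_V0 f" shows "P x \<in> V0_span X"
proof -
  define Q where "Q = (\<lambda>y. if y = x then P else (\<lambda>p. 0))"
  have "(\<Sum>y\<in>X. Q y y) = (\<Sum>y\<in>X. if y = x then P x else 0)" by (intro sum.cong) (auto simp: Q_def)
  then have "P x - (\<Sum>y\<in>X. Q y y) = 0" using assms(1,2) by simp
  moreover have "\<forall>y\<in>X. Q y \<in> weyl_V0 f" using assms(3) weyl_V0_zero by (auto simp: Q_def)
  ultimately show ?thesis unfolding V0_span_def using gm_relations_0[of f] by (intro CollectI exI[of _ Q]) simp
qed

lemma V0_span_0: "0 \<in> V0_span X"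
  unfolding V0_span_def using weyl_V0_zero gm_relations_0 by (intro CollectI exI[of _ "\<lambda>x y. 0"]) auto

lemma V0_span_sum: "(\<And>i. i \<in> A \<Longrightarrow> p i \<in> V0_span X) \<Longrightarrow> sum p A \<in> V0_span X"
  by (induction A rule: infinite_finite_induct) (auto simp: V0_span_0 V0_span_add)

lemma V0_span_relation: assumes "q \<in> V0_span X" "p - q \<in> gm_relations f" shows "p \<in> V0_span X"
proof -
  obtain P where P: "\<forall>x\<in>X. P x \<in> weyl_V0 f" "q - (\<Sum>x\<in>X. P x x) \<in> gm_relations f"
    using assms(1) unfolding V0_span_def by blast
  have "p - (\<Sum>x\<in>X. P x x) \<in> gm_relations f" using gm_relations_add[OF assms(2) P(2)] by simp
  then show ?thesis using P(1) unfolding V0_span_def by blast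
qed

lemma funpow_tau_V0: "(gm_tau ^^ k) \<in> weyl_V0 f"
proof (induction k)
  case 0
  have "gm_scale 1 = (\<lambda>p :: 'n tau_form. p)" by (simp add: fun_eq_iff)
  then show ?case using weyl_V0.const[of 1 f] by (simp add: id_def)
next
  case (Suc k)
  then show ?case unfolding funpow.simps by (intro weyl_V0.mult weyl_V0.tau)
qed

lemma funpow_tau_vol_tau: "(gm_tau ^^ k) (vol_tau g m) = vol_tau g (m + int k)"
proof -
  have 1: "gm_tau (vol_tau g m) = vol_tau g (m + 1)" for m
    by (rule poly_mapping_eqI) (auto simp: lookup_gm_tau vol_tau_def lookup_single when_def)
  show ?thesis by (induction k) (simp_all add: 1 add.commute add.left_commute)
qed

text \<open>Above level T0 the vanishing of the graded cokernel replaces a coefficient at \<tau>^m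
  by one of level lower by M at \<tau>^(m-1) and a remainder of level lower by 1. What is left are
  the finitely many exponents of level at most T0, each with its least admissible power of \<tau>;
  higher powers arise by applying \<tau>.\<close>

lemma newton_tau_generated:
  obtains X where "finite X" "X \<subseteq> newton_tau T" "newton_tau T \<subseteq> V0_span X"
proof -
  obtain T0 where T0: "\<And>S g. T0 < S \<Longrightarrow> g \<in> newton_le S \<Longrightarrow>
    \<exists>h. (\<forall>i. h i \<in> newton_le (S - int M)) \<and> g - (\<Sum>i\<in>UNIV. log_deriv i f * h i) \<in> newton_le (S - 1)"
    using newton_graded_cofinite by blast
  define A where "A = {a. \<forall>\<sigma>\<in>\<Lambda>. wt \<sigma> a \<le> T0}"
  \<comment> \<open>The least m for which u^a \<tau>^m has order at most T/M. Negating the quotient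
    rounded down amounts to rounding up.\<close>
  define \<mu> where "\<mu> = (\<lambda>a. Max ((\<lambda>\<sigma>. - ((T - wt \<sigma> a) div int M)) ` \<Lambda>))"
  have \<mu>: "(\<forall>\<sigma>\<in>\<Lambda>. wt \<sigma> a \<le> T + int M * m) \<longleftrightarrow> \<mu> a \<le> m" for a m
  proof -
    have "wt \<sigma> a \<le> T + int M * m \<longleftrightarrow> - ((T - wt \<sigma> a) div int M) \<le> m" for \<sigma>
    proof -
      have "- m \<le> (T - wt \<sigma> a) div int M \<longleftrightarrow> - m * int M \<le> T - wt \<sigma> a"
        using M(1) by (intro le_div_iff_int) simp
      then show ?thesis by (simp add: mult.commute) linarith
    qed
    then show ?thesis unfolding \<mu>_def using finite_facets facets_nonempty by (subst Max_le_iff) auto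
  qed
  define X where "X = (\<lambda>a. vol_tau (psingle a 1) (\<mu> a)) ` A"
  have finX: "finite X" unfolding X_def A_def by (intro finite_imageI finite_newton_le_exponents)
  have XT: "X \<subseteq> newton_tau T"
  proof
    fix x assume "x \<in> X"
    then obtain a where "x = vol_tau (psingle a 1) (\<mu> a)" by (auto simp: X_def)
    moreover have "psingle a 1 \<in> newton_le (T + int M * \<mu> a)" using \<mu>[of a "\<mu> a"] by (simp add: newton_le_def)
    ultimately show "x \<in> newton_tau T" by (simp add: vol_tau_newton_tau)
  qed
  have vol: "vol_tau g m \<in> V0_span X" if "g \<in> newton_le S" "S \<le> T + int M * m" for g m S
    using that
  proof (induction "nat (S - T0)" arbitrary: S g m rule: less_induct)
    case less
    show ?case
    proof (cases "S \<le> T0")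
      case True
      have "vol_tau (psingle a c) m \<in> V0_span X" if a: "a \<in> pkeys g" for a c
      proof -
        have le: "\<forall>\<sigma>\<in>\<Lambda>. wt \<sigma> a \<le> S" using less.prems(1) a by (auto simp: newton_le_def)
        then have "a \<in> A" using True by (fastforce simp: A_def)
        have "\<mu> a \<le> m" using \<mu>[of a m] le less.prems(2) by fastforce
        have "(gm_scale c \<circ> (gm_tau ^^ nat (m - \<mu> a))) (vol_tau (psingle a 1) (\<mu> a)) \<in> V0_span X"
          using finX \<open>a \<in> A\<close> by (intro V0_span_generator weyl_V0.mult weyl_V0.const funpow_tau_V0) (auto simp: X_def)
        moreover have "(gm_scale c \<circ> (gm_tau ^^ nat (m - \<mu> a))) (vol_tau (psingle a 1) (\<mu> a)) = gm_scale c (vol_tau (psingle a 1) m)"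
          using \<open>\<mu> a \<le> m\<close> by (simp add: funpow_tau_vol_tau)
        moreover have "gm_scale c (vol_tau (psingle a 1) m) = vol_tau (psingle a c) m"
          by (rule tau_forms_eqI) (auto simp: tau_forms_scale vol_tau_tau_forms top_coeff_scale top_coeff_vol_tau mult_single)
        ultimately show ?thesis by simp
      qed
      then have "(\<Sum>a\<in>pkeys g. vol_tau (psingle a (plookup g a)) m) \<in> V0_span X" by (intro V0_span_sum)
      moreover have "(\<Sum>a\<in>pkeys g. vol_tau (psingle a (plookup g a)) m) = vol_tau g m"
      proof (rule tau_forms_eqI)
        fix k
        show "top_coeff (\<Sum>a\<in>pkeys g. vol_tau (psingle a (plookup g a)) m) k = top_coeff (vol_tau g m) k"
          using poly_mapping_sum_single[of g] by (simp add: top_coeff_sum top_coeff_vol_tau)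
      qed (intro tau_forms_sum vol_tau_tau_forms)+
      ultimately show ?thesis by simp
    next
      case False
      then obtain h where h: "\<forall>i. h i \<in> newton_le (S - int M)" "g - (\<Sum>i\<in>UNIV. log_deriv i f * h i) \<in> newton_le (S - 1)"
        using T0[of S g] less.prems(1) by auto
      define g' where "g' = g - (\<Sum>i\<in>UNIV. log_deriv i f * h i)"
      have "vol_tau (\<Sum>i\<in>UNIV. log_deriv i (h i)) (m - 1) \<in> V0_span X"
      proof (rule less.hyps)
        show "nat (S - int M - T0) < nat (S - T0)" using False M(1) by simp
        show "(\<Sum>i\<in>UNIV. log_deriv i (h i)) \<in> newton_le (S - int M)" using h(1) by (intro newton_le_sum newton_le_log_deriv) blast
        show "S - int M \<le> T + int M * (m - 1)" using less.prems(2) by (simp add: algebra_simps)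
      qed
      moreover have "vol_tau g' m \<in> V0_span X"
      proof (rule less.hyps)
        show "nat (S - 1 - T0) < nat (S - T0)" using False by simp
        show "g' \<in> newton_le (S - 1)" using h(2) by (simp add: g'_def)
        show "S - 1 \<le> T + int M * m" using less.prems(2) by simp
      qed
      ultimately have "vol_tau (\<Sum>i\<in>UNIV. log_deriv i (h i)) (m - 1) + vol_tau g' m \<in> V0_span X" by (rule V0_span_add)
      moreover have "vol_tau g m - (vol_tau (\<Sum>i\<in>UNIV. log_deriv i (h i)) (m - 1) + vol_tau g' m) \<in> gm_relations f"
        using gm_relations_uminus[OF gm_relation_vol[of h "m - 1" f]]
        by (simp add: g'_def vol_tau_diff algebra_simps)
      ultimately show ?thesis by (rule V0_span_relation)
    qed
  qed
  have "newton_tau T \<subseteq> V0_span X"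
  proof
    fix p assume p: "p \<in> newton_tau T"
    have "vol_tau (psingle a (plookup (top_coeff p m) a)) m \<in> V0_span X" if a: "a \<in> pkeys (top_coeff p m)" for m a
    proof (rule vol[OF _ order_refl])
      show "psingle a (plookup (top_coeff p m) a) \<in> newton_le (T + int M * m)"
        using p a by (auto simp: newton_tau_def newton_le_def)
    qed
    then have "(\<Sum>m\<in>pkeys p. \<Sum>a\<in>pkeys (top_coeff p m). vol_tau (psingle a (plookup (top_coeff p m) a)) m) \<in> V0_span X"
      by (intro V0_span_sum)
    then show "p \<in> V0_span X" using tau_forms_vol_expansion[OF newton_tau_tau_forms[OF p]] by simp
  qed
  then show thesis using that finX XT by blast
qed

definition newton_gm :: "rat \<Rightarrow> 'n tau_form set set" where
  "newton_gm \<alpha> = gm_class f ` newton_tau (level \<alpha>)"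

lemma gm_class_newton_gmD:
  assumes "gm_class f p \<in> newton_gm \<alpha>" obtains q where "q \<in> newton_tau (level \<alpha>)" "p - q \<in> gm_relations f"
  using assms unfolding newton_gm_def by (auto simp: gm_class_eq_iff)

text \<open>A single step generated over the degree 0 piece suffices: higher steps come from it by
  \<open>\<partial>\<^sub>\<tau>\<close> once its level is at least M, and lower ones by powers of
  \<tau>, which are invertible on forms.\<close>

lemma newton_gm_good: "good_filtration f (\<lambda>k. newton_gm (\<alpha> + of_int k))"
proof -
  define j where "j = level \<alpha>"
  \<comment> \<open>Moves the base step up by whole units until its level is at least M, beyond
    which the scalar \<beta> - 1 is nonzero; the generators are accordingly placed in degree
    K.\<close>
  define K where "K = max 0 (int M - j)"
  define S where "S = j + int M * K"
  have S: "int M \<le> S"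
  proof -
    have "1 * K \<le> int M * K" using M(1) by (intro mult_right_mono) (auto simp: K_def)
    then show ?thesis unfolding S_def by (auto simp: K_def)
  qed
  obtain X where X: "finite X" "X \<subseteq> newton_tau S" "newton_tau S \<subseteq> V0_span X" by (rule newton_tau_generated)
  define gen where "gen = (\<lambda>k. {p. \<exists>P. (\<forall>x\<in>X. P x \<in> weyl_V f k) \<and> p - (\<Sum>x\<in>X. P x x) \<in> gm_relations f})"
  have gen_pos: "newton_tau (S + int M * int i) \<subseteq> gen (int i)" for i
  proof (induction i)
    case 0
    have "weyl_V f 0 = weyl_V0 f" by (auto simp: weyl_V_def)
    then show ?case using X(3) by (simp add: gen_def V0_span_def)
  next
    case (Suc i)
    show ?case
    proof
      fix p assume "p \<in> newton_tau (S + int M * int (Suc i))"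
      then have "p \<in> newton_tau (S + int M * int i + int M)" by (simp add: algebra_simps)
      moreover have "int M \<le> S + int M * int i" using S by (simp add: add_increasing2)
      ultimately obtain p1 p2 where p12: "p1 \<in> newton_tau (S + int M * int i)" "p2 \<in> newton_tau (S + int M * int i)"
        "p - (p1 + gm_dtau f p2) \<in> gm_relations f"
        using dtau_generates_step[of p "S + int M * int i" M] by blast
      obtain P where P: "\<forall>x\<in>X. P x \<in> weyl_V f (int i)" "p1 - (\<Sum>x\<in>X. P x x) \<in> gm_relations f"
        using p12(1) Suc unfolding gen_def by blast
      obtain Q where Q: "\<forall>x\<in>X. Q x \<in> weyl_V f (int i)" "p2 - (\<Sum>x\<in>X. Q x x) \<in> gm_relations f"
        using p12(2) Suc unfolding gen_def by blast
      define R where "R = (\<lambda>x y. P x y + (gm_dtau f \<circ> Q x) y)"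
      have "R x \<in> weyl_V f (int (Suc i))" if "x \<in> X" for x
      proof -
        have "P x \<in> weyl_V f (int (Suc i))" using P(1) that by (intro weyl_V_mono[of "int i" "int (Suc i)"]) auto
        moreover have "gm_dtau f \<circ> Q x \<in> weyl_V f (int i + 1)" using Q(1) that by (intro weyl_V_dtau) auto
        then have "gm_dtau f \<circ> Q x \<in> weyl_V f (int (Suc i))" by (simp only: of_nat_Suc add.commute)
        ultimately show ?thesis unfolding R_def by (rule weyl_V_add)
      qed
      moreover have "p - (\<Sum>x\<in>X. R x x) \<in> gm_relations f"
      proof -
        have "(p - (p1 + gm_dtau f p2)) + (p1 - (\<Sum>x\<in>X. P x x)) + gm_dtau f (p2 - (\<Sum>x\<in>X. Q x x)) \<in> gm_relations f"
          by (intro gm_relations_add gm_relations_dtau p12 P Q)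
        then show ?thesis
          by (simp add: R_def sum.distrib gm_operator_diff[OF gm_operator_dtau] gm_operator_sum[OF gm_operator_dtau])
            (simp add: algebra_simps)
      qed
      ultimately show "p \<in> gen (int (Suc i))" unfolding gen_def by blast
    qed
  qed
  have gen_neg: "newton_tau (S - int M * int i) \<subseteq> gen (- int i)" for i
  proof
    fix p assume p: "p \<in> newton_tau (S - int M * int i)"
    have "(tau_inverse ^^ k) p \<in> newton_tau (S - int M * int i + int M * int k)" for k
    proof (induction k)
      case (Suc k)
      then show ?case using newton_tau_tau_inverse[OF Suc] by (simp add: algebra_simps)
    qed (use p in simp)
    from this[of i] have "(tau_inverse ^^ i) p \<in> V0_span X" using X(3) by auto
    then obtain P where P: "\<forall>x\<in>X. P x \<in> weyl_V0 f" "(tau_inverse ^^ i) p - (\<Sum>x\<in>X. P x x) \<in> gm_relations f"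
      unfolding V0_span_def by blast
    have inv: "(gm_tau ^^ i) ((tau_inverse ^^ i) q) = q" for q :: "'n tau_form"
      by (induction i arbitrary: q) (simp_all add: funpow_swap1 gm_tau_inverse)
    have op: "gm_operator f (gm_tau ^^ i)" by (intro gm_operator_funpow gm_operator_tau)
    have "(gm_tau ^^ i) ((tau_inverse ^^ i) p - (\<Sum>x\<in>X. P x x)) \<in> gm_relations f"
      using op P(2) by (simp add: gm_operator_def)
    then have "p - (\<Sum>x\<in>X. ((gm_tau ^^ i) \<circ> P x) x) \<in> gm_relations f"
      by (simp add: gm_operator_diff[OF op] gm_operator_sum[OF op] inv)
    moreover have "\<forall>x\<in>X. (gm_tau ^^ i) \<circ> P x \<in> weyl_V f (- int i)" using P(1) unfolding weyl_V_def by auto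
    ultimately show "p \<in> gen (- int i)" unfolding gen_def by (intro CollectI exI[of _ "\<lambda>x. (gm_tau ^^ i) \<circ> P x"] conjI)
  qed
  have gen: "newton_tau (S + int M * k) \<subseteq> gen k" for k
  proof (cases "0 \<le> k")
    case True
    then show ?thesis using gen_pos[of "nat k"] by simp
  next
    case False
    then show ?thesis using gen_neg[of "nat (- k)"] by simp
  qed
  obtain b where b: "bij_betw b {0..<card X} X" using ex_bij_betw_nat_finite[OF X(1)] by blast
  have bs: "(\<Sum>i<card X. F (b i)) = (\<Sum>x\<in>X. F x)" for F :: "'n tau_form \<Rightarrow> 'n tau_form"
    using sum.reindex_bij_betw[OF b, of F] by (simp add: lessThan_atLeast0)
  have bX: "b i \<in> X" if "i < card X" for i using b that by (auto simp: bij_betw_def)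
  show ?thesis
    unfolding good_filtration_def
  proof (intro exI[of _ "card X"] exI[of _ b] exI[of _ "\<lambda>_. K"] conjI allI impI)
    show "b i \<in> tau_forms CARD('n)" if "i < card X" for i using bX[OF that] X(2) newton_tau_tau_forms by blast
    fix k
    have lev: "level (\<alpha> + of_int k) = S + int M * (k - K)" by (simp add: level_add_int S_def j_def algebra_simps)
    show "newton_gm (\<alpha> + of_int k) = {gm_class f (\<Sum>i<card X. P i (b i)) | P. \<forall>i<card X. P i \<in> weyl_V f (k - K)}"
    proof (intro equalityI subsetI)
      fix x assume "x \<in> newton_gm (\<alpha> + of_int k)"
      then obtain p where p: "x = gm_class f p" "p \<in> newton_tau (S + int M * (k - K))" by (auto simp: newton_gm_def lev)
      obtain P where P: "\<forall>x\<in>X. P x \<in> weyl_V f (k - K)" "p - (\<Sum>x\<in>X. P x x) \<in> gm_relations f"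
        using p(2) gen[of "k - K"] unfolding gen_def by blast
      have "x = gm_class f (\<Sum>i<card X. P (b i) (b i))" unfolding p(1) gm_class_eq_iff using P(2) bs[of "\<lambda>x. P x x"] by simp
      then show "x \<in> {gm_class f (\<Sum>i<card X. P i (b i)) | P. \<forall>i<card X. P i \<in> weyl_V f (k - K)}"
        using P(1) bX by (intro CollectI exI[of _ "\<lambda>i. P (b i)"]) auto
    next
      fix x assume "x \<in> {gm_class f (\<Sum>i<card X. P i (b i)) | P. \<forall>i<card X. P i \<in> weyl_V f (k - K)}"
      then obtain P where P: "x = gm_class f (\<Sum>i<card X. P i (b i))" "\<forall>i<card X. P i \<in> weyl_V f (k - K)" by blast
      have "P i (b i) \<in> newton_tau (S + int M * (k - K))" if "i < card X" for i
        using P(2) bX[OF that] X(2) that by (intro newton_tau_weyl_V) auto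
      then have "(\<Sum>i<card X. P i (b i)) \<in> newton_tau (S + int M * (k - K))" by (intro newton_tau_sum) auto
      then show "x \<in> newton_gm (\<alpha> + of_int k)" unfolding newton_gm_def lev P(1) by (rule imageI)
    qed
  qed
qed

lemma newton_gm_mono: "\<alpha> \<le> \<beta> \<Longrightarrow> newton_gm \<alpha> \<subseteq> newton_gm \<beta>"
  unfolding newton_gm_def using newton_tau_mono[OF level_mono] by blast

text \<open>If \<beta> is not in (1/M)\<int>, the step at \<beta> coincides with an earlier one and
  the exponent 0 works. Otherwise each application of the operator removes an active facet, so the
  number of facets works.\<close>

lemma newton_gm_nilpotent:
  "\<exists>N::nat. \<forall>p\<in>tau_forms CARD('n). gm_class f p \<in> newton_gm \<beta> \<longrightarrow>
      gm_class f ((euler_shift f \<beta> ^^ N) p) \<in> (\<Union>\<gamma>\<in>{..<\<beta>}. newton_gm \<gamma>)"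
proof -
  define T where "T = level \<beta>"
  define \<gamma> where "\<gamma> = (of_int T / of_nat M :: rat)"
  have lg: "level \<gamma> = T" by (simp add: \<gamma>_def level_quotient)
  show ?thesis
  proof (cases "\<gamma> = \<beta>")
    case False
    then have "\<gamma> < \<beta>" using quotient_level_le[of \<beta>] by (simp add: \<gamma>_def T_def)
    moreover have "newton_gm \<gamma> = newton_gm \<beta>" unfolding newton_gm_def lg T_def ..
    ultimately show ?thesis by (intro exI[of _ 0]) auto
  next
    case True
    show ?thesis
    proof (intro exI[of _ "card \<Lambda>"] ballI impI)
      fix p assume "gm_class f p \<in> newton_gm \<beta>"
      then obtain q where q: "q \<in> newton_tau T" "p - q \<in> gm_relations f" unfolding T_def by (rule gm_class_newton_gmD)
      let ?E = "euler_shift f \<beta> ^^ card \<Lambda>"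
      have op: "gm_operator f ?E" by (intro gm_operator_funpow gm_operator_weyl_V0 euler_shift_V0)
      have "q \<in> newton_active T (card \<Lambda>)" using q(1) newton_active_card by blast
      from euler_shift_nilpotent[OF this] obtain q' where q': "q' \<in> newton_tau (T - 1)" "?E q - q' \<in> gm_relations f"
        unfolding True[unfolded \<gamma>_def] ..
      have "gm_class f (?E p) = gm_class f (?E q)"
        using q(2) unfolding gm_class_eq_iff[symmetric] by (rule gm_operator_class[OF op])
      also have "\<dots> = gm_class f q'" unfolding gm_class_eq_iff by (rule q'(2))
      also have "\<dots> \<in> newton_gm (of_int (T - 1) / of_nat M)" unfolding newton_gm_def level_quotient using q'(1) by blast
      finally have "gm_class f (?E p) \<in> newton_gm (of_int (T - 1) / of_nat M)" .
      moreover have "of_int (T - 1) / of_nat M < \<beta>"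
        unfolding True[symmetric] \<gamma>_def using M(1) by (intro divide_strict_right_mono) auto
      ultimately show "gm_class f (?E p) \<in> (\<Union>\<gamma>\<in>{..<\<beta>}. newton_gm \<gamma>)" by blast
    qed
  qed
qed

lemma newton_gm_is_MK: "is_MK_filtration f newton_gm"
  unfolding is_MK_filtration_def euler_shift_eq[symmetric]
proof (intro conjI)
  show "mono newton_gm" using newton_gm_mono by (auto simp: mono_def)
  show "(\<Union>\<beta>. newton_gm \<beta>) = gauss_manin f"
  proof (intro equalityI subsetI)
    fix x assume "x \<in> (\<Union>\<beta>. newton_gm \<beta>)"
    then show "x \<in> gauss_manin f" using newton_tau_tau_forms by (auto simp: newton_gm_def gauss_manin_def)
  next
    fix x assume "x \<in> gauss_manin f"
    then obtain p where p: "p \<in> tau_forms CARD('n)" "x = gm_class f p" by (auto simp: gauss_manin_def)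
    then obtain T where "p \<in> newton_tau T" using newton_tau_exists by blast
    then have "x \<in> newton_gm (of_int T / of_nat M)" using p(2) by (simp add: newton_gm_def level_quotient)
    then show "x \<in> (\<Union>\<beta>. newton_gm \<beta>)" by blast
  qed
  \<comment> \<open>One representative for each class of (1/M)\<int> modulo \<int>.\<close>
  define A where "A = (\<lambda>j. of_int j / of_nat M :: rat) ` {0..<int M}"
  have "newton_gm \<beta> = \<Union>{newton_gm (\<alpha> + of_int k) | \<alpha> k. \<alpha> \<in> A \<and> \<alpha> + of_int k \<le> \<beta>}" for \<beta>
  proof (intro equalityI subsetI)
    fix x assume x: "x \<in> newton_gm \<beta>"
    define T where "T = level \<beta>"
    define \<alpha> where "\<alpha> = (of_int (T mod int M) / of_nat M :: rat)"
    have "of_int (T mod int M + int M * (T div int M)) = (of_int T :: rat)" by (simp only: mod_mult_div_eq)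
    then have T: "of_int (T mod int M) + of_nat M * of_int (T div int M) = (of_int T :: rat)"
      by (simp only: of_int_add of_int_mult of_int_of_nat_eq)
    have eq: "\<alpha> + of_int (T div int M) = of_int T / of_nat M"
      unfolding \<alpha>_def T[symmetric] using M(1) by (simp add: add_divide_distrib)
    have "\<alpha> \<in> A" unfolding A_def \<alpha>_def using M(1) by (intro imageI) auto
    moreover have "\<alpha> + of_int (T div int M) \<le> \<beta>" unfolding eq unfolding T_def by (rule quotient_level_le)
    moreover have "x \<in> newton_gm (\<alpha> + of_int (T div int M))"
      using x unfolding eq newton_gm_def level_quotient unfolding T_def .
    ultimately show "x \<in> \<Union>{newton_gm (\<alpha> + of_int k) | \<alpha> k. \<alpha> \<in> A \<and> \<alpha> + of_int k \<le> \<beta>}" by blast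
  next
    fix x assume "x \<in> \<Union>{newton_gm (\<alpha> + of_int k) | \<alpha> k. \<alpha> \<in> A \<and> \<alpha> + of_int k \<le> \<beta>}"
    then show "x \<in> newton_gm \<beta>" using newton_gm_mono by blast
  qed
  moreover have "finite A" by (simp add: A_def)
  ultimately show "\<exists>A. finite A \<and>
        (\<forall>\<beta>. newton_gm \<beta> = \<Union>{newton_gm (\<alpha> + of_int k) | \<alpha> k. \<alpha> \<in> A \<and> \<alpha> + of_int k \<le> \<beta>}) \<and>
        (\<forall>\<alpha>\<in>A. good_filtration f (\<lambda>k. newton_gm (\<alpha> + of_int k)))"
    using newton_gm_good by blast
  show "\<forall>\<beta>. \<exists>N::nat. \<forall>p\<in>tau_forms CARD('n). gm_class f p \<in> newton_gm \<beta> \<longrightarrow>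
      gm_class f ((euler_shift f \<beta> ^^ N) p) \<in> (\<Union>\<gamma>\<in>{..<\<beta>}. newton_gm \<gamma>)"
    using newton_gm_nilpotent by blast
qed

section \<open>Representatives without positive powers of \<tau>\<close>

lemma twisted_d_square: "twisted_d f (twisted_d f p) = 0"
proof (rule poly_mapping_eqI)
  fix m
  have "ext_deriv (ext_deriv \<omega>) = 0" for \<omega> :: "'n form"
    unfolding ext_deriv_eq_koszul by (rule koszul_square) (auto simp: additive_log_deriv log_deriv_commute)
  then show "plookup (twisted_d f (twisted_d f p)) m = plookup 0 m"
    by (simp add: lookup_gm ext_deriv_diff df_wedge_diff ext_deriv_df_wedge df_wedge_square)
qed

text \<open>Degree n - 2 is expressed by Suc (Suc (card I)) = n, because truncated subtraction would
  admit degree 0 instead of no degree at all when n = 1.\<close>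

lemma koszul_penultimate_k_forms:
  fixes \<zeta> :: "'n form"
  assumes "\<And>i. T i 0 = 0" "\<forall>I. Suc (Suc (card I)) \<noteq> CARD('n) \<longrightarrow> \<zeta> $ I = 0"
  shows "koszul T \<zeta> \<in> k_forms (CARD('n) - 1)"
  unfolding k_forms_def
proof (intro CollectI allI impI)
  fix J :: "'n set" assume J: "card J \<noteq> CARD('n) - 1"
  have "\<zeta> $ (J - {i}) = 0" if "i \<in> J" for i
  proof -
    have "Suc (card (J - {i})) = card J" using that by (intro card_Suc_Diff1) auto
    then show ?thesis using assms(2) J by fastforce
  qed
  then show "koszul T \<zeta> $ J = 0" by (simp add: koszul_def assms(1))
qed

text \<open>\<open>df_wedge_exact\<close> bounds the degree of the primitive only from above.
  Cutting it down to degree n - 2 keeps its image, which is homogeneous of degree n - 1.\<close>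

lemma df_wedge_exact_top:
  assumes "\<omega> \<in> k_forms (CARD('n) - 1)" "df_wedge f \<omega> = 0"
  obtains \<zeta> where "\<forall>I. Suc (Suc (card I)) \<noteq> CARD('n) \<longrightarrow> \<zeta> $ I = 0" "\<omega> = df_wedge f \<zeta>"
proof -
  have "\<forall>I. CARD('n) \<le> card I \<longrightarrow> \<omega> $ I = 0"
  proof (intro allI impI)
    fix I :: "'n set" assume "CARD('n) \<le> card I"
    then have "card I \<noteq> CARD('n) - 1" using zero_less_card_finite[where 'a='n] by linarith
    then show "\<omega> $ I = 0" using assms(1) by (simp add: k_forms_def)
  qed
  then obtain \<zeta> where z: "\<forall>I. CARD('n) \<le> Suc (card I) \<longrightarrow> \<zeta> $ I = 0" "\<omega> = df_wedge f \<zeta>"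
    by (rule df_wedge_exact[OF _ assms(2)])
  define \<zeta>' where "\<zeta>' = (\<chi> I. if Suc (Suc (card I)) = CARD('n) then \<zeta> $ I else 0)"
  have z': "\<forall>I. Suc (Suc (card I)) \<noteq> CARD('n) \<longrightarrow> \<zeta>' $ I = 0" by (simp add: \<zeta>'_def)
  have "df_wedge f \<zeta>' $ J = \<omega> $ J" for J
  proof (cases "card J = CARD('n) - 1")
    case True
    have "\<zeta>' $ (J - {i}) = \<zeta> $ (J - {i})" if "i \<in> J" for i
    proof -
      have "Suc (card (J - {i})) = card J" using that by (intro card_Suc_Diff1) auto
      then show ?thesis using True by (simp add: \<zeta>'_def)
    qed
    then show ?thesis unfolding z(2) koszul_def by simp
  next
    case False
    have "df_wedge f \<zeta>' \<in> k_forms (CARD('n) - 1)" using z' by (intro koszul_penultimate_k_forms) auto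
    then show ?thesis using False assms(1) by (simp add: k_forms_def)
  qed
  then show thesis using that[OF z'] by (simp add: vec_eq_iff)
qed

text \<open>Exactness of \<open>df \<and>\<close> in degree \<open>n - 1\<close> is what pushes down the top \<open>\<tau>\<close>-degree of a primitive.\<close>

lemma primitive_lower_degree:
  assumes "\<eta> \<in> tau_forms (CARD('n) - 1)" "\<forall>m>K. plookup (twisted_d f \<eta>) m = 0"
  obtains \<eta>' where "\<eta>' \<in> tau_forms (CARD('n) - 1)" "twisted_d f \<eta>' = twisted_d f \<eta>" "\<forall>m\<ge>K. plookup \<eta>' m = 0"
proof -
  have *: "\<exists>\<eta>'\<in>tau_forms (CARD('n) - 1). twisted_d f \<eta>' = twisted_d f \<eta> \<and> (\<forall>m\<ge>K. plookup \<eta>' m = 0)"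
    if "\<eta> \<in> tau_forms (CARD('n) - 1)" "\<forall>m>K. plookup (twisted_d f \<eta>) m = 0" "\<forall>m\<ge>K + int B. plookup \<eta> m = 0" for B \<eta>
    using that
  proof (induction B arbitrary: \<eta>)
    case 0
    then show ?case by auto
  next
    case (Suc B)
    \<comment> \<open>The highest power of \<tau> that may occur in \<eta>. The coefficient of the
      twisted differential at b + 1 is then minus the wedge product of df with that of \<eta> at b,
      and it vanishes because b + 1 > K.\<close>
    define b where "b = K + int B"
    have "plookup (twisted_d f \<eta>) (b + 1) = 0" using Suc.prems(2) by (simp add: b_def)
    moreover have "plookup \<eta> (b + 1) = 0" using Suc.prems(3) by (simp add: b_def)
    ultimately have d0: "df_wedge f (plookup \<eta> b) = 0" by (simp add: lookup_gm)
    have "plookup \<eta> b \<in> k_forms (CARD('n) - 1)" using Suc.prems(1) by (simp add: tau_forms_def)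
    then obtain \<zeta> where z: "\<forall>I. Suc (Suc (card I)) \<noteq> CARD('n) \<longrightarrow> \<zeta> $ I = 0" "plookup \<eta> b = df_wedge f \<zeta>"
      using df_wedge_exact_top[OF _ d0] by blast
    \<comment> \<open>The twisted differential of \<zeta> \<tau>^(b-1) has top term -df \<and>
      \<zeta> at \<tau>^b, which cancels the top coefficient of \<eta>; since the differential
      squares to zero, the image is unchanged.\<close>
    define \<xi> where "\<xi> = \<eta> + twisted_d f (psingle (b - 1) \<zeta>)"
    have lx: "plookup (twisted_d f (psingle (b - 1) \<zeta>)) m =
        (if m = b - 1 then ext_deriv \<zeta> else 0) - (if m = b then df_wedge f \<zeta> else 0)" for m
      by (auto simp: lookup_gm lookup_single when_def)
    have "twisted_d f (psingle (b - 1) \<zeta>) \<in> tau_forms (CARD('n) - 1)"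
    proof -
      have "df_wedge f \<zeta> \<in> k_forms (CARD('n) - 1)"
        using z(1) by (intro koszul_penultimate_k_forms) auto
      moreover have "ext_deriv \<zeta> \<in> k_forms (CARD('n) - 1)"
        unfolding ext_deriv_eq_koszul using z(1) by (intro koszul_penultimate_k_forms) auto
      ultimately show ?thesis unfolding tau_forms_def mem_Collect_eq lx
        by (intro allI k_forms_diff) (simp_all only: k_forms_0 simp_thms split: if_split)
    qed
    then have x1: "\<xi> \<in> tau_forms (CARD('n) - 1)" unfolding \<xi>_def using Suc.prems(1) by (intro tau_forms_add)
    have x2: "twisted_d f \<xi> = twisted_d f \<eta>" by (simp add: \<xi>_def twisted_d_add twisted_d_square)
    have "\<forall>m\<ge>K + int B. plookup \<xi> m = 0"
    proof (intro allI impI)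
      fix m assume m: "K + int B \<le> m"
      show "plookup \<xi> m = 0"
      proof (cases "m = b")
        case True
        then show ?thesis unfolding \<xi>_def lookup_add lx by (simp add: z(2))
      next
        case False
        then have "K + int (Suc B) \<le> m" using m by (simp add: b_def)
        then have "plookup \<eta> m = 0" using Suc.prems(3) by blast
        then show ?thesis unfolding \<xi>_def lookup_add lx using False m by (simp add: b_def)
      qed
    qed
    then show ?case using Suc.IH[OF x1] Suc.prems(2) x2 by simp
  qed
  define B where "B = nat (Max (insert 0 ((\<lambda>m. m + 1 - K) ` pkeys \<eta>)))"
  have "\<forall>m\<ge>K + int B. plookup \<eta> m = 0"
  proof (intro allI impI, rule ccontr)
    fix m assume "K + int B \<le> m" "plookup \<eta> m \<noteq> 0"
    then have "m + 1 - K \<le> Max (insert 0 ((\<lambda>m. m + 1 - K) ` pkeys \<eta>))" by (intro Max_ge) (auto simp: in_keys_iff)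
    then have "m + 1 - K \<le> int B" unfolding B_def by linarith
    then show False using \<open>K + int B \<le> m\<close> by linarith
  qed
  from *[OF assms this] show thesis using that by blast
qed

text \<open>As q has no positive powers of \<tau>, the top coefficient of p, at \<tau>^(K+1), comes
  from the primitive of p - q, and after its degree has been cut to at most K this coefficient is a
  multiple of df. Strictness supplies cofactors of the right order, and the resulting relation moves
  the coefficient to \<tau>^K while p stays in \<open>newton_tau T\<close>.\<close>

lemma brieskorn_representative:
  assumes "p \<in> newton_tau T" "q \<in> theta_forms" "p - q \<in> gm_relations f"
  shows "\<exists>p'\<in>newton_tau T. (\<forall>m>0. plookup p' m = 0) \<and> p - p' \<in> gm_relations f"
proof -
  have *: "\<exists>p'\<in>newton_tau T. (\<forall>m>0. plookup p' m = 0) \<and> p - p' \<in> gm_relations f"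
    if "p \<in> newton_tau T" "p - q \<in> gm_relations f" "\<forall>m>int K. plookup p m = 0" for K p
    using that
  proof (induction K arbitrary: p)
    case 0
    then show ?case using gm_relations_0 by (intro bexI[of _ p]) auto
  next
    case (Suc K)
    have q0: "plookup q m = 0" if "m > 0" for m using assms(2) that by (simp add: theta_forms_def)
    obtain \<eta>0 where e0: "\<eta>0 \<in> tau_forms (CARD('n) - 1)" "p - q = twisted_d f \<eta>0"
      using Suc.prems(2) by (auto simp: gm_relations_def)
    have "\<forall>m>int (Suc K). plookup (twisted_d f \<eta>0) m = 0"
      unfolding e0(2)[symmetric] lookup_minus using Suc.prems(3) q0 by auto
    then obtain \<eta> where e: "\<eta> \<in> tau_forms (CARD('n) - 1)" "twisted_d f \<eta> = p - q" "\<forall>m\<ge>int (Suc K). plookup \<eta> m = 0"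
      unfolding e0(2) by (rule primitive_lower_degree[OF e0(1)])
    \<comment> \<open>The minus sign is that of df in the twisted differential; the Koszul sign
      turns the coordinates of the (n-1)-form into the data of an unsigned sum.\<close>
    define h where "h = (\<lambda>i. - (koszul_sign i UNIV * plookup \<eta> (int K) $ (UNIV - {i})))"
    have "plookup p (int (Suc K)) = plookup (p - q) (int (Suc K))" using q0 by (simp add: lookup_minus)
    also have "\<dots> = - df_wedge f (plookup \<eta> (int K))"
      unfolding e(2)[symmetric] using e(3) by (simp add: lookup_twisted_d)
    finally have g: "top_coeff p (int (Suc K)) = (\<Sum>i\<in>UNIV. log_deriv i f * h i)"
      by (simp add: top_coeff_def koszul_def h_def sum_negf mult_ac)
    have gT: "top_coeff p (int (Suc K)) \<in> newton_le (T + int M * int (Suc K))" using Suc.prems(1) unfolding newton_tau_def by blast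
    obtain h' where h': "\<forall>i. h' i \<in> newton_le (T + int M * int (Suc K) - int M)"
        "top_coeff p (int (Suc K)) = (\<Sum>i\<in>UNIV. log_deriv i f * h' i)"
      by (rule df_wedge_strict[OF gT g])
    define d where "d = (\<Sum>i\<in>UNIV. log_deriv i (h' i))"
    define g where "g = top_coeff p (int (Suc K))"
    have rel: "vol_tau d (int K) - vol_tau g (int (Suc K)) \<in> gm_relations f"
      using gm_relation_vol[of h' "int K" f] unfolding d_def g_def unfolding h'(2) unfolding of_nat_Suc by (simp only: add.commute)
    define p1 where "p1 = p + (vol_tau d (int K) - vol_tau g (int (Suc K)))"
    have "T + int M * int (Suc K) - int M = T + int M * int K" by (simp add: algebra_simps)
    with h'(1) have "\<forall>i. h' i \<in> newton_le (T + int M * int K)" by (simp only: simp_thms)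
    then have "d \<in> newton_le (T + int M * int K)" unfolding d_def
      by (intro newton_le_sum newton_le_log_deriv) blast
    moreover have "- g \<in> newton_le (T + int M * int (Suc K))"
      using Suc.prems(1) unfolding g_def newton_tau_def by (intro newton_le_uminus) blast
    ultimately have "vol_tau d (int K) + vol_tau (- g) (int (Suc K)) \<in> newton_tau T"
      by (intro newton_tau_add vol_tau_newton_tau)
    then have p1T: "p1 \<in> newton_tau T" unfolding p1_def
      by (intro newton_tau_add Suc.prems(1)) (simp add: vol_tau_uminus)
    have p1q: "p1 - q \<in> gm_relations f"
      using gm_relations_add[OF Suc.prems(2) rel] by (simp add: p1_def algebra_simps)
    have "plookup p1 m = 0" if m: "m > int K" for m
    proof (cases "m = int (Suc K)")
      case True
      have "plookup p m = g *s vol_form" unfolding g_def True top_coeff_def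
        using Suc.prems(1) by (intro top_form_eq) (auto simp: newton_tau_def tau_forms_def)
      then show ?thesis using True by (simp add: p1_def lookup_add lookup_minus vol_tau_def lookup_single when_def)
    next
      case False
      then have "plookup p m = 0" using Suc.prems(3) m by auto
      then show ?thesis using False m by (simp add: p1_def lookup_add lookup_minus vol_tau_def lookup_single when_def)
    qed
    then obtain p' where p': "p' \<in> newton_tau T" "\<forall>m>0. plookup p' m = 0" "p1 - p' \<in> gm_relations f"
      using Suc.IH[OF p1T p1q] by blast
    have "(p1 - p') - (vol_tau d (int K) - vol_tau g (int (Suc K))) \<in> gm_relations f"
      by (rule gm_relations_diff[OF p'(3) rel])
    then show ?case using p'(1,2) by (intro bexI[of _ p']) (auto simp: p1_def algebra_simps)
  qed
  define K where "K = nat (Max (insert 0 (pkeys p)))"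
  have "\<forall>m>int K. plookup p m = 0"
  proof (intro allI impI, rule ccontr)
    fix m assume "int K < m" "plookup p m \<noteq> 0"
    then have "m \<le> Max (insert 0 (pkeys p))" by (intro Max_ge) (auto simp: in_keys_iff)
    then show False using \<open>int K < m\<close> unfolding K_def by linarith
  qed
  from *[OF assms(1,3) this] show ?thesis .
qed

lemma newton_brieskorn_eq: "newton_brieskorn f \<alpha> = brieskorn f \<inter> MK_filtration f \<alpha>"
  unfolding MK_filtration_eq[OF newton_gm_is_MK]
proof (intro equalityI subsetI IntI)
  fix x assume "x \<in> newton_brieskorn f \<alpha>"
  then obtain p where p: "x = gm_class f p" "p \<in> newton_tau (level \<alpha>)" "\<forall>m>0. plookup p m = 0"
    by (auto simp: newton_brieskorn_def newton_theta_forms_eq)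
  have "p \<in> theta_forms" using p(2,3) by (simp add: theta_forms_def newton_tau_def)
  then show "x \<in> brieskorn f" using p(1) by (simp add: brieskorn_def)
  show "x \<in> newton_gm \<alpha>" using p(1,2) by (simp add: newton_gm_def)
next
  fix x assume "x \<in> brieskorn f \<inter> newton_gm \<alpha>"
  then obtain p q where pq: "x = gm_class f q" "q \<in> theta_forms" "x = gm_class f p" "p \<in> newton_tau (level \<alpha>)"
    by (auto simp: brieskorn_def newton_gm_def)
  then have "p - q \<in> gm_relations f" by (simp flip: gm_class_eq_iff)
  then obtain p' where "p' \<in> newton_tau (level \<alpha>)" "\<forall>m>0. plookup p' m = 0" "p - p' \<in> gm_relations f"
    using brieskorn_representative[OF pq(4,2)] by blast
  then show "x \<in> newton_brieskorn f \<alpha>"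
    unfolding newton_brieskorn_def newton_theta_forms_eq pq(3) by (intro image_eqI[of _ _ p']) (auto simp: gm_class_eq_iff)
qed

end

theorem theorem4p5:
  fixes f :: "'n::{finite,linorder} laurent"
  assumes "convenient f" and "nondegenerate f"
  shows "\<forall>\<alpha>::rat. newton_brieskorn f \<alpha> = brieskorn f \<inter> MK_filtration f \<alpha>"
proof -
  interpret nondegenerate_laurent f by unfold_locales (fact assms)+
  show ?thesis using newton_brieskorn_eq by blast
qed

end
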